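(* For every $n\ge1$, the homology of the multi-pointed partition poset $\Pi_{MP}(n)$ with coefficients in $k$ is the $\mathbb{S}_n$-module $$H_l(\Pi_{MP}(n))\cong\begin{cases}(\mathcal{L}ie\circ\mathcal{M}ag)^*(n)\otimes\mathrm{sgn}_{\mathbb{S}_n}&\text{if } l=n-1,\\0&\text{otherwise.}\end{cases}$$
   Context: $k$ denotes $\mathbb{Z}$, $\mathbb{Q}$, $\mathbb{F}_p$ or a field of characteristic $0$. A multi-pointed partition of $[n]$ is a set partition of $[n]$ in which at least one element of each block is emphasized (pointed). In $\Pi_{MP}(n)$, $\lambda\le\mu$ iff $\mu$ refines $\lambda$ as a partition and, for each block $B$ of $\mu$, either all pointed elements of $B$ remain pointed in $\lambda$ or all of them become unpointed in $\lambda$; $\mathbb{S}_n$ acts by relabelling. $H_l(\Pi)$ is the homology of the complex spanned by chains $\lambda_0<\cdots<\lambda_l$, $\lambda_0$ minimal, $\lambda_l$ maximal, with differential $\sum_{0<i<l}(-1)^id_i$, $d_i$ omitting $\lambda_i$. $\mathcal{L}ie$ is the operad of Lie algebras, $\mathcal{M}ag$ the operad of magmatic algebras (one binary operation, no relations), $\mathcal{L}ie\circ\mathcal{M}ag$ their composition product as $\mathbb{S}$-modules, $(\cdot)^*$ the linear dual and $\mathrm{sgn}_{\mathbb{S}_n}$ the sign representation. *)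

theory Defs
  imports "HOL-Combinatorics.Permutations" "HOL-Computational_Algebra.Primes"
begin

text \<open>k is Z, Q, F_p or a field of characteristic 0 (Q is covered by the last case).\<close>
definition admissible_coeffs :: "'k::comm_ring_1 itself \<Rightarrow> bool" where
  "admissible_coeffs _ \<longleftrightarrow>
     bij (of_int :: int \<Rightarrow> 'k)
   \<or> (\<exists>p::nat. prime p \<and> surj (of_int :: int \<Rightarrow> 'k) \<and> (of_nat p :: 'k) = 0)
   \<or> ((\<forall>x::'k. x \<noteq> 0 \<longrightarrow> (\<exists>y. x * y = 1)) \<and> (\<forall>m::nat. m > 0 \<longrightarrow> (of_nat m :: 'k) \<noteq> 0))"

text \<open>A multi-pointed partition of [n] = {1..n}: a set of pairs (block, pointed elements).\<close>
type_synonym mpart = "(nat set \<times> nat set) set"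

definition is_mp :: "nat \<Rightarrow> mpart \<Rightarrow> bool" where
  "is_mp n lam \<longleftrightarrow>
     (\<forall>(B, P) \<in> lam. P \<noteq> {} \<and> P \<subseteq> B)
   \<and> \<Union> (fst ` lam) = {1..n}
   \<and> (\<forall>x\<in>lam. \<forall>y\<in>lam. x \<noteq> y \<longrightarrow> fst x \<inter> fst y = {})"

definition MP :: "nat \<Rightarrow> mpart set" where
  "MP n = {lam. is_mp n lam}"

text \<open>lam \<le> mu: mu refines lam, and the pointed elements of each block C of lam are exactly
  the pointed elements of some of the blocks of mu contained in C (so for each block B of mu,
  either all its pointed elements stay pointed, or all become unpointed).\<close>
definition mp_le :: "mpart \<Rightarrow> mpart \<Rightarrow> bool" where
  "mp_le lam mu \<longleftrightarrow>
     (\<forall>(B, P) \<in> mu. \<exists>(C, Q) \<in> lam. B \<subseteq> C)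
   \<and> (\<forall>(C, Q) \<in> lam. \<exists>S \<subseteq> {(B, P) \<in> mu. B \<subseteq> C}. Q = \<Union> (snd ` S))"

definition mp_less :: "mpart \<Rightarrow> mpart \<Rightarrow> bool" where
  "mp_less lam mu \<longleftrightarrow> mp_le lam mu \<and> lam \<noteq> mu"

definition mp_minimal :: "nat \<Rightarrow> mpart \<Rightarrow> bool" where
  "mp_minimal n lam \<longleftrightarrow> lam \<in> MP n \<and> \<not> (\<exists>mu\<in>MP n. mp_less mu lam)"

definition mp_maximal :: "nat \<Rightarrow> mpart \<Rightarrow> bool" where
  "mp_maximal n lam \<longleftrightarrow> lam \<in> MP n \<and> \<not> (\<exists>mu\<in>MP n. mp_less lam mu)"

definition mp_relabel :: "(nat \<Rightarrow> nat) \<Rightarrow> mpart \<Rightarrow> mpart" where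
  "mp_relabel s lam = (\<lambda>(B, P). (s ` B, s ` P)) ` lam"

definition chains :: "nat \<Rightarrow> nat \<Rightarrow> mpart list set" where
  "chains n l = {c. length c = Suc l \<and> set c \<subseteq> MP n \<and> sorted_wrt mp_less c
                    \<and> mp_minimal n (hd c) \<and> mp_maximal n (last c)}"

definition del_at :: "nat \<Rightarrow> 'a list \<Rightarrow> 'a list" where
  "del_at i c = take i c @ drop (Suc i) c"

text \<open>Chain module C_l: k-valued functions supported on chains of length l
  (= free k-module on these chains, the set being finite).\<close>
definition Cmod :: "nat \<Rightarrow> nat \<Rightarrow> (mpart list \<Rightarrow> 'k::comm_ring_1) set" where
  "Cmod n l = {f. \<forall>c. c \<notin> chains n l \<longrightarrow> f c = 0}"

definition bd :: "nat \<Rightarrow> nat \<Rightarrow> (mpart list \<Rightarrow> 'k::comm_ring_1) \<Rightarrow> (mpart list \<Rightarrow> 'k)" where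
  "bd n l f = (\<lambda>c'. \<Sum>c\<in>chains n l. \<Sum>i\<in>{1..<l}.
                      if del_at i c = c' then (- 1) ^ i * f c else 0)"

definition cycles :: "nat \<Rightarrow> nat \<Rightarrow> (mpart list \<Rightarrow> 'k::comm_ring_1) set" where
  "cycles n l = {f \<in> Cmod n l. bd n l f = (\<lambda>_. 0)}"

definition boundaries :: "nat \<Rightarrow> nat \<Rightarrow> (mpart list \<Rightarrow> 'k::comm_ring_1) set" where
  "boundaries n l = bd n (Suc l) ` Cmod n (Suc l)"

definition chain_act :: "(nat \<Rightarrow> nat) \<Rightarrow> (mpart list \<Rightarrow> 'k) \<Rightarrow> (mpart list \<Rightarrow> 'k)" where
  "chain_act s f = (\<lambda>c. f (map (mp_relabel (inv s)) c))"

text \<open>Magmatic trees (elements of the free magma); Mag(S) is spanned by trees whose leaves are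
  labelled bijectively by S.\<close>
datatype mtree = Leaf nat | Node mtree mtree

fun leaves :: "mtree \<Rightarrow> nat list" where
  "leaves (Leaf i) = [i]"
| "leaves (Node l r) = leaves l @ leaves r"

fun relabel_tree :: "(nat \<Rightarrow> nat) \<Rightarrow> mtree \<Rightarrow> mtree" where
  "relabel_tree s (Leaf i) = Leaf (s i)"
| "relabel_tree s (Node l r) = Node (relabel_tree s l) (relabel_tree s r)"

text \<open>The free associative algebra over k on the alphabet of trees: functions on words.\<close>
type_synonym 'k tens = "mtree list \<Rightarrow> 'k"

definition word :: "mtree list \<Rightarrow> 'k::comm_ring_1 tens" where
  "word w = (\<lambda>u. if u = w then 1 else 0)"

definition tmult :: "'k::comm_ring_1 tens \<Rightarrow> 'k tens \<Rightarrow> 'k tens" where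
  "tmult a b = (\<lambda>w. \<Sum>i\<le>length w. a (take i w) * b (drop i w))"

definition lie_br :: "'k::comm_ring_1 tens \<Rightarrow> 'k tens \<Rightarrow> 'k tens" where
  "lie_br a b = (\<lambda>w. tmult a b w - tmult b a w)"

inductive lie_mono :: "nat set \<Rightarrow> 'k::comm_ring_1 tens \<Rightarrow> bool" where
  gen: "distinct (leaves t) \<Longrightarrow> lie_mono (set (leaves t)) (word [t])"
| br: "lie_mono A a \<Longrightarrow> lie_mono B b \<Longrightarrow> A \<inter> B = {} \<Longrightarrow> lie_mono (A \<union> B) (lie_br a b)"

definition kspan :: "('b \<Rightarrow> 'k::comm_ring_1) set \<Rightarrow> ('b \<Rightarrow> 'k) set" where
  "kspan X = {v. \<exists>F c. finite F \<and> F \<subseteq> X \<and> v = (\<lambda>w. \<Sum>x\<in>F. c x * x w)}"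

text \<open>(Lie o Mag)(n) \<otimes> k, realised as the multilinear part (in 1..n) of the free Lie algebra
  generated by the free magma.\<close>
definition LieMag :: "nat \<Rightarrow> 'k::comm_ring_1 tens set" where
  "LieMag n = kspan {a. lie_mono {1..n} a}"

definition tens_act :: "(nat \<Rightarrow> nat) \<Rightarrow> 'k tens \<Rightarrow> 'k tens" where
  "tens_act s a = (\<lambda>w. a (map (relabel_tree (inv s)) w))"

definition LieMag_dual :: "nat \<Rightarrow> ('k::comm_ring_1 tens \<Rightarrow> 'k) set" where
  "LieMag_dual n = {f.
     (\<forall>x\<in>LieMag n. \<forall>y\<in>LieMag n. f (\<lambda>w. x w + y w) = f x + f y)
   \<and> (\<forall>r. \<forall>x\<in>LieMag n. f (\<lambda>w. r * x w) = r * f x)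
   \<and> (\<forall>x. x \<notin> LieMag n \<longrightarrow> f x = 0)}"

definition dual_sgn_act :: "nat \<Rightarrow> (nat \<Rightarrow> nat) \<Rightarrow> ('k::comm_ring_1 tens \<Rightarrow> 'k) \<Rightarrow> ('k tens \<Rightarrow> 'k)" where
  "dual_sgn_act n s f =
     (\<lambda>x. if x \<in> LieMag n then of_int (sign s) * f (tens_act (inv s) x) else 0)"

text \<open>H = Z/B is isomorphic, as a k[S_n]-module, to M: there is an S_n-equivariant k-linear
  surjection Z \<rightarrow> M whose kernel is exactly B.\<close>
definition homology_iso ::
  "nat \<Rightarrow> ('a \<Rightarrow> 'k::comm_ring_1) set \<Rightarrow> ('a \<Rightarrow> 'k) set
   \<Rightarrow> ((nat \<Rightarrow> nat) \<Rightarrow> ('a \<Rightarrow> 'k) \<Rightarrow> ('a \<Rightarrow> 'k))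
   \<Rightarrow> ('m \<Rightarrow> 'k) set \<Rightarrow> ((nat \<Rightarrow> nat) \<Rightarrow> ('m \<Rightarrow> 'k) \<Rightarrow> ('m \<Rightarrow> 'k)) \<Rightarrow> bool" where
  "homology_iso n Z B actZ M actM \<longleftrightarrow>
    (\<exists>\<phi>. \<phi> ` Z = M
       \<and> (\<forall>f\<in>Z. \<forall>g\<in>Z. \<phi> (\<lambda>x. f x + g x) = (\<lambda>y. \<phi> f y + \<phi> g y))
       \<and> (\<forall>r. \<forall>f\<in>Z. \<phi> (\<lambda>x. r * f x) = (\<lambda>y. r * \<phi> f y))
       \<and> (\<forall>f\<in>Z. \<phi> f = (\<lambda>_. 0) \<longleftrightarrow> f \<in> B)
       \<and> (\<forall>s. s permutes {1..n} \<longrightarrow> (\<forall>f\<in>Z. \<phi> (actZ s f) = actM s (\<phi> f))))"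

end

theory Submission
  imports Defs
begin

text \<open>
  Read a maximal chain from the partition into singletons downwards, as a sequence of merges of two
  blocks, and label each merge by its minimum, with a minus sign if both pointed sets are kept.
  Every interval contains exactly one chain with increasing labels, so inserting or removing the first
  increasing step is an acyclic matching on chains; the unmatched chains are the falling maximal ones.
  Hence the homology is concentrated in the top degree, where a cycle is determined by its
  arbitrary values on the falling chains.

  A falling chain first builds magmatic trees and then brackets them one by one with the word containing
  1. So falling chains correspond to the left-normed brackets of words of trees whose first letter
  contains 1, which are a basis of \<open>LieMag n\<close>; a Lie element is recovered from its coefficients at
  these words.  This gives the linear isomorphism.

  For equivariance, attach to any chain of merges its signed product (bracket, product of trees).  The
  sign is that of an orientation of the set of blocks, hence relabelling by a permutation multiplies
  by its sign.  On the chains which form trees first, the values of a cycle and these products satisfy the same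
  relations (exchange of disjoint merges, Jacobi), which reduce both to falling chains.
\<close>

section \<open>Discrete Morse theory for chains in a labelled poset\<close>

text \<open>The signs of the labels explain the shape of the falling chains. Labels never increase
  along such a chain, so the products, whose labels are positive, precede the brackets. The last
  merge creates the block of all elements and has label 1 or -1; hence every negative label equals
  -1, and each bracket involves the block of 1. Equivariance meets an obstacle: a cycle gives one
  relation for every interval of length two, but the algebra supports only some of them. Two
  brackets satisfy Jacobi and two disjoint merges can be exchanged, whereas two products on three
  common blocks satisfy no relation, and a product does not distribute over a bracket. The remedy is
  to rewrite a chain only at an ascent and only if no product comes after a bracket. At such an
  ascent there are either two brackets or two disjoint products, so both sides obey the same
  relation. This class of chains is described through pointed sets alone, hence it is stable under
  relabelling, and it is closed under the rewriting.\<close>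

lemma triangular_solve:
  fixes I :: "'x \<Rightarrow> 'y \<Rightarrow> 'k::comm_ring_1" and N :: "'y \<Rightarrow> nat"
  assumes fin: "finite X" "finite U"
    and up: "\<And>c. c \<in> U \<Longrightarrow> up c \<in> X" "\<And>c. c \<in> U \<Longrightarrow> I (up c) c * I (up c) c = 1"
    and tri: "\<And>c d. c \<in> U \<Longrightarrow> d \<in> U \<Longrightarrow> d \<noteq> c \<Longrightarrow> I (up c) d \<noteq> 0 \<Longrightarrow> N d < N c"
  shows "\<exists>g. (\<forall>x. x \<notin> up ` U \<longrightarrow> g x = 0) \<and> (\<forall>d\<in>U. (\<Sum>x\<in>X. I x d * g x) = f d)"
proof -
  \<comment> \<open>Induction on a bound \<open>K\<close> from which on \<open>f\<close> vanishes.
    The unknown of each cell of the top level is fixed by its diagonal entry, which is its own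
    inverse; by triangularity, subtracting its contribution disturbs only lower levels.\<close>
  have step: "\<exists>g. (\<forall>x. x \<notin> up ` U \<longrightarrow> g x = 0) \<and> (\<forall>d\<in>U. (\<Sum>x\<in>X. I x d * g x) = f d)"
    if "\<forall>c\<in>U. K \<le> N c \<longrightarrow> f c = 0" for K f
    using that
  proof (induction K arbitrary: f)
    case 0
    then show ?case by (intro exI[of _ "\<lambda>_. 0"]) auto
  next
    case (Suc K)
    define V where "V = {c \<in> U. N c = K}"
    have finV: "finite V" using fin by (simp add: V_def)
    define g0 where "g0 = (\<lambda>x. \<Sum>c\<in>V. if x = up c then I (up c) c * f c else 0)"
    define f1 where "f1 = (\<lambda>d. \<Sum>x\<in>X. I x d * g0 x)"
    have f1: "f1 d = (\<Sum>c\<in>V. I (up c) d * (I (up c) c * f c))" for d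
    proof -
      have "f1 d = (\<Sum>x\<in>X. \<Sum>c\<in>V. if x = up c then I x d * (I (up c) c * f c) else 0)"
        unfolding f1_def g0_def sum_distrib_left by (intro sum.cong refl) auto
      also have "\<dots> = (\<Sum>c\<in>V. \<Sum>x\<in>X. if x = up c then I x d * (I (up c) c * f c) else 0)"
        by (rule sum.swap)
      also have "\<dots> = (\<Sum>c\<in>V. I (up c) d * (I (up c) c * f c))"
        using up(1) fin(1) by (intro sum.cong refl) (auto simp: V_def)
      finally show ?thesis .
    qed
    have "f d - f1 d = 0" if d: "d \<in> U" "K \<le> N d" for d
    proof -
      have z: "I (up c) d * (I (up c) c * f c) = 0" if "c \<in> V" "c \<noteq> d" for c
        using tri[of c d] that d by (force simp: V_def)
      show ?thesis
      proof (cases "N d = K")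
        case True
        then have "d \<in> V" using d by (simp add: V_def)
        have "f1 d = (\<Sum>c\<in>{d}. I (up c) d * (I (up c) c * f c))"
          unfolding f1 using \<open>d \<in> V\<close> z finV by (intro sum.mono_neutral_right) auto
        also have "\<dots> = (I (up d) d * I (up d) d) * f d" by (simp add: mult.assoc)
        also have "\<dots> = f d" using up(2) d by simp
        finally show ?thesis by simp
      next
        case False
        then have "f d = 0" using Suc.prems d by auto
        moreover have "f1 d = 0" unfolding f1 using z False by (intro sum.neutral) (auto simp: V_def)
        ultimately show ?thesis by simp
      qed
    qed
    then obtain g where g: "\<forall>x. x \<notin> up ` U \<longrightarrow> g x = 0"
      "\<forall>d\<in>U. (\<Sum>x\<in>X. I x d * g x) = f d - f1 d"
      using Suc.IH[of "\<lambda>d. f d - f1 d"] by auto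
    show ?case
    proof (intro exI[of _ "\<lambda>x. g x + g0 x"] conjI allI impI ballI)
      fix x assume "x \<notin> up ` U"
      moreover from this have "g0 x = 0" unfolding g0_def V_def by (intro sum.neutral) auto
      ultimately show "g x + g0 x = 0" using g(1) by simp
    next
      fix d assume "d \<in> U"
      then show "(\<Sum>x\<in>X. I x d * (g x + g0 x)) = f d"
        using g(2) by (simp add: distrib_left sum.distrib flip: f1_def)
          (simp add: f1_def)
    qed
  qed
  show ?thesis
  proof (rule step[of "Suc (Max (insert 0 (N ` U)))"], intro ballI impI)
    fix c assume c: "c \<in> U" "Suc (Max (insert 0 (N ` U))) \<le> N c"
    have "N c \<le> Max (insert 0 (N ` U))" using fin c by (intro Max_ge) auto
    then show "f c = 0" using c by simp
  qed
qed

text \<open>Among the cells whose unknown is nonzero, take one of largest \<open>N\<close>. Its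
  equation contains only its own diagonal term, so this unknown vanishes after all.\<close>

lemma triangular_unique:
  fixes I :: "'x \<Rightarrow> 'y \<Rightarrow> 'k::comm_ring_1" and N :: "'y \<Rightarrow> nat"
  assumes fin: "finite X" "finite U"
    and up: "\<And>c. c \<in> U \<Longrightarrow> up c \<in> X" "\<And>c. c \<in> U \<Longrightarrow> I (up c) c * I (up c) c = 1"
    and tri: "\<And>c d. c \<in> U \<Longrightarrow> d \<in> U \<Longrightarrow> d \<noteq> c \<Longrightarrow> I (up c) d \<noteq> 0 \<Longrightarrow> N d < N c"
    and g: "\<And>x. x \<notin> up ` U \<Longrightarrow> g x = 0" "\<And>d. d \<in> U \<Longrightarrow> (\<Sum>x\<in>X. I x d * g x) = 0"
  shows "g x = 0"
proof (rule ccontr)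
  assume "g x \<noteq> 0"
  define S where "S = {c \<in> U. g (up c) \<noteq> 0}"
  have S: "finite S" "S \<noteq> {}" using fin \<open>g x \<noteq> 0\<close> g(1)[of x] unfolding S_def by auto
  then have "Max (N ` S) \<in> N ` S" by (intro Max_in) auto
  then obtain c where c: "c \<in> S" "N c = Max (N ` S)" by force
  then have cmax: "N d \<le> N c" if "d \<in> S" for d using that S by auto
  have cU: "c \<in> U" using c by (simp add: S_def)
  have "I y c * g y = 0" if y: "y \<in> X" "y \<noteq> up c" for y
  proof (rule ccontr)
    assume a: "I y c * g y \<noteq> 0"
    then have "g y \<noteq> 0" by auto
    then obtain d where d: "d \<in> U" "y = up d" using g(1) by blast
    then have "d \<in> S" using \<open>g y \<noteq> 0\<close> by (simp add: S_def)
    moreover have "d \<noteq> c" using d y by blast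
    moreover have "N c < N d" using tri[of d c] d cU a y by (metis mult_zero_left)
    ultimately show False using cmax by fastforce
  qed
  then have "(\<Sum>y\<in>X. I y c * g y) = (\<Sum>y\<in>{up c}. I y c * g y)"
    using fin up(1)[OF cU] by (intro sum.mono_neutral_right) auto
  then have "I (up c) c * g (up c) = 0" using g(2)[OF cU] by simp
  then have "(I (up c) c * I (up c) c) * g (up c) = 0" by (simp add: mult.assoc)
  then show False using up(2)[OF cU] c by (simp add: S_def)
qed

section \<open>Labelled posets and the matching on their chains\<close>

locale el_poset =
  fixes V :: "'p set" and lt :: "'p \<Rightarrow> 'p \<Rightarrow> bool" and rk :: "'p \<Rightarrow> nat"
    and lab :: "'p \<Rightarrow> 'p \<Rightarrow> int"
  assumes trans: "\<And>x y z. x \<in> V \<Longrightarrow> y \<in> V \<Longrightarrow> z \<in> V \<Longrightarrow> lt x y \<Longrightarrow> lt y z \<Longrightarrow> lt x z"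
    and rk_less: "\<And>x y. x \<in> V \<Longrightarrow> y \<in> V \<Longrightarrow> lt x y \<Longrightarrow> rk x < rk y"
begin

text \<open>The coatoms of the interval from \<open>x\<close> to \<open>y\<close>. Chains are read
  downwards, so these are the possible first steps from \<open>y\<close> towards
  \<open>x\<close>.\<close>

definition cc :: "'p \<Rightarrow> 'p \<Rightarrow> 'p set" where
  "cc x y = {v \<in> V. (v = x \<or> lt x v) \<and> lt v y \<and> Suc (rk v) = rk y}"

definition first :: "'p \<Rightarrow> 'p \<Rightarrow> 'p \<Rightarrow> bool" where
  "first x y v \<longleftrightarrow> v \<in> cc x y \<and> (\<forall>v'\<in>cc x y. v' \<noteq> v \<longrightarrow> lab y v < lab y v')"

definition fst_step :: "'p \<Rightarrow> 'p \<Rightarrow> 'p" where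
  "fst_step x y = (SOME v. first x y v)"

end

text \<open>A local form of edge-lexicographic labellings. Instead of speaking of the unique
  increasing chain of an interval, \<open>ascent\<close> says that a step towards \<open>x\<close>
  is the first one exactly when the first step following it has a larger label.\<close>

locale el_labelling = el_poset V lt rk lab
  for V :: "'p set" and lt rk lab +
  assumes first_ex: "\<And>x y. x \<in> V \<Longrightarrow> y \<in> V \<Longrightarrow> lt x y \<Longrightarrow> \<exists>v. first x y v"
    and ascent: "\<And>x u v w. x \<in> V \<Longrightarrow> u \<in> V \<Longrightarrow> v \<in> V \<Longrightarrow> lt v u \<Longrightarrow> Suc (rk v) = rk u \<Longrightarrow> lt x v
        \<Longrightarrow> first x v w \<Longrightarrow> first x u v \<longleftrightarrow> lab u v < lab v w"
begin

lemma fst_step: "x \<in> V \<Longrightarrow> y \<in> V \<Longrightarrow> lt x y \<Longrightarrow> first x y (fst_step x y)"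
  unfolding fst_step_def using first_ex by (metis someI)

lemma first_unique: "first x y v \<Longrightarrow> first x y v' \<Longrightarrow> v = v'"
  unfolding first_def by (metis less_asym)

lemma fst_step_eq: "x \<in> V \<Longrightarrow> y \<in> V \<Longrightarrow> lt x y \<Longrightarrow> v = fst_step x y \<longleftrightarrow> first x y v"
  using fst_step first_unique by blast

lemma fst_stepD:
  assumes "x \<in> V" "y \<in> V" "lt x y" "v = fst_step x y"
  shows "v \<in> V" "v = x \<or> lt x v" "lt v y" "Suc (rk v) = rk y"
  using fst_step[OF assms(1-3)] assms(4) by (auto simp: first_def cc_def)

lemma fst_step_cover:
  assumes "x \<in> V" "y \<in> V" "lt x y" "Suc (rk x) = rk y"
  shows "fst_step x y = x"
proof -
  note v = fst_stepD[OF assms(1-3) refl]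
  show ?thesis using v rk_less[OF assms(1) v(1)] assms(4) by auto
qed

lemma fst_step_lab_less:
  assumes "x \<in> V" "y \<in> V" "lt x y" "v \<in> cc x y" "v \<noteq> fst_step x y"
  shows "lab y (fst_step x y) < lab y v"
  using fst_step[OF assms(1-3)] assms(4,5) by (auto simp: first_def)

lemma ascent':
  assumes "x \<in> V" "u \<in> V" "v \<in> V" "lt v u" "Suc (rk v) = rk u" "lt x v"
  shows "v = fst_step x u \<longleftrightarrow> lab u v < lab v (fst_step x v)"
  using ascent[OF assms fst_step] fst_step_eq[of x u v] trans[of x v u] assms by blast

fun dchain :: "'p list \<Rightarrow> bool" where
  "dchain [] = True"
| "dchain [y] = (y \<in> V)"
| "dchain (y # z # zs) = (y \<in> V \<and> lt z y \<and> dchain (z # zs))"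

text \<open>The matching. Scanning from the top, the first irregularity decides: a gap receives its
  first step, so the chain is the smaller partner; an element that is the first step of the gap left
  by its own removal makes the chain a larger partner, hence \<open>None\<close>. Chains without
  irregularity also give \<open>None\<close>; \<open>crit\<close> singles them out.\<close>

fun upf :: "'p list \<Rightarrow> 'p list option" where
  "upf (y # z # zs) =
     (if rk y \<noteq> Suc (rk z) then Some (y # fst_step z y # z # zs)
      else if zs = [] \<or> z = fst_step (hd zs) y then None
      else map_option ((#) y) (upf (z # zs)))"
| "upf _ = None"

fun crit :: "'p list \<Rightarrow> bool" where
  "crit (y # z # zs) = (rk y = Suc (rk z) \<and> (zs = [] \<or> z \<noteq> fst_step (hd zs) y) \<and> crit (z # zs))"
| "crit _ = True"

text \<open>The labels along the chain of first steps; the recursion is cut off by the rank, which is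
  large enough on comparable elements.\<close>
fun fill_aux :: "nat \<Rightarrow> 'p \<Rightarrow> 'p \<Rightarrow> int list" where
  "fill_aux 0 x y = []"
| "fill_aux (Suc k) x y = lab y (fst_step x y) # fill_aux k x (fst_step x y)"

definition fill :: "'p \<Rightarrow> 'p \<Rightarrow> int list" where
  "fill x y = fill_aux (rk y - rk x) x y"

text \<open>The label word of the saturated chain obtained by filling every gap with first steps.
  Its lexicographic decrease shows that the matching is acyclic.\<close>

fun wlab :: "'p list \<Rightarrow> int list" where
  "wlab (y # z # zs) = fill z y @ wlab (z # zs)"
| "wlab _ = []"

lemma fill_rec:
  assumes "x \<in> V" "y \<in> V" "lt x y"
  shows "fill x y = lab y (fst_step x y) # fill x (fst_step x y)"
proof -
  have "rk x < rk y" using rk_less assms by auto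
  moreover have "Suc (rk (fst_step x y)) = rk y" using fst_stepD[OF assms refl] by simp
  ultimately obtain k where "rk y - rk x = Suc k" "rk (fst_step x y) - rk x = k"
    by (cases "rk y - rk x") auto
  then show ?thesis by (simp add: fill_def)
qed

lemma fill_self [simp]: "fill x x = []" by (simp add: fill_def)

lemma dchain_V: "dchain (y # ys) \<Longrightarrow> y \<in> V"
  by (cases ys) auto

lemma dchain_lt: "dchain (y # ys) \<Longrightarrow> z \<in> set ys \<Longrightarrow> lt z y \<and> z \<in> V"
proof (induction ys arbitrary: y)
  case (Cons a ys)
  then have a: "y \<in> V" "lt a y" "dchain (a # ys)" by auto
  then have "a \<in> V" using dchain_V by auto
  then show ?case using Cons.IH[of a] a Cons.prems(2) trans by (metis set_ConsD)
qed simp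

lemma dchain_Cons_iff: "dchain (y # zs) \<longleftrightarrow> y \<in> V \<and> (zs = [] \<or> lt (hd zs) y \<and> dchain zs)"
  by (cases zs) auto

lemma dchain_iff_sorted: "dchain C \<longleftrightarrow> set C \<subseteq> V \<and> sorted_wrt (\<lambda>a b. lt b a) C"
proof (induction C rule: dchain.induct)
  case (3 y z zs)
  have "dchain (y # z # zs) \<Longrightarrow> \<forall>w\<in>set (z # zs). lt w y" using dchain_lt by blast
  then show ?case using 3 by auto
qed auto

lemma upf_coverE:
  assumes "upf (y # z # zs) = Some D" "rk y = Suc (rk z)"
  obtains w ws D' where "zs = w # ws" "z \<noteq> fst_step w y" "upf (z # zs) = Some D'" "D = y # D'"
proof (cases zs)
  case Nil
  then show ?thesis using assms by simp
next
  case (Cons w ws)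
  then have ne: "z \<noteq> fst_step w y" using assms by auto
  then have "map_option ((#) y) (upf (z # zs)) = Some D" using assms Cons by simp
  then show ?thesis using that Cons ne by blast
qed

lemma upf_spec:
  assumes "dchain C" "upf C = Some D"
  shows "dchain D \<and> (\<exists>xs v ys. D = xs @ v # ys \<and> C = xs @ ys \<and> xs \<noteq> [] \<and> ys \<noteq> [])"
  using assms
proof (induction C arbitrary: D rule: upf.induct)
  case (1 y z zs)
  have yz: "y \<in> V" "z \<in> V" "lt z y" "dchain (z # zs)" using 1 dchain_V by auto
  show ?case
  proof (cases "rk y = Suc (rk z)")
    case False
    then have D: "D = y # fst_step z y # z # zs" using 1 by simp
    have "fst_step z y \<noteq> z" using False fst_stepD[OF yz(2,1,3) refl] by auto
    then have "dchain D" using yz fst_stepD[OF yz(2,1,3) refl] by (auto simp: D)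
    moreover have "D = [y] @ fst_step z y # (z # zs) \<and> y # z # zs = [y] @ (z # zs)" by (simp add: D)
    ultimately show ?thesis by blast
  next
    case True
    then obtain w ws D' where *: "zs = w # ws" "z \<noteq> fst_step w y" "upf (z # zs) = Some D'" "D = y # D'"
      by (rule upf_coverE[OF 1(3)])
    have IH: "dchain D' \<and> (\<exists>xs v ys. D' = xs @ v # ys \<and> z # zs = xs @ ys \<and> xs \<noteq> [] \<and> ys \<noteq> [])"
      using 1(1)[of D'] True * yz by simp
    then obtain xs v ys where xs: "D' = xs @ v # ys" "z # zs = xs @ ys" "xs \<noteq> []" "ys \<noteq> []" by blast
    have "hd D' = z" using xs by (cases xs) auto
    then have "dchain D" using IH yz xs by (auto simp: * dchain_Cons_iff)
    moreover have "D = (y # xs) @ v # ys \<and> y # z # zs = (y # xs) @ ys" using xs * by simp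
    ultimately show ?thesis using xs by blast
  qed
qed auto

lemma upf_SomeE:
  assumes "dchain (z # zs)" "upf (z # zs) = Some D"
  obtains w ws where "zs = w # ws" "rk z \<noteq> Suc (rk w)" "D = z # fst_step w z # w # ws"
  | w ws ws' where "zs = w # ws" "rk z = Suc (rk w)" "D = z # w # ws'"
proof (cases zs)
  case Nil
  then show ?thesis using assms by simp
next
  case (Cons w ws)
  show ?thesis
  proof (cases "rk z = Suc (rk w)")
    case False
    then show ?thesis using assms that(1) Cons by simp
  next
    case True
    then obtain D' where D': "D = z # D'" "upf (w # ws) = Some D'"
      using upf_coverE[of z w ws D] assms Cons by metis
    have "dchain (w # ws)" using assms Cons by simp
    from upf_spec[OF this D'(2)] obtain xs v ys where "D' = xs @ v # ys" "w # ws = xs @ ys" "xs \<noteq> []"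
      by blast
    then have "\<exists>ws'. D' = w # ws'" by (cases xs) auto
    then show ?thesis using that(2) Cons True D' by blast
  qed
qed

text \<open>By \<open>ascent'\<close>, whether \<open>z\<close> is a first step depends only on the
  label of the first step below \<open>z\<close>, and this step is the same for the targets
  \<open>w\<close> and \<open>fst_step w z\<close>.\<close>

lemma fst_step_cut:
  assumes "w \<in> V" "y \<in> V" "z \<in> V" "lt z y" "rk y = Suc (rk z)" "lt w z"
  shows "z = fst_step (fst_step w z) y \<longleftrightarrow> z = fst_step w y"
proof -
  note t = fst_stepD[OF assms(1,3,6) refl]
  have "fst_step (fst_step w z) z = fst_step w z" using fst_step_cover t assms(3) by simp
  then show ?thesis
    using ascent'[of "fst_step w z" y z] ascent'[of w y z] assms t by simp
qed

text \<open>Acyclicity. If the deleted element lies directly below the inserted first step, or is a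
  non-first step above it, then a larger label is replaced by that of a first step, while the word
  above this place stays the same. A deletion further down leaves the inserted first step removable,
  which \<open>upf\<close> rejects.\<close>

lemma upf_other_facet:
  assumes "dchain C" "upf C = Some D" "D = xs @ v # ys" "xs \<noteq> []" "ys \<noteq> []" "xs @ ys \<noteq> C"
    "upf (xs @ ys) \<noteq> None"
  shows "(wlab (xs @ ys), wlab C) \<in> lexord {(a, b). a < b}"
  using assms
proof (induction C arbitrary: D xs rule: upf.induct)
  case (1 y z zs)
  have yz: "y \<in> V" "z \<in> V" "lt z y" "dchain (z # zs)" using 1(2) dchain_V by auto
  show ?case
  proof (cases "rk y = Suc (rk z)")
    case False
    then have D: "D = y # fst_step z y # z # zs" using 1 by simp
    define s where "s = fst_step z y"
    have s: "s \<in> V" "s = z \<or> lt z s" "lt s y" "Suc (rk s) = rk y"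
      using fst_stepD[OF yz(2,1,3) s_def] by auto
    have sz: "lt z s" using s False by auto
    from 1(4,5) D have "\<exists>xs'. xs = y # xs'" by (cases xs) auto
    then obtain xs' where xs': "xs = y # xs'" by blast
    have eq: "s # z # zs = xs' @ v # ys" using 1(4) D xs' s_def by simp
    show ?thesis
    proof (cases xs')
      case Nil
      then show ?thesis using eq xs' 1(7) by simp
    next
      case (Cons a xs'')
      then have a: "a = s" "z # zs = xs'' @ v # ys" using eq by auto
      show ?thesis
      proof (cases xs'')
        case Nil
        then have v: "v = z" "zs = ys" using a by auto
        obtain w ws where w: "zs = w # ws" using 1(6) v by (cases ys) auto
        have wV: "w \<in> V" "lt w z" using yz w dchain_V by auto
        have ws: "lt w s" using trans[of w z s] wV yz s sz by blast
        have "upf (y # s # w # ws) \<noteq> None" using 1(8) xs' Cons Nil v w a by simp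
        then have ne: "s \<noteq> fst_step w y" using s by (auto split: if_splits)
        \<comment> \<open>If the two first steps agreed, \<open>ascent'\<close> would make
          \<open>s\<close> the first step from \<open>y\<close> towards \<open>w\<close> as well,
          and the new facet could not be enlarged.\<close>
        have ne2: "fst_step z s \<noteq> fst_step w s"
        proof
          assume e: "fst_step z s = fst_step w s"
          have "lab y s < lab s (fst_step z s)" using ascent'[of z y s] s yz sz by (simp add: s_def)
          then have "s = fst_step w y" using ascent'[of w y s] s yz ws wV e by simp
          then show False using ne by simp
        qed
        have "fst_step z s \<in> cc w s"
          using fst_stepD[OF yz(2) s(1) sz refl] wV yz trans[of w z "fst_step z s"]
          by (auto simp: cc_def)
        then have "lab s (fst_step w s) < lab s (fst_step z s)"
          using fst_step_lab_less[OF wV(1) s(1) ws] ne2 by simp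
        moreover have "fill s y = [lab y s]"
          using fill_rec[OF s(1) yz(1) s(3)] fst_step_cover[OF s(1) yz(1) s(3,4)] by simp
        moreover have "fill z y = lab y s # fill z s" using fill_rec[OF yz(2,1,3)] s_def by simp
        moreover have "fill z s = lab s (fst_step z s) # fill z (fst_step z s)"
          using fill_rec[OF yz(2) s(1) sz] .
        moreover have "fill w s = lab s (fst_step w s) # fill w (fst_step w s)"
          using fill_rec[OF wV(1) s(1) ws] .
        moreover have "ys = w # ws" using v w by simp
        ultimately show ?thesis using xs' Cons Nil a(1) v(1) by simp
      next
        case (Cons b xs3)
        then have "upf (xs @ ys) = upf (y # s # z # (xs3 @ ys))" using xs' \<open>xs' = a # xs''\<close> a by simp
        also have "\<dots> = None" using s s_def by simp
        finally show ?thesis using 1(8) by simp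
      qed
    qed
  next
    case True
    then obtain w ws D' where *: "zs = w # ws" "z \<noteq> fst_step w y" "upf (z # zs) = Some D'" "D = y # D'"
      by (rule upf_coverE[OF 1(3)])
    have wV: "w \<in> V" "lt w z" using yz * dchain_V by auto
    from 1(4,5) * obtain xs' where xs': "xs = y # xs'" by (cases xs) auto
    have eq: "D' = xs' @ v # ys" using 1(4) * xs' by simp
    have fz: "fill z y = [lab y z]"
      using fill_rec[OF yz(2,1,3)] fst_step_cover[OF yz(2,1,3)] True by simp
    have shape: "(\<exists>r. D' = z # fst_step w z # r) \<or> (\<exists>r. D' = z # w # r \<and> rk z = Suc (rk w))"
      by (rule upf_SomeE[OF yz(4) *(3)]) (use * in auto)
    show ?thesis
    proof (cases xs')
      case Nil
      then obtain r0 r where r: "ys = r0 # r" "r0 = fst_step w z \<or> r0 = w"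
        using shape eq 1(6) by auto
      have r0V: "r0 \<in> V" "lt r0 z" using r fst_stepD[OF wV(1) yz(2) wV(2) refl] wV by auto
      have ne: "z \<noteq> fst_step r0 y" using r fst_step_cut[of w y z] wV yz * True by auto
      have "z \<in> cc r0 y" using yz r0V True by (simp add: cc_def)
      moreover have r0y: "lt r0 y" using trans r0V yz by blast
      ultimately have "lab y (fst_step r0 y) < lab y z"
        using fst_step_lab_less[of r0 y z] r0V yz ne by simp
      then show ?thesis using xs' Nil r fz fill_rec[OF r0V(1) yz(1) r0y] by simp
    next
      case (Cons a xs'')
      then have a: "a = z" using shape eq by auto
      have ne: "xs'' @ ys \<noteq> []" using 1(6) by simp
      then obtain b r where b: "xs'' @ ys = b # r" by (cases "xs'' @ ys") auto
      have "xs @ ys = y # z # (xs'' @ ys)" using xs' Cons a by simp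
      then have up2: "upf (xs' @ ys) \<noteq> None"
        using 1(8) True b Cons a by (auto split: if_splits)
      have "(wlab (xs' @ ys), wlab (z # zs)) \<in> lexord {(a, b). a < b}"
        using 1(1)[of D' xs'] True * yz eq Cons 1(6) 1(7) xs' up2 by simp
      then show ?thesis using xs' Cons a fz by simp
    qed
  qed
qed auto

text \<open>If the first irregularity is a removable element, deleting it gives the smaller partner.
  In the recursive case the head is put back on the partner of the tail, and
  \<open>fst_step_cut\<close> ensures that this creates no irregularity above the old one.\<close>

lemma chain_trichotomy:
  assumes "dchain C" "C \<noteq> []"
  shows "upf C \<noteq> None \<or> crit C \<or> (\<exists>D. dchain D \<and> upf D = Some C)"
  using assms
proof (induction C rule: upf.induct)
  case (1 y z zs)
  have yz: "y \<in> V" "z \<in> V" "lt z y" "dchain (z # zs)" using 1(2) dchain_V by auto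
  show ?case
  proof (cases "rk y = Suc (rk z)")
    case True
    show ?thesis
    proof (cases zs)
      case Nil
      then show ?thesis using True by simp
    next
      case (Cons w ws)
      have wV: "w \<in> V" "lt w z" using yz Cons dchain_V by auto
      have wy: "lt w y" using wV yz trans by blast
      show ?thesis
      proof (cases "z = fst_step w y")
        case eq: True
        have "rk w < rk z" using rk_less wV yz by blast
        then have "upf (y # w # ws) = Some (y # z # w # ws)" using True eq by simp
        moreover have "dchain (y # w # ws)" using wy yz Cons by simp
        ultimately show ?thesis using Cons by blast
      next
        case False
        consider "upf (z # zs) \<noteq> None" | "crit (z # zs)" | D where "dchain D" "upf D = Some (z # zs)"
          using 1(1) True Cons False yz by auto
        then show ?thesis
        proof cases
          case 1
          then show ?thesis using True False Cons by simp
        next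
          case 2
          then show ?thesis using True False Cons by simp
        next
          case 3
          obtain z' D' where D: "D = z' # D'" using 3 by (cases D) auto
          have "\<exists>w' ws'. D' = w' # ws' \<and> z' = z \<and> (w = w' \<or> w = fst_step w' z)"
          proof (rule upf_SomeE[of z' D' "z # zs"])
            show "dchain (z' # D')" "upf (z' # D') = Some (z # zs)" using 3 D by simp_all
          next
            fix v vs assume "D' = v # vs" "z # zs = z' # fst_step v z' # v # vs"
            then show ?thesis using Cons by simp
          next
            fix v vs vs' assume "D' = v # vs" "z # zs = z' # v # vs'"
            then show ?thesis using Cons by simp
          qed
          then obtain w' ws' where w': "D' = w' # ws'" "z' = z" "w = w' \<or> w = fst_step w' z" by blast
          have w'V: "w' \<in> V" "lt w' z" using 3 D w' dchain_V by auto
          have "z \<noteq> fst_step w' y" using w' False fst_step_cut[of w' y z] w'V yz True by auto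
          then have "upf (y # D) = Some (y # z # zs)" using 3 D w' True by simp
          moreover have "dchain (y # D)" using 3 D w' yz by simp
          ultimately show ?thesis by blast
        qed
      qed
    qed
  next
    case False
    then show ?thesis by simp
  qed
qed simp_all

lemma crit_not_upf:
  assumes "dchain C" "upf C = Some D"
  shows "\<not> crit D"
  using assms
proof (induction C arbitrary: D rule: upf.induct)
  case (1 y z zs)
  have yz: "y \<in> V" "z \<in> V" "lt z y" "dchain (z # zs)" using 1(2) dchain_V by auto
  show ?case
  proof (cases "rk y = Suc (rk z)")
    case True
    then obtain w ws D' where *: "zs = w # ws" "z \<noteq> fst_step w y" "upf (z # zs) = Some D'" "D = y # D'"
      by (rule upf_coverE[OF 1(3)])
    have "\<not> crit D'" using 1(1)[of D'] True * yz by simp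
    moreover have "\<exists>r. D' = z # r" by (rule upf_SomeE[OF yz(4) *(3)]) simp_all
    ultimately show ?thesis using *(4) by (metis crit.simps(1))
  next
    case False
    then have "D = y # fst_step z y # z # zs" using 1(3) by simp
    then show ?thesis by simp
  qed
qed simp_all

lemma crit_covers:
  "crit C \<Longrightarrow> C \<noteq> [] \<Longrightarrow> rk (hd C) + 1 = rk (last C) + length C"
  by (induction C rule: crit.induct) auto

end

section \<open>An edge-lexicographic labelling of the multi-pointed partition poset\<close>

definition pts :: "mpart \<Rightarrow> nat set" where
  "pts x = \<Union> (snd ` x)"

text \<open>The label of a merge is minus the minimum of the new block if both pointed sets survive (a Lie
  bracket) and plus that minimum if one of them is dropped (a magmatic product).\<close>
definition mlab :: "mpart \<Rightarrow> mpart \<Rightarrow> int" where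
  "mlab y x = (let a = int (Min (\<Union> (fst ` (x - y)))) in if pts x = pts y then - a else a)"

abbreviation key :: "nat set \<times> nat set \<Rightarrow> nat" where
  "key b \<equiv> Min (fst b)"

definition mrg :: "mpart \<Rightarrow> nat set \<times> nat set \<Rightarrow> nat set \<times> nat set \<Rightarrow> nat set \<Rightarrow> mpart" where
  "mrg y b c P = insert (fst b \<union> fst c, P) (y - {b, c})"

section \<open>Blocks and the refinement order\<close>

lemma MP_iff:
  "x \<in> MP n \<longleftrightarrow> (\<forall>b\<in>x. snd b \<noteq> {} \<and> snd b \<subseteq> fst b) \<and> \<Union> (fst ` x) = {1..n}
     \<and> (\<forall>b\<in>x. \<forall>c\<in>x. b \<noteq> c \<longrightarrow> fst b \<inter> fst c = {})"
  by (simp add: MP_def is_mp_def case_prod_unfold)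

lemma MP_block:
  assumes "x \<in> MP n" "b \<in> x"
  shows "snd b \<noteq> {}" "snd b \<subseteq> fst b" "fst b \<subseteq> {1..n}" "finite (fst b)" "fst b \<noteq> {}"
proof -
  show "snd b \<noteq> {}" "snd b \<subseteq> fst b" "fst b \<subseteq> {1..n}" using assms by (auto simp: MP_iff)
  then show "finite (fst b)" "fst b \<noteq> {}" by (auto intro: finite_subset)
qed

lemma MP_snd_fst: "x \<in> MP n \<Longrightarrow> b \<in> x \<Longrightarrow> i \<in> snd b \<Longrightarrow> i \<in> fst b"
  using MP_block(2) by blast

lemma MP_disj: "x \<in> MP n \<Longrightarrow> b \<in> x \<Longrightarrow> c \<in> x \<Longrightarrow> i \<in> fst b \<Longrightarrow> i \<in> fst c \<Longrightarrow> b = c"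
  unfolding MP_iff by blast

lemma MP_cover: "x \<in> MP n \<Longrightarrow> i \<in> {1..n} \<Longrightarrow> \<exists>b\<in>x. i \<in> fst b"
  by (auto simp: MP_iff)

lemma finite_MP: "finite (MP n)"
proof (rule finite_subset)
  show "MP n \<subseteq> Pow (Pow {1..n} \<times> Pow {1..n})"
    using MP_block by (fastforce simp: mem_Times_iff)
qed simp

lemma finite_MP_elem: "x \<in> MP n \<Longrightarrow> finite x"
proof (rule finite_subset)
  show "x \<in> MP n \<Longrightarrow> x \<subseteq> Pow {1..n} \<times> Pow {1..n}"
    using MP_block by (fastforce simp: mem_Times_iff)
qed simp

lemma pts_block:
  assumes "x \<in> MP n" "b \<in> x" "i \<in> pts x" "i \<in> fst b"
  shows "i \<in> snd b"
proof -
  obtain c where c: "c \<in> x" "i \<in> snd c" using assms(3) by (auto simp: pts_def)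
  then have "i \<in> fst c" using MP_block(2) assms(1) by blast
  then have "c = b" using MP_disj assms c by blast
  then show ?thesis using c by simp
qed

lemma key_in: "x \<in> MP n \<Longrightarrow> b \<in> x \<Longrightarrow> key b \<in> fst b"
  using MP_block by auto

lemma key_inj: "x \<in> MP n \<Longrightarrow> b \<in> x \<Longrightarrow> c \<in> x \<Longrightarrow> key b = key c \<Longrightarrow> b = c"
  using key_in MP_disj by metis

lemma key_pos: "x \<in> MP n \<Longrightarrow> b \<in> x \<Longrightarrow> 0 < key b"
  using key_in[of x n b] MP_block(3)[of x n b] by (metis Suc_le_eq atLeastAtMost_iff less_eq_Suc_le subsetD One_nat_def)

lemma mp_le_alt:
  "mp_le x y \<longleftrightarrow> (\<forall>b\<in>y. \<exists>c\<in>x. fst b \<subseteq> fst c)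
     \<and> (\<forall>c\<in>x. \<exists>S\<subseteq>{b \<in> y. fst b \<subseteq> fst c}. snd c = \<Union> (snd ` S))"
  by (simp add: mp_le_def case_prod_unfold)

text \<open>Taking for \<open>S\<close> the blocks of \<open>y\<close> whose points survive turns
  the condition on sets of blocks into one condition per block, together with the demand that no
  element becomes newly pointed.\<close>

lemma mp_le_iff:
  assumes x: "x \<in> MP n" and y: "y \<in> MP n"
  shows "mp_le x y \<longleftrightarrow>
    (\<forall>b\<in>y. \<exists>c\<in>x. fst b \<subseteq> fst c \<and> (snd b \<subseteq> snd c \<or> snd b \<inter> snd c = {})) \<and> pts x \<subseteq> pts y"
    (is "_ \<longleftrightarrow> ?R \<and> ?P")
proof
  assume le: "mp_le x y"
  have 1: "\<exists>c\<in>x. fst b \<subseteq> fst c" if "b \<in> y" for b using le that unfolding mp_le_alt by blast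
  have 2: "\<exists>S\<subseteq>{b \<in> y. fst b \<subseteq> fst c}. snd c = \<Union> (snd ` S)" if "c \<in> x" for c
    using le that by (simp add: mp_le_alt)
  show "?R \<and> ?P"
  proof
    show ?R
    proof
      fix b assume b: "b \<in> y"
      obtain c where c: "c \<in> x" "fst b \<subseteq> fst c" using 1 b by blast
      obtain S where S: "S \<subseteq> {b \<in> y. fst b \<subseteq> fst c}" "snd c = \<Union> (snd ` S)" using 2[OF c(1)] by blast
      have "snd b \<subseteq> snd c \<or> snd b \<inter> snd c = {}"
      proof (cases "b \<in> S")
        case False
        have "i \<notin> snd c" if "i \<in> snd b" for i
        proof
          assume "i \<in> snd c"
          then obtain b' where b': "b' \<in> S" "i \<in> snd b'" using S by auto
          then have "b' \<in> y" using S by auto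
          then have "i \<in> fst b'" "i \<in> fst b" using MP_snd_fst[OF y] b' \<open>b' \<in> y\<close> that b by blast+
          then have "b' = b" using MP_disj[OF y \<open>b' \<in> y\<close> b] by blast
          then show False using b' False by simp
        qed
        then show ?thesis by auto
      qed (use S in auto)
      then show "\<exists>c\<in>x. fst b \<subseteq> fst c \<and> (snd b \<subseteq> snd c \<or> snd b \<inter> snd c = {})" using c by blast
    qed
    show ?P
    proof
      fix i assume "i \<in> pts x"
      then obtain c where c: "c \<in> x" "i \<in> snd c" by (auto simp: pts_def)
      obtain S where S: "S \<subseteq> {b \<in> y. fst b \<subseteq> fst c}" "snd c = \<Union> (snd ` S)" using 2[OF c(1)] by blast
      then obtain b where "b \<in> S" "i \<in> snd b" using c(2) by auto
      then show "i \<in> pts y" using S by (auto simp: pts_def)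
    qed
  qed
next
  assume R: "?R \<and> ?P"
  have "\<exists>S\<subseteq>{b \<in> y. fst b \<subseteq> fst c}. snd c = \<Union> (snd ` S)" if c: "c \<in> x" for c
  proof (intro exI conjI)
    let ?S = "{b \<in> y. fst b \<subseteq> fst c \<and> snd b \<subseteq> snd c}"
    show "?S \<subseteq> {b \<in> y. fst b \<subseteq> fst c}" by auto
    show "snd c = \<Union> (snd ` ?S)"
    proof
      show "snd c \<subseteq> \<Union> (snd ` ?S)"
      proof
        fix i assume i: "i \<in> snd c"
        then have "i \<in> pts y" using R c by (auto simp: pts_def)
        then obtain b where b: "b \<in> y" "i \<in> snd b" by (auto simp: pts_def)
        then obtain d where d: "d \<in> x" "fst b \<subseteq> fst d" "snd b \<subseteq> snd d \<or> snd b \<inter> snd d = {}"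
          using R by blast
        have "i \<in> fst b" "i \<in> fst c" using MP_snd_fst[OF y b] MP_snd_fst[OF x c i] by simp_all
        then have "i \<in> fst d" "i \<in> fst c" using d(2) by blast+
        then have "d = c" using MP_disj[OF x d(1) c] by blast
        then have "b \<in> ?S" using b d i by auto
        then show "i \<in> \<Union> (snd ` ?S)" using b by blast
      qed
    qed auto
  qed
  then show "mp_le x y" using R unfolding mp_le_alt by blast
qed

definition cls :: "mpart \<Rightarrow> nat set \<times> nat set \<Rightarrow> nat set \<times> nat set" where
  "cls x b = (THE d. d \<in> x \<and> fst b \<subseteq> fst d)"

text \<open>Survival of the points of \<open>b\<close>. If \<open>x\<close> lies below
  \<open>y\<close> and \<open>b\<close> is a block of \<open>y\<close>, the failure of
  \<open>ty\<close> means that all its points are lost, so every block has one of two types.\<close>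

definition ty :: "mpart \<Rightarrow> nat set \<times> nat set \<Rightarrow> bool" where
  "ty x b \<longleftrightarrow> snd b \<subseteq> snd (cls x b)"

lemma cls_eqI:
  assumes "x \<in> MP n" "d \<in> x" "fst b \<subseteq> fst d" "fst b \<noteq> {}"
  shows "cls x b = d"
  unfolding cls_def using assms MP_disj[OF assms(1)] by (intro the_equality) blast+

lemma cls_props:
  assumes "x \<in> MP n" "y \<in> MP n" "mp_le x y" "b \<in> y"
  shows "cls x b \<in> x" "fst b \<subseteq> fst (cls x b)" "ty x b \<or> snd b \<inter> snd (cls x b) = {}"
proof -
  obtain c where c: "c \<in> x" "fst b \<subseteq> fst c" "snd b \<subseteq> snd c \<or> snd b \<inter> snd c = {}"
    using mp_le_iff[OF assms(1,2)] assms(3,4) by blast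
  moreover have "cls x b = c" using cls_eqI[OF assms(1) c(1,2) MP_block(5)[OF assms(2,4)]] .
  ultimately show "cls x b \<in> x" "fst b \<subseteq> fst (cls x b)" "ty x b \<or> snd b \<inter> snd (cls x b) = {}"
    by (auto simp: ty_def)
qed

lemma cls_surj:
  assumes "x \<in> MP n" "y \<in> MP n" "mp_le x y" "d \<in> x"
  shows "\<exists>b\<in>y. cls x b = d \<and> ty x b"
proof -
  obtain i where i: "i \<in> snd d" using MP_block(1) assms by blast
  then have "i \<in> pts x" using assms by (auto simp: pts_def)
  then have "i \<in> pts y" using mp_le_iff assms by blast
  then obtain b where b: "b \<in> y" "i \<in> snd b" by (auto simp: pts_def)
  note p = cls_props[OF assms(1-3) b(1)]
  have "cls x b = d"
    using MP_disj[OF assms(1) p(1) assms(4), of i] p MP_block(2)[OF assms(2) b(1)]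
      MP_block(2)[OF assms(1,4)] b i by blast
  moreover have "ty x b" using p(3) b i calculation by auto
  ultimately show ?thesis using b by blast
qed

lemma cls_image:
  assumes "x \<in> MP n" "y \<in> MP n" "mp_le x y"
  shows "cls x ` y = x"
proof (intro equalityI subsetI)
  fix d assume "d \<in> cls x ` y"
  then show "d \<in> x" using cls_props(1)[OF assms] by blast
next
  fix d assume "d \<in> x"
  then obtain b where "b \<in> y" "cls x b = d" using cls_surj[OF assms] by blast
  then show "d \<in> cls x ` y" by blast
qed

text \<open>A coarse block that absorbs only one fine block has the same elements, and also the same
  points because some block inside it must survive.\<close>

lemma sole_block_eq:
  assumes "x \<in> MP n" "y \<in> MP n" "mp_le x y" "b \<in> y" "\<And>c. c \<in> y \<Longrightarrow> cls x c = cls x b \<Longrightarrow> c = b"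
  shows "cls x b = b"
proof (rule prod_eqI)
  note p = cls_props[OF assms(1-4)]
  have sub: "i \<in> fst b" if "i \<in> fst (cls x b)" for i
  proof -
    have "i \<in> {1..n}" using that MP_block(3)[OF assms(1) p(1)] by blast
    then obtain c where c: "c \<in> y" "i \<in> fst c" using MP_cover[OF assms(2)] by blast
    then have "cls x c = cls x b"
      using cls_props[OF assms(1-3) c(1)] that MP_disj[OF assms(1) _ p(1)] by blast
    then show ?thesis using assms(5) c by blast
  qed
  show "fst (cls x b) = fst b" using p sub by blast
  obtain c where "c \<in> y" "cls x c = cls x b" "ty x c" using cls_surj[OF assms(1-3) p(1)] by blast
  then have "ty x b" using assms(5) by metis
  then have "snd b \<subseteq> snd (cls x b)" by (simp add: ty_def)
  moreover have "snd (cls x b) \<subseteq> snd b"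
  proof
    fix i assume i: "i \<in> snd (cls x b)"
    then have "i \<in> pts x" using p by (auto simp: pts_def)
    then have "i \<in> pts y" using mp_le_iff assms(1-3) by blast
    moreover have "i \<in> fst b" using i MP_block(2)[OF assms(1) p(1)] sub by blast
    ultimately show "i \<in> snd b" using pts_block[OF assms(2,4)] by blast
  qed
  ultimately show "snd (cls x b) = snd b" by blast
qed

text \<open>\<open>cls x\<close> maps the blocks of \<open>y\<close> onto those of \<open>x\<close>,
  and where it is injective nothing is merged. This makes the number of blocks a rank.\<close>

lemma mp_le_card:
  assumes "x \<in> MP n" "y \<in> MP n" "mp_le x y"
  shows "card x \<le> card y" "card x = card y \<Longrightarrow> x = y"
proof -
  note img = cls_image[OF assms]
  have fin: "finite y" using assms finite_MP_elem by blast
  show "card x \<le> card y" using img card_image_le[OF fin, of "cls x"] by simp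
  assume "card x = card y"
  then have "inj_on (cls x) y" using img fin by (simp add: eq_card_imp_inj_on)
  then have "cls x b = b" if "b \<in> y" for b
    using sole_block_eq[OF assms that] that by (auto dest: inj_onD)
  then show "x = y" using img by auto
qed

lemma mp_le_refl: "x \<in> MP n \<Longrightarrow> mp_le x x"
  using mp_le_iff by blast

lemma mp_le_trans:
  assumes "x \<in> MP n" "y \<in> MP n" "z \<in> MP n" "mp_le x y" "mp_le y z"
  shows "mp_le x z"
proof -
  have px: "pts x \<subseteq> pts y" "pts y \<subseteq> pts z" using assms mp_le_iff by blast+
  have "\<exists>c\<in>x. fst b \<subseteq> fst c \<and> (snd b \<subseteq> snd c \<or> snd b \<inter> snd c = {})" if b: "b \<in> z" for b
  proof -
    note p = cls_props[OF assms(2,3,5) b]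
    note q = cls_props[OF assms(1,2,4) p(1)]
    have "snd b \<subseteq> snd (cls x (cls y b)) \<or> snd b \<inter> snd (cls x (cls y b)) = {}"
    proof (cases "ty y b")
      case True
      then show ?thesis using q(3) unfolding ty_def by blast
    next
      \<comment> \<open>Points lost in \<open>y\<close> are not pointed in any block of
        \<open>y\<close>, so \<open>pts x \<subseteq> pts y\<close> keeps them unpointed in
        \<open>x\<close>.\<close>
      case False
      have "i \<notin> snd (cls x (cls y b))" if i: "i \<in> snd b" for i
      proof
        assume "i \<in> snd (cls x (cls y b))"
        then have "i \<in> pts y" using q(1) px(1) by (auto simp: pts_def)
        moreover have "i \<in> fst (cls y b)" using i p(2) MP_block(2)[OF assms(3) b] by blast
        ultimately have "i \<in> snd (cls y b)" using pts_block[OF assms(2) p(1)] by blast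
        then show False using p(3) False i by blast
      qed
      then show ?thesis by blast
    qed
    then show ?thesis using p q by blast
  qed
  then show ?thesis using mp_le_iff assms px by blast
qed

lemma mp_le_antisym: "x \<in> MP n \<Longrightarrow> y \<in> MP n \<Longrightarrow> mp_le x y \<Longrightarrow> mp_le y x \<Longrightarrow> x = y"
  using mp_le_card by (meson le_antisym)

lemma mp_less_card: "x \<in> MP n \<Longrightarrow> y \<in> MP n \<Longrightarrow> mp_less x y \<Longrightarrow> card x < card y"
  unfolding mp_less_def using mp_le_card by (meson le_neq_implies_less)

lemma mp_less_trans:
  assumes "x \<in> MP n" "y \<in> MP n" "z \<in> MP n" "mp_less x y" "mp_less y z"
  shows "mp_less x z"
  using assms mp_le_trans[of x n y z] mp_less_card[of x n y] mp_less_card[of y n z]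
  unfolding mp_less_def by fastforce

interpretation MPo: el_poset "MP n" mp_less card mlab for n
  by unfold_locales (use mp_less_trans mp_less_card in blast)+

section \<open>Covers are merges of two blocks\<close>

lemma mrg_props:
  assumes y: "y \<in> MP n" and bc: "b \<in> y" "c \<in> y" "b \<noteq> c" and P: "P = snd b \<union> snd c \<or> P = snd b"
  shows "mrg y b c P \<in> MP n" "mp_less (mrg y b c P) y" "Suc (card (mrg y b c P)) = card y"
    "(fst b \<union> fst c, P) \<notin> y"
    "mlab y (mrg y b c P) = (if P = snd b \<union> snd c then - int (min (key b) (key c)) else int (min (key b) (key c)))"
proof -
  let ?N = "(fst b \<union> fst c, P)" and ?v = "mrg y b c P"
  note bb = MP_block[OF y bc(1)] and cb = MP_block[OF y bc(2)]
  show new: "?N \<notin> y"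
  proof
    assume N: "?N \<in> y"
    obtain i where "i \<in> fst b" using bb by blast
    then have "?N = b" using MP_disj[OF y N bc(1), of i] by auto
    moreover obtain i where "i \<in> fst c" using cb by blast
    then have "?N = c" using MP_disj[OF y N bc(2), of i] by auto
    ultimately show False using bc by metis
  qed
  have dis: "fst d \<inter> (fst b \<union> fst c) = {}" if "d \<in> y - {b, c}" for d
    using that bc MP_disj[OF y] by blast
  show v: "?v \<in> MP n"
    unfolding MP_iff
  proof (intro conjI ballI impI)
    fix d assume "d \<in> ?v"
    then show "snd d \<noteq> {}" "snd d \<subseteq> fst d" using y P bb cb by (auto simp: mrg_def MP_iff)
  next
    have "\<Union> (fst ` y) = \<Union> (fst ` ?v)" using bc by (auto simp: mrg_def)
    then show "\<Union> (fst ` ?v) = {1..n}" using y by (simp add: MP_iff)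
  next
    fix d e assume "d \<in> ?v" "e \<in> ?v" "d \<noteq> e"
    then consider "d = ?N" "e \<in> y - {b, c}" | "e = ?N" "d \<in> y - {b, c}" | "d \<in> y" "e \<in> y"
      by (auto simp: mrg_def)
    then show "fst d \<inter> fst e = {}"
    proof cases
      case 1
      then show ?thesis using dis[of e] by (simp add: Int_commute)
    next
      case 2
      then show ?thesis using dis[of d] by simp
    next
      case 3
      then show ?thesis using MP_disj[OF y] \<open>d \<noteq> e\<close> by blast
    qed
  qed
  have fin: "finite y" using finite_MP_elem y by blast
  have "card ?v = Suc (card (y - {b, c}))" using new fin by (simp add: mrg_def)
  moreover have "card (y - {b, c}) = card y - 2" using bc fin by (subst card_Diff_subset) auto
  moreover have "card {b, c} \<le> card y" using bc fin by (intro card_mono) auto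
  ultimately show cardv: "Suc (card ?v) = card y" using bc by simp
  have "\<exists>d\<in>?v. fst e \<subseteq> fst d \<and> (snd e \<subseteq> snd d \<or> snd e \<inter> snd d = {})" if e: "e \<in> y" for e
  proof (cases "e \<in> {b, c}")
    case True
    have "snd b \<inter> snd c = {}" using bb cb bc MP_disj[OF y] by blast
    then have "fst e \<subseteq> fst ?N \<and> (snd e \<subseteq> snd ?N \<or> snd e \<inter> snd ?N = {})" using True P by auto
    then show ?thesis unfolding mrg_def by blast
  next
    case False
    then show ?thesis using e unfolding mrg_def by blast
  qed
  moreover have "pts ?v \<subseteq> pts y" using P bc by (auto simp: pts_def mrg_def)
  ultimately have "mp_le ?v y" using mp_le_iff v y by blast
  moreover have "?v \<noteq> y" using cardv by auto
  ultimately show "mp_less ?v y" by (simp add: mp_less_def)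
  have "?v - y = {?N}" using new by (auto simp: mrg_def)
  moreover have "Min (fst b \<union> fst c) = min (key b) (key c)" using bb cb by (simp add: Min_Un)
  moreover have "pts ?v = pts y \<longleftrightarrow> P = snd b \<union> snd c"
  proof
    assume "P = snd b \<union> snd c" then show "pts ?v = pts y" using bc by (auto simp: pts_def mrg_def)
  next
    assume eq: "pts ?v = pts y"
    show "P = snd b \<union> snd c"
    proof (rule ccontr)
      assume "P \<noteq> snd b \<union> snd c"
      then have P: "P = snd b" using P by blast
      obtain i where i: "i \<in> snd c" using cb by blast
      then have "i \<in> pts ?v" using eq bc by (auto simp: pts_def)
      then obtain d where d: "d \<in> ?v" "i \<in> snd d" by (auto simp: pts_def)
      have ic: "i \<in> fst c" "i \<notin> snd b" using i bb cb bc MP_disj[OF y] by blast+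
      then have "d \<noteq> ?N" using d P by auto
      then have "d \<in> y - {b, c}" using d by (auto simp: mrg_def)
      then show False using dis[of d] ic d MP_block(2)[OF v d(1)] by blast
    qed
  qed
  ultimately show "mlab y ?v = (if P = snd b \<union> snd c then - int (min (key b) (key c)) else int (min (key b) (key c)))"
    by (simp add: mlab_def)
qed

text \<open>As only one block is lost, \<open>cls v\<close> identifies a single pair. A survivor of
  this pair may be called \<open>b\<close>, since merging is symmetric when both pointed sets are
  kept and otherwise keeps that of \<open>b\<close>.\<close>

lemma cover_cases:
  assumes v: "v \<in> MP n" and y: "y \<in> MP n" and le: "mp_le v y" and card: "Suc (card v) = card y"
  obtains b c P where "b \<in> y" "c \<in> y" "b \<noteq> c" "P = snd b \<union> snd c \<or> P = snd b" "v = mrg y b c P"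
proof -
  note res = that
  let ?f = "cls v"
  note img = cls_image[OF v y le]
  have fin: "finite y" using y finite_MP_elem by blast
  have "\<not> inj_on ?f y" using card_image[of ?f y] img card by auto
  then obtain b c where bc: "b \<in> y" "c \<in> y" "b \<noteq> c" "?f b = ?f c" by (auto simp: inj_on_def)
  have wlog: thesis if bc: "b \<in> y" "c \<in> y" "b \<noteq> c" "?f b = ?f c" and tb: "ty v b" for b c
  proof -
    have "y = insert c (y - {c})" using bc by blast
    then have "v = insert (?f c) (?f ` (y - {c}))" using img by (metis image_insert)
    moreover have "?f c \<in> ?f ` (y - {c})" using bc by (metis DiffI imageI singletonD)
    ultimately have img': "?f ` (y - {c}) = v" by (simp add: insert_absorb)
    have "card (y - {c}) = card v" using card bc fin by simp
    then have inj: "inj_on ?f (y - {c})" using img' fin by (simp add: eq_card_imp_inj_on)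
    have other: "?f d = d" if d: "d \<in> y - {b, c}" for d
    proof (rule sole_block_eq[OF v y le])
      show "d \<in> y" using d by simp
      fix e assume e: "e \<in> y" "?f e = ?f d"
      show "e = d"
      proof (cases "e = c")
        case True
        then have "?f b = ?f d" using e bc by simp
        then have "b = d" using inj bc d by (auto dest: inj_onD)
        then show ?thesis using d by simp
      next
        case False
        then show ?thesis using e inj d by (auto dest: inj_onD)
      qed
    qed
    let ?D = "?f b"
    have D: "?D \<in> v" using cls_props(1)[OF v y le bc(1)] .
    have only: "e = b \<or> e = c" if "e \<in> y" "?f e = ?D" for e
    proof (cases "e = c")
      case False
      then show ?thesis using inj_onD[OF inj that(2)] that(1) bc by blast
    qed simp
    have "fst ?D = fst b \<union> fst c"
    proof
      show "fst b \<union> fst c \<subseteq> fst ?D"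
        using cls_props(2)[OF v y le bc(1)] cls_props(2)[OF v y le bc(2)] bc by simp
      show "fst ?D \<subseteq> fst b \<union> fst c"
      proof
        fix i assume i: "i \<in> fst ?D"
        then obtain e where e: "e \<in> y" "i \<in> fst e" using MP_cover[OF y] MP_block(3)[OF v D] by blast
        then have "?f e = ?D" using cls_props[OF v y le e(1)] i MP_disj[OF v _ D] by blast
        then show "i \<in> fst b \<union> fst c" using only e by blast
      qed
    qed
    moreover have "snd ?D = snd b \<union> snd c \<or> snd ?D = snd b"
    proof -
      have sub: "snd ?D \<subseteq> snd b \<union> snd c"
      proof
        fix i assume i: "i \<in> snd ?D"
        then have "i \<in> pts v" using D by (auto simp: pts_def)
        then have "i \<in> pts y" using mp_le_iff[OF v y] le by blast
        moreover have "i \<in> fst b \<union> fst c" using i MP_block(2)[OF v D] calculation \<open>fst ?D = _\<close> by blast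
        ultimately show "i \<in> snd b \<union> snd c" using pts_block[OF y] bc by blast
      qed
      moreover have "snd b \<subseteq> snd ?D" using tb by (simp add: ty_def)
      moreover have "snd c \<subseteq> snd ?D \<or> snd c \<inter> snd ?D = {}"
        using cls_props(3)[OF v y le bc(2)] bc by (simp add: ty_def)
      ultimately show ?thesis by blast
    qed
    moreover have "v = insert ?D (y - {b, c})"
    proof -
      have "v = ?f ` ({b, c} \<union> (y - {b, c}))" using img bc by (metis Un_Diff_cancel empty_subsetI insert_subset sup.absorb_iff2)
      also have "\<dots> = {?D} \<union> ?f ` (y - {b, c})" unfolding image_Un using bc(4) by simp
      also have "?f ` (y - {b, c}) = (\<lambda>d. d) ` (y - {b, c})" using other by (intro image_cong refl)
      also have "{?D} \<union> (\<lambda>d. d) ` (y - {b, c}) = insert ?D (y - {b, c})" by simp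
      finally show ?thesis .
    qed
    ultimately have "v = mrg y b c (snd ?D)" by (metis mrg_def prod.collapse)
    then show thesis using res[of b c "snd ?D"] bc(1-3) \<open>snd ?D = _ \<or> _\<close> by simp
  qed
  have "?f b \<in> v" using cls_props(1)[OF v y le bc(1)] .
  show thesis
  proof (cases "ty v b")
    case True
    then show thesis using wlog bc by blast
  next
    case fb: False
    show thesis
    proof (cases "ty v c")
      case True
      then show thesis using wlog[of c b] bc by metis
    next
      case fc: False
      \<comment> \<open>Some block of the class survives. It collides with \<open>b\<close> too, so
        the argument above applies to \<open>d\<close> and \<open>b\<close>.\<close>
      obtain d where d: "d \<in> y" "?f d = ?f b" "ty v d" using cls_surj[OF v y le \<open>?f b \<in> v\<close>] by blast
      then have ne: "d \<noteq> b" "d \<noteq> c" using fb fc by auto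
      show thesis by (rule wlog[of d b]) (use d bc ne in auto)
    qed
  qed
qed

lemma cls_mrg:
  assumes x: "x \<in> MP n" and y: "y \<in> MP n" and le: "mp_le x (mrg y b c P)"
    and bc: "b \<in> y" "c \<in> y" "b \<noteq> c" and P: "P = snd b \<union> snd c \<or> P = snd b"
  shows "mp_le x y" "cls x b = cls x (fst b \<union> fst c, P)" "cls x c = cls x (fst b \<union> fst c, P)"
    "ty x (fst b \<union> fst c, P) = ty x b" "P = snd b \<union> snd c \<Longrightarrow> ty x b = ty x c"
    "P = snd b \<Longrightarrow> \<not> ty x c"
proof -
  let ?N = "(fst b \<union> fst c, P)"
  note m = mrg_props[OF y bc P]
  have N: "?N \<in> mrg y b c P" by (simp add: mrg_def)
  show le': "mp_le x y" using mp_le_trans[OF x m(1) y le] m(2) by (simp add: mp_less_def)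
  note p = cls_props[OF x m(1) le N]
  show cb: "cls x b = cls x ?N" using p MP_block(5)[OF y bc(1)] by (intro cls_eqI[OF x]) auto
  show cc: "cls x c = cls x ?N" using p MP_block(5)[OF y bc(2)] by (intro cls_eqI[OF x]) auto
  note pb = cls_props(3)[OF x y le' bc(1)] and pc = cls_props(3)[OF x y le' bc(2)]
  note nb = MP_block(1)[OF y bc(1)] and nc = MP_block(1)[OF y bc(2)]
  show tb: "ty x ?N = ty x b" using p(3) P pb nb unfolding ty_def cb by auto
  show "ty x b = ty x c" if "P = snd b \<union> snd c"
    using p(3) pb pc nb nc that unfolding ty_def cb cc by auto
  show "\<not> ty x c" if Pb: "P = snd b"
  proof
    assume "ty x c"
    then have sub: "snd c \<subseteq> snd (cls x ?N)" by (simp add: ty_def cc)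
    obtain i where i: "i \<in> snd c" using nc by blast
    then have "i \<in> pts x" using sub p(1) by (auto simp: pts_def)
    then have "i \<in> pts (mrg y b c P)" using mp_le_iff[OF x m(1)] le by blast
    moreover have "i \<in> fst ?N" using i MP_block(2)[OF y bc(2)] by auto
    ultimately have "i \<in> snd ?N" using pts_block[OF m(1) N] by blast
    then show False using i Pb MP_block(2)[OF y bc(1)] MP_block(2)[OF y bc(2)] MP_disj[OF y bc(1,2)] bc(3) by auto
  qed
qed

lemma left_ne_both:
  assumes "y \<in> MP n" "b \<in> y" "c \<in> y" "b \<noteq> c"
  shows "snd b \<noteq> snd b \<union> snd c"
  using MP_block(1,2)[OF assms(1,2)] MP_block(1,2)[OF assms(1,3)] MP_disj[OF assms(1-3)] assms(4) by blast

text \<open>Together with \<open>cls_mrg\<close> this describes the merges that stay above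
  \<open>x\<close> by types: a bracket needs equal types, a product needs its dropped factor to lose
  its points in \<open>x\<close>.\<close>

lemma mrg_le:
  assumes x: "x \<in> MP n" and y: "y \<in> MP n" and le: "mp_le x y"
    and bc: "b \<in> y" "c \<in> y" "b \<noteq> c" and cl: "cls x b = cls x c"
    and P: "P = snd b \<union> snd c \<and> ty x b = ty x c \<or> P = snd b \<and> \<not> ty x c"
  shows "mp_le x (mrg y b c P)"
proof -
  let ?N = "(fst b \<union> fst c, P)"
  have P': "P = snd b \<union> snd c \<or> P = snd b" using P by blast
  note m = mrg_props[OF y bc P']
  note pb = cls_props[OF x y le bc(1)] and pc = cls_props[OF x y le bc(2)]
  have "\<exists>d\<in>x. fst e \<subseteq> fst d \<and> (snd e \<subseteq> snd d \<or> snd e \<inter> snd d = {})" if "e \<in> mrg y b c P" for e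
  proof (cases "e = ?N")
    case True
    have "fst ?N \<subseteq> fst (cls x b)" using pb pc cl by auto
    moreover have "snd ?N \<subseteq> snd (cls x b) \<or> snd ?N \<inter> snd (cls x b) = {}"
      using pb(3) pc(3) cl P unfolding ty_def by auto
    ultimately show ?thesis using True pb(1) by blast
  next
    case False
    then have "e \<in> y" using that by (auto simp: mrg_def)
    then show ?thesis using mp_le_iff[OF x y] le by blast
  qed
  moreover have "pts x \<subseteq> pts (mrg y b c P)"
  proof
    fix i assume i: "i \<in> pts x"
    then have "i \<in> pts y" using mp_le_iff[OF x y] le by blast
    then obtain e where e: "e \<in> y" "i \<in> snd e" by (auto simp: pts_def)
    show "i \<in> pts (mrg y b c P)"
    proof (cases "e = c \<and> P = snd b")
      case True
      then have "\<not> ty x c" using P left_ne_both[OF y bc] by simp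
      then have "snd c \<inter> snd (cls x c) = {}" using pc by blast
      moreover have "i \<in> snd (cls x c)"
        using pts_block[OF x pc(1) i] True e pc(2) MP_block(2)[OF y bc(2)] by blast
      ultimately show ?thesis using True e by blast
    next
      case False
      then show ?thesis using e P' by (auto simp: pts_def mrg_def)
    qed
  qed
  ultimately show ?thesis using mp_le_iff[OF x m(1)] by blast
qed

section \<open>Merges towards a fixed lower bound and their labels\<close>

definition both_mv :: "mpart \<Rightarrow> mpart \<Rightarrow> nat set \<times> nat set \<Rightarrow> nat set \<times> nat set \<Rightarrow> bool" where
  "both_mv x y b c \<longleftrightarrow> b \<in> y \<and> c \<in> y \<and> b \<noteq> c \<and> cls x b = cls x c \<and> ty x b = ty x c"

definition left_mv :: "mpart \<Rightarrow> mpart \<Rightarrow> nat set \<times> nat set \<Rightarrow> nat set \<times> nat set \<Rightarrow> bool" where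
  "left_mv x y b c \<longleftrightarrow> b \<in> y \<and> c \<in> y \<and> b \<noteq> c \<and> cls x b = cls x c \<and> \<not> ty x c"

lemma both_mv_sym: "both_mv x y b c = both_mv x y c b"
  by (auto simp: both_mv_def)

lemma mrg_both_sym: "mrg y b c (snd b \<union> snd c) = mrg y c b (snd c \<union> snd b)"
  by (simp add: mrg_def insert_commute Un_commute)

lemma cc_both:
  assumes "x \<in> MP n" "y \<in> MP n" "mp_le x y" "both_mv x y b c"
  shows "mrg y b c (snd b \<union> snd c) \<in> MPo.cc n x y"
    "mlab y (mrg y b c (snd b \<union> snd c)) = - int (min (key b) (key c))"
proof -
  have bc: "b \<in> y" "c \<in> y" "b \<noteq> c" "cls x b = cls x c" "ty x b = ty x c"
    using assms(4) by (auto simp: both_mv_def)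
  note m = mrg_props[OF assms(2) bc(1-3), of "snd b \<union> snd c"]
  have "mp_le x (mrg y b c (snd b \<union> snd c))" using mrg_le[OF assms(1-3) bc(1-4)] bc(5) by blast
  then show "mrg y b c (snd b \<union> snd c) \<in> MPo.cc n x y"
    using m by (auto simp: MPo.cc_def mp_less_def)
  show "mlab y (mrg y b c (snd b \<union> snd c)) = - int (min (key b) (key c))" using m by simp
qed

lemma cc_left:
  assumes "x \<in> MP n" "y \<in> MP n" "mp_le x y" "left_mv x y b c"
  shows "mrg y b c (snd b) \<in> MPo.cc n x y"
    "mlab y (mrg y b c (snd b)) = int (min (key b) (key c))"
proof -
  have bc: "b \<in> y" "c \<in> y" "b \<noteq> c" "cls x b = cls x c" "\<not> ty x c"
    using assms(4) by (auto simp: left_mv_def)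
  note m = mrg_props[OF assms(2) bc(1-3), of "snd b"]
  have "mp_le x (mrg y b c (snd b))" using mrg_le[OF assms(1-3) bc(1-4)] bc(5) by blast
  then show "mrg y b c (snd b) \<in> MPo.cc n x y"
    using m by (auto simp: MPo.cc_def mp_less_def)
  show "mlab y (mrg y b c (snd b)) = int (min (key b) (key c))"
    using m left_ne_both[OF assms(2) bc(1-3)] by simp
qed

lemma cc_cases:
  assumes "x \<in> MP n" "y \<in> MP n" "v \<in> MPo.cc n x y"
  obtains b c where "both_mv x y b c" "v = mrg y b c (snd b \<union> snd c)" "key b < key c"
    "mlab y v = - int (key b)"
  | b c where "left_mv x y b c" "v = mrg y b c (snd b)" "mlab y v = int (min (key b) (key c))"
proof -
  have v: "v \<in> MP n" "mp_le x v" "mp_le v y" "Suc (card v) = card y"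
    using assms mp_le_refl by (auto simp: MPo.cc_def mp_less_def)
  obtain b c P where bc: "b \<in> y" "c \<in> y" "b \<noteq> c" "P = snd b \<union> snd c \<or> P = snd b" "v = mrg y b c P"
    using cover_cases[OF v(1) assms(2) v(3,4)] by blast
  note k = cls_mrg[OF assms(1,2) _ bc(1-4)]
  have cl: "cls x b = cls x c" using k(2,3) v(2) bc(5) by simp
  show thesis
  proof (cases "P = snd b")
    case True
    then have mv: "left_mv x y b c" using k(6) v(2) bc cl by (simp add: left_mv_def)
    show thesis by (rule that(2)[OF mv]) (use bc True cc_left[OF assms(1,2) _ mv] mp_le_trans[OF assms(1) v(1) assms(2) v(2,3)] in auto)
  next
    case False
    then have P: "P = snd b \<union> snd c" using bc by blast
    then have mv: "both_mv x y b c" using k(5) v(2) bc cl by (simp add: both_mv_def)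
    have lv: "mlab y v = - int (min (key b) (key c))"
      using cc_both[OF assms(1,2) _ mv] mp_le_trans[OF assms(1) v(1) assms(2) v(2,3)] bc P by auto
    have "key b \<noteq> key c" using key_inj[OF assms(2) bc(1,2)] bc(3) by blast
    then consider "key b < key c" | "key c < key b" by linarith
    then show thesis
    proof cases
      case 1
      then show thesis using that(1)[OF mv] bc P lv by simp
    next
      case 2
      then show thesis using that(1)[of c b] mv bc P lv mrg_both_sym both_mv_sym by simp
    qed
  qed
qed

lemma card_gt_two_blocks:
  assumes "x \<in> MP n" "y \<in> MP n" "mp_less x y"
  shows "\<exists>b\<in>y. \<exists>c\<in>y. b \<noteq> c \<and> cls x b = cls x c"
proof (rule ccontr)
  assume "\<not> ?thesis"
  then have "inj_on (cls x) y" by (auto simp: inj_on_def)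
  moreover have le: "mp_le x y" using assms by (simp add: mp_less_def)
  ultimately have "card y = card x" using card_image[of "cls x" y] cls_image[OF assms(1,2) le] by simp
  then show False using mp_less_card[OF assms] by simp
qed

lemma cc_nonempty:
  assumes "x \<in> MP n" "y \<in> MP n" "mp_less x y"
  shows "MPo.cc n x y \<noteq> {}"
proof -
  have le: "mp_le x y" using assms by (simp add: mp_less_def)
  obtain b c where bc: "b \<in> y" "c \<in> y" "b \<noteq> c" "cls x b = cls x c"
    using card_gt_two_blocks[OF assms] by blast
  then have "both_mv x y b c \<or> left_mv x y b c \<or> left_mv x y c b"
    by (auto simp: both_mv_def left_mv_def)
  then show ?thesis using cc_both[OF assms(1,2) le] cc_left[OF assms(1,2) le] by blast
qed

text \<open>The least label is attained only once. If brackets are possible, it belongs to the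
  largest minimum; two different partners of the same block could be bracketed with each other, with
  a still larger minimum. If no bracket is possible, a class has at most one block of each type, so
  a product is determined by its minimum.\<close>

lemma MP_first_ex:
  assumes x: "x \<in> MP n" and y: "y \<in> MP n" and lt: "mp_less x y"
  shows "\<exists>v. MPo.first n x y v"
proof -
  have le: "mp_le x y" using lt by (simp add: mp_less_def)
  have "finite (MPo.cc n x y)" by (rule finite_subset[OF _ finite_MP]) (auto simp: MPo.cc_def)
  then obtain v where v: "v \<in> MPo.cc n x y" "\<And>v'. v' \<in> MPo.cc n x y \<Longrightarrow> mlab y v \<le> mlab y v'"
    using cc_nonempty[OF assms] by (metis arg_min_if_finite(1) arg_min_if_finite(2) linorder_not_less)
  have bothD: "mlab y v \<le> - int (min (key b) (key c))" if "both_mv x y b c" for b c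
    using v(2) cc_both[OF x y le that] by metis
  have kd: "key b \<noteq> key c" if "b \<in> y" "c \<in> y" "b \<noteq> c" for b c
    using key_inj[OF y] that by blast
  have "v' = v" if v': "v' \<in> MPo.cc n x y" "mlab y v' = mlab y v" for v'
    using x y v(1)
  proof (cases rule: cc_cases)
    case (1 b c)
    note A = this
    show ?thesis using x y v'(1)
    proof (cases rule: cc_cases)
      case (1 b' c')
      have bb: "b \<in> y" "c \<in> y" "b' \<in> y" "c' \<in> y" using A 1 by (auto simp: both_mv_def)
      have "b' = b" using A 1 v' key_inj[OF y] bb by simp
      moreover have "c' = c"
      proof (rule ccontr)
        assume "c' \<noteq> c"
        then have "both_mv x y c c'" using A 1 \<open>b' = b\<close> by (auto simp: both_mv_def)
        from bothD[OF this] show False using A 1 \<open>b' = b\<close> by (simp add: min_def split: if_splits)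
      qed
      ultimately show ?thesis using A 1 by simp
    next
      case (2 b' c')
      have "b \<in> y" using A by (auto simp: both_mv_def)
      then have "0 < key b" using key_pos[OF y] by blast
      then show ?thesis using A 2 v' by linarith
    qed
  next
    case (2 b c)
    note A = this
    have bb: "b \<in> y" "c \<in> y" "b \<noteq> c" "\<not> ty x c" "cls x b = cls x c" using A by (auto simp: left_mv_def)
    have no: False if "both_mv x y d e" for d e
      using bothD[OF that] A(3) key_pos[OF y bb(1)] key_pos[OF y bb(2)] by (simp add: min_def split: if_splits)
    show ?thesis using x y v'(1)
    proof (cases rule: cc_cases)
      case (1 b' c')
      then show ?thesis using no by blast
    next
      case (2 b' c')
      have cc: "b' \<in> y" "c' \<in> y" "b' \<noteq> c'" "\<not> ty x c'" "cls x b' = cls x c'" using 2 by (auto simp: left_mv_def)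
      have tb: "ty x b" "ty x b'" using no[of b c] no[of b' c'] bb cc by (auto simp: both_mv_def)
      have m: "min (key b) (key c) = min (key b') (key c')" using A 2 v' by linarith
      have "b = b' \<or> c = c' \<or> b = c' \<or> c = b'"
        using m key_inj[OF y] bb cc unfolding min_def by (metis (full_types))
      then have "b = b' \<or> c = c'" using tb bb cc by auto
      moreover have "c = c'" if "b = b'" using no[of c c'] bb cc that by (auto simp: both_mv_def)
      moreover have "b = b'" if "c = c'" using no[of b b'] bb cc tb that by (auto simp: both_mv_def)
      ultimately show ?thesis using A 2 by blast
    qed
  qed
  then show ?thesis using v unfolding MPo.first_def by (metis order.not_eq_order_implies_strict)
qed

lemma moves_after_merge:
  assumes x: "x \<in> MP n" and u: "u \<in> MP n" and le: "mp_le x (mrg u b c P)"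
    and bc: "b \<in> u" "c \<in> u" "b \<noteq> c" and P: "P = snd b \<union> snd c \<or> P = snd b"
  defines "N \<equiv> (fst b \<union> fst c, P)" and "v \<equiv> mrg u b c P"
  shows "d \<in> v \<longleftrightarrow> d = N \<or> d \<in> u \<and> d \<noteq> b \<and> d \<noteq> c"
    and "N \<notin> u" "cls x N = cls x b" "ty x N = ty x b" "cls x c = cls x b"
    and "key N = min (key b) (key c)"
proof -
  note m = cls_mrg[OF x u le bc P] and r = mrg_props[OF u bc P]
  show "d \<in> v \<longleftrightarrow> d = N \<or> d \<in> u \<and> d \<noteq> b \<and> d \<noteq> c" by (auto simp: v_def N_def mrg_def)
  show "N \<notin> u" "cls x N = cls x b" "ty x N = ty x b" "cls x c = cls x b"
    using m r by (simp_all add: N_def)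
  show "key N = min (key b) (key c)"
    using MP_block(4,5)[OF u] bc by (simp add: N_def Min_Un)
qed

text \<open>Compare \<open>v\<close> with the first step \<open>t\<close>. A bracket
  \<open>v\<close> that is first leaves only brackets of smaller minimum; if it is not first,
  \<open>t\<close> leaves behind a bracket of at least the same minimum, so no increase follows. A
  product \<open>v\<close> that is first excludes brackets, and the later products avoid the merged
  block and have larger minima; if it is not first, a merge with label at most that of
  \<open>v\<close> remains.\<close>

lemma MP_ascent:
  assumes x: "x \<in> MP n" and u: "u \<in> MP n" and v: "v \<in> MP n" and lt: "mp_less v u"
    and card: "Suc (card v) = card u" and xv: "mp_less x v" and w: "MPo.first n x v w"
  shows "MPo.first n x u v \<longleftrightarrow> mlab u v < mlab v w"
proof -
  have le: "mp_le x v" "mp_le v u" "mp_le x u"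
    using lt xv mp_le_trans[OF x v u] by (auto simp: mp_less_def)
  have vcc: "v \<in> MPo.cc n x u" using v lt card xv by (auto simp: MPo.cc_def)
  have wcc: "w \<in> MPo.cc n x v" and wmin: "\<And>w'. w' \<in> MPo.cc n x v \<Longrightarrow> mlab v w \<le> mlab v w'"
    using w unfolding MPo.first_def by (auto simp: order.order_iff_strict)
  have ku: "key d = key e \<longleftrightarrow> d = e" if "d \<in> u" "e \<in> u" for d e using key_inj[OF u] that by blast
  have xu: "mp_less x u" using mp_less_trans[OF x v u xv lt] .
  obtain t where t: "MPo.first n x u t" using MP_first_ex[OF x u xu] by blast
  have tcc: "t \<in> MPo.cc n x u" and tmin: "\<And>w'. w' \<in> MPo.cc n x u \<Longrightarrow> w' \<noteq> t \<Longrightarrow> mlab u t < mlab u w'"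
    using t unfolding MPo.first_def by auto
  have tuniq: "MPo.first n x u v \<longleftrightarrow> v = t"
    using t tmin vcc unfolding MPo.first_def by (metis less_asym)
  have tboth: "mlab u t \<le> - int (min (key d) (key e))" if "both_mv x u d e" for d e
    using cc_both[OF x u le(3) that] tmin by (metis order.order_iff_strict)
  have tleft: "mlab u t \<le> int (min (key d) (key e))" if "left_mv x u d e" for d e
    using cc_left[OF x u le(3) that] tmin by (metis order.order_iff_strict)
  have wboth: "mlab v w \<le> - int (min (key d) (key e))" if "both_mv x v d e" for d e
    using cc_both[OF x v le(1) that] wmin by metis
  have wleft: "mlab v w \<le> int (min (key d) (key e))" if "left_mv x v d e" for d e
    using cc_left[OF x v le(1) that] wmin by metis
  have kpos: "0 < key d" if "d \<in> u" for d using key_pos[OF u that] .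
  show ?thesis unfolding tuniq using x u vcc
  proof (cases rule: cc_cases)
    case (1 b c)
    note A = this
    have bc: "b \<in> u" "c \<in> u" "b \<noteq> c" "ty x b = ty x c" using A by (auto simp: both_mv_def)
    define N where "N = (fst b \<union> fst c, snd b \<union> snd c)"
    note mv = moves_after_merge[OF x u _ bc(1-3), of "snd b \<union> snd c", folded N_def A(2), OF le(1)]
    have N: "\<And>d. d \<in> v \<longleftrightarrow> d = N \<or> d \<in> u \<and> d \<noteq> b \<and> d \<noteq> c" "N \<notin> u" "cls x N = cls x b"
      "ty x N = ty x b" "cls x c = cls x b" "key N = key b"
      using mv A(3) by auto
    show "v = t \<longleftrightarrow> mlab u v < mlab v w"
    proof
      assume "v = t"
      then have all: "key b \<ge> min (key d) (key e)" if "both_mv x u d e" for d e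
        using tboth[OF that] A(4) unfolding \<open>v = t\<close> by simp
      show "mlab u v < mlab v w" using x v wcc
      proof (cases rule: cc_cases)
        case (1 d e)
        have de: "d \<in> v" "e \<in> v" "d \<noteq> e" "cls x d = cls x e" "ty x d = ty x e"
          using 1 by (auto simp: both_mv_def)
        \<comment> \<open>Such a block \<open>f\<close> could be bracketed with \<open>c\<close>; as
          \<open>v\<close> is the first step, the minimum of that bracket cannot exceed
          \<open>key b\<close>.\<close>
        have other: "key f < key b" if f: "f \<in> u" "f \<noteq> b" "f \<noteq> c" "cls x f = cls x N" "ty x f = ty x N" for f
        proof (rule ccontr)
          assume "\<not> key f < key b"
          then have "key b < key f" using ku[of f b] f bc by auto
          moreover have "both_mv x u c f" using f bc N by (auto simp: both_mv_def)
          ultimately show False using all A by fastforce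
        qed
        have "key d < key b"
        proof (cases "d = N")
          case True
          then have "key e < key b" using other[of e] de N(1)[of e] by auto
          then show ?thesis using 1 True N(6) by simp
        next
          case dN: False
          show ?thesis
          proof (cases "e = N")
            case True
            then show ?thesis using other[of d] de N(1)[of d] dN by auto
          next
            case False
            then have "both_mv x u d e" using de N(1) dN by (auto simp: both_mv_def)
            then have "key d \<le> key b" using all[of d e] 1(3) by simp
            moreover have "key d \<noteq> key b" using de N(1)[of d] dN ku bc by auto
            ultimately show ?thesis by simp
          qed
        qed
        then show ?thesis using A 1 by simp
      next
        case (2 d e)
        then show ?thesis using A kpos[OF bc(1)] by linarith
      qed
    next
      assume as: "mlab u v < mlab v w"
      show "v = t"
      proof (rule ccontr)
        assume "v \<noteq> t"
        then have tv: "mlab u t < - int (key b)" using tmin[OF vcc] A by simp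
        show False using x u tcc
        proof (cases rule: cc_cases)
          case (1 d e)
          have de: "d \<in> u" "e \<in> u" "d \<noteq> e" "cls x d = cls x e" "ty x d = ty x e"
            using 1 by (auto simp: both_mv_def)
          have k: "key b < key d" "key d < key e" using tv 1 by auto
          have db: "d \<noteq> b" "e \<noteq> b" using k by auto
          have NP: "both_mv x v N f" if "f \<in> u" "f \<noteq> b" "f \<noteq> c" "cls x f = cls x c" "ty x f = ty x c" for f
            using that N bc by (auto simp: both_mv_def)
          consider "d = c" | "e = c" | "d \<noteq> c" "e \<noteq> c" by blast
          then show False
          proof cases
            case a: 1
            then have "both_mv x v N e" using de db by (intro NP) auto
            from wboth[OF this] show False using as A N(6) k by simp
          next
            case a: 2
            then have "both_mv x v N d" using de db by (intro NP) auto
            from wboth[OF this] show False using as A N(6) k by simp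
          next
            case 3
            then have "both_mv x v d e" using de db N(1) by (auto simp: both_mv_def)
            from wboth[OF this] show False using as A k by simp
          qed
        next
          case (2 d e)
          then show False using tv by linarith
        qed
      qed
    qed
  next
    case (2 b c)
    note A = this
    have bc: "b \<in> u" "c \<in> u" "b \<noteq> c" "\<not> ty x c" "cls x b = cls x c" using A by (auto simp: left_mv_def)
    define N where "N = (fst b \<union> fst c, snd b)"
    note mv = moves_after_merge[OF x u _ bc(1-3), of "snd b", folded N_def A(2), OF le(1)]
    have N: "\<And>d. d \<in> v \<longleftrightarrow> d = N \<or> d \<in> u \<and> d \<noteq> b \<and> d \<noteq> c" "N \<notin> u" "cls x N = cls x b"
      "ty x N = ty x b" "key N = min (key b) (key c)"
      using mv by auto
    show "v = t \<longleftrightarrow> mlab u v < mlab v w"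
    proof
      assume "v = t"
      have no: False if "both_mv x u d e" for d e
        using tboth[OF that] A(3) kpos[OF bc(1)] kpos[OF bc(2)] unfolding \<open>v = t\<close>
        by (simp add: min_def split: if_splits)
      show "mlab u v < mlab v w" using x v wcc
      proof (cases rule: cc_cases)
        case (1 d e)
        have de: "d \<in> v" "e \<in> v" "d \<noteq> e" "cls x d = cls x e" "ty x d = ty x e"
          using 1 by (auto simp: both_mv_def)
        have False
        proof (cases "d = N")
          case True
          then have "both_mv x u b e" using de N by (auto simp: both_mv_def bc)
          then show False by (rule no)
        next
          case dN: False
          show False
          proof (cases "e = N")
            case True
            then have "both_mv x u b d" using de N dN by (auto simp: both_mv_def bc)
            then show False by (rule no)
          next
            case False
            then have "both_mv x u d e" using de N dN by (auto simp: both_mv_def)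
            then show False by (rule no)
          qed
        qed
        then show ?thesis ..
      next
        case (2 d e)
        have de: "d \<in> v" "e \<in> v" "d \<noteq> e" "cls x d = cls x e" "\<not> ty x e"
          using 2 by (auto simp: left_mv_def)
        have dN: "d \<noteq> N"
        proof
          assume "d = N"
          then have "both_mv x u c e" using de N bc by (auto simp: both_mv_def)
          then show False by (rule no)
        qed
        have eN: "e \<noteq> N"
        proof
          assume "e = N"
          then have "both_mv x u b c" using de N bc by (auto simp: both_mv_def)
          then show False by (rule no)
        qed
        have du: "d \<in> u" "e \<in> u" "d \<noteq> b" "d \<noteq> c" "e \<noteq> b" "e \<noteq> c" using de N(1) dN eN by blast+
        have "left_mv x u d e" using de du by (auto simp: left_mv_def)
        from tleft[OF this] have "min (key b) (key c) \<le> min (key d) (key e)" using A \<open>v = t\<close> by simp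
        moreover have "min (key b) (key c) \<noteq> min (key d) (key e)"
          using du ku bc unfolding min_def by auto
        ultimately have "min (key b) (key c) < min (key d) (key e)" by linarith
        then show ?thesis unfolding A(3) 2(3) of_nat_less_iff .
      qed
    next
      assume as: "mlab u v < mlab v w"
      have nb: False if "both_mv x v d e" for d e using wboth[OF that] as A by linarith
      have nl: False if "left_mv x v d e" "min (key d) (key e) \<le> min (key b) (key c)" for d e
        using wleft[OF that(1)] that(2) as A by linarith
      show "v = t"
      proof (rule ccontr)
        assume "v \<noteq> t"
        then have tv: "mlab u t < int (min (key b) (key c))" using tmin[OF vcc] A by simp
        \<comment> \<open>Two blocks of equal type in one class leave, after the product
          \<open>v\<close>, a merge whose label is at most that of \<open>v\<close>: either a
          bracket, or a product with the merged block, whose key is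
          \<open>min (key b) (key c)\<close>.\<close>
        have bcase: False if de: "d \<in> u" "e \<in> u" "d \<noteq> e" "cls x d = cls x e" "ty x d = ty x e" for d e
        proof -
          have Nf: False if f: "f \<in> u" "f \<noteq> b" "f \<noteq> c" "cls x f = cls x b" "ty x f \<or> \<not> ty x b" for f
          proof (cases "ty x f = ty x b")
            case True
            then have "both_mv x v N f" using f N by (auto simp: both_mv_def)
            then show False by (rule nb)
          next
            case False
            then have "left_mv x v f N" using f N by (auto simp: left_mv_def)
            then show False by (rule nl) (auto simp: N(5) min_def)
          qed
          have Nc: False if f: "f \<in> u" "f \<noteq> b" "f \<noteq> c" "cls x f = cls x b" "ty x b" "\<not> ty x f" for f
          proof -
            have "left_mv x v N f" using f N by (auto simp: left_mv_def)
            then show False by (rule nl) (auto simp: N(5) min_def)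
          qed
          have N3: False if f: "f \<in> u" "f \<noteq> b" "f \<noteq> c" "cls x f = cls x b" for f
            using Nf[OF f] Nc[OF f] by blast
          consider "d \<notin> {b, c}" "e \<notin> {b, c}" | "d \<in> {b, c}" "e \<notin> {b, c}" | "d \<notin> {b, c}" "e \<in> {b, c}"
            | "d \<in> {b, c}" "e \<in> {b, c}" by blast
          then show False
          proof cases
            case 1
            then have "both_mv x v d e" using de N(1) by (auto simp: both_mv_def)
            then show False by (rule nb)
          next
            case 2
            then show False using N3[of e] de bc by auto
          next
            case 3
            then show False using N3[of d] de bc by auto
          next
            case 4
            \<comment> \<open>Here both factors lose their points, so a third block of the class
              survives and takes over the role of \<open>e\<close>.\<close>
            then have "\<not> ty x b" using de bc by auto
            have "cls x b \<in> x" using cls_props(1)[OF x u le(3) bc(1)] .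
            then obtain f where f: "f \<in> u" "cls x f = cls x b" "ty x f" using cls_surj[OF x u le(3)] by blast
            then have "f \<noteq> b" "f \<noteq> c" using \<open>\<not> ty x b\<close> bc by auto
            then show False using N3 f by blast
          qed
        qed
        show False using x u tcc
        proof (cases rule: cc_cases)
          case (1 d e)
          then show False using bcase[of d e] unfolding both_mv_def by blast
        next
          case (2 d e)
          have de: "d \<in> u" "e \<in> u" "d \<noteq> e" "cls x d = cls x e" "\<not> ty x e" using 2 by (auto simp: left_mv_def)
          have ut: "t = mrg u d e (snd d)" using 2 by simp
          have "e \<noteq> b" using bcase[of b c] bc de by auto
          show False
          proof (cases "e = c")
            case True
            then have "d \<noteq> b" using ut A \<open>v \<noteq> t\<close> by auto
            then show False using bcase[of d b] bcase[of b c] bcase[of d c] de bc True by auto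
          next
            case ec: False
            have "d \<noteq> b" using bcase[of c e] bc de ec by auto
            moreover have "d \<noteq> c" using bcase[of c e] bc de ec by auto
            ultimately have "left_mv x v d e" using de N(1) ec \<open>e \<noteq> b\<close> by (auto simp: left_mv_def)
            then show False by (rule nl) (use tv 2 in linarith)
          qed
        qed
      qed
    qed
  qed
qed

interpretation MPl: el_labelling "MP n" mp_less card mlab for n
  by unfold_locales (use MP_first_ex MP_ascent in blast)+

section \<open>Homology of the chain complex\<close>

definition top_mp :: "nat \<Rightarrow> mpart" where
  "top_mp n = (\<lambda>i. ({i}, {i})) ` {1..n}"

lemma top_mp_MP: "top_mp n \<in> MP n"
  by (auto simp: MP_iff top_mp_def)

lemma card_top_mp: "card (top_mp n) = n"
  unfolding top_mp_def by (subst card_image) (auto simp: inj_on_def)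

lemma le_top_mp:
  assumes "x \<in> MP n"
  shows "mp_le x (top_mp n)"
  unfolding mp_le_iff[OF assms top_mp_MP]
proof (intro conjI ballI)
  fix b assume "b \<in> top_mp n"
  then obtain i where i: "i \<in> {1..n}" "b = ({i}, {i})" by (auto simp: top_mp_def)
  then obtain c where "c \<in> x" "i \<in> fst c" using MP_cover[OF assms] by blast
  then show "\<exists>c\<in>x. fst b \<subseteq> fst c \<and> (snd b \<subseteq> snd c \<or> snd b \<inter> snd c = {})" using i by auto
next
  have "pts x \<subseteq> {1..n}"
    using MP_block(2,3)[OF assms] unfolding pts_def by blast
  also have "{1..n} \<subseteq> pts (top_mp n)" by (auto simp: pts_def top_mp_def)
  finally show "pts x \<subseteq> pts (top_mp n)" .
qed

lemma mp_maximal_iff: "mp_maximal n x \<longleftrightarrow> x = top_mp n"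
proof
  assume "mp_maximal n x"
  then show "x = top_mp n"
    using le_top_mp top_mp_MP unfolding mp_maximal_def mp_less_def by blast
next
  assume "x = top_mp n"
  then show "mp_maximal n x"
    using le_top_mp mp_le_antisym top_mp_MP unfolding mp_maximal_def mp_less_def by blast
qed

lemma MP_card_pos: "x \<in> MP n \<Longrightarrow> n \<ge> 1 \<Longrightarrow> 0 < card x"
  using MP_cover[of x n 1] finite_MP_elem[of x n] by (auto simp: card_gt_0_iff)

lemma mp_minimal_iff:
  assumes "n \<ge> 1"
  shows "mp_minimal n x \<longleftrightarrow> x \<in> MP n \<and> card x = 1"
proof
  assume min: "mp_minimal n x"
  then have x: "x \<in> MP n" by (simp add: mp_minimal_def)
  have "\<not> (b \<in> x \<and> c \<in> x \<and> b \<noteq> c)" for b c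
    using mrg_props(1,2)[OF x, of b c "snd b"] min unfolding mp_minimal_def by blast
  then have "card x \<le> 1" using card_le_Suc0_iff_eq[OF finite_MP_elem[OF x]] by auto
  then show "x \<in> MP n \<and> card x = 1" using x MP_card_pos[OF x assms] by simp
next
  assume x: "x \<in> MP n \<and> card x = 1"
  have False if "y \<in> MP n" "mp_less y x" for y
    using mp_less_card[OF that(1) _ that(2)] x MP_card_pos[OF that(1) assms] by simp
  then show "mp_minimal n x" using x unfolding mp_minimal_def by blast
qed

text \<open>The chains of the complex run upwards; reversed, they are the descending lists on which
  the matching acts.\<close>

lemma chains_iff:
  assumes "n \<ge> 1"
  shows "c \<in> chains n l \<longleftrightarrow> length c = Suc l \<and> MPl.dchain n (rev c)
    \<and> card (hd c) = 1 \<and> last c = top_mp n"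
proof -
  have d: "MPl.dchain n (rev c) \<longleftrightarrow> set c \<subseteq> MP n \<and> sorted_wrt mp_less c"
    by (simp add: MPl.dchain_iff_sorted sorted_wrt_rev)
  have "hd c \<in> MP n" if "length c = Suc l" "set c \<subseteq> MP n"
    using that by (cases c) auto
  then show ?thesis unfolding chains_def d mp_maximal_iff mp_minimal_iff[OF assms] by auto
qed

lemma distinct_chain: "c \<in> chains n l \<Longrightarrow> distinct c"
proof -
  assume "c \<in> chains n l"
  then have "set c \<subseteq> MP n" "sorted_wrt mp_less c" by (auto simp: chains_def)
  then show "distinct c" by (induction c) (auto simp: mp_less_def)
qed

lemma finite_chains: "finite (chains n l)"
proof (rule finite_subset)
  show "chains n l \<subseteq> {c. set c \<subseteq> MP n \<and> length c = Suc l}" by (auto simp: chains_def)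
qed (rule finite_lists_length_eq[OF finite_MP])

lemma facet_chain:
  assumes "p @ z # q \<in> chains n (Suc l)" "p \<noteq> []" "q \<noteq> []"
  shows "p @ q \<in> chains n l"
  using assms by (auto simp: chains_def sorted_wrt_append)

section \<open>Incidence coefficients and the differential\<close>

definition inc :: "nat \<Rightarrow> mpart list \<Rightarrow> mpart list \<Rightarrow> 'k::comm_ring_1" where
  "inc l c d = (\<Sum>i\<in>{1..<l}. if del_at i c = d then (- 1) ^ i else 0)"

lemma bd_inc: "bd n l f d = (\<Sum>c\<in>chains n l. inc l c d * f c)"
  unfolding bd_def inc_def sum_distrib_right by (intro sum.cong refl) auto

lemma del_at_append: "del_at (length p) (p @ z # q) = p @ q"
  by (simp add: del_at_def)

lemma length_del_at: "i < length c \<Longrightarrow> length (del_at i c) = length c - 1"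
  by (simp add: del_at_def)

lemma nth_del_at: "i < length c \<Longrightarrow> k < length c - 1 \<Longrightarrow> del_at i c ! k = (if k < i then c ! k else c ! Suc k)"
  by (auto simp: del_at_def nth_append min_def)

lemma del_at_split:
  assumes "length c = Suc l" "i \<in> {1..<l}"
  obtains p z q where "c = p @ z # q" "p \<noteq> []" "q \<noteq> []" "length p = i" "del_at i c = p @ q"
proof -
  have "c = take i c @ c ! i # drop (Suc i) c" using assms by (simp add: id_take_nth_drop)
  moreover have "length (take i c) = i" using assms by simp
  moreover have "take i c \<noteq> []" "drop (Suc i) c \<noteq> []" using assms by auto
  ultimately show thesis using that by (simp add: del_at_def)
qed

text \<open>The entries of the chain are distinct, so only one deletion produces this facet and the
  coefficient is a single sign.\<close>

lemma inc_facet: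
  assumes "distinct (p @ z # q)" "length (p @ z # q) = Suc l" "p \<noteq> []" "q \<noteq> []"
  shows "(inc l (p @ z # q) (p @ q) :: 'k::comm_ring_1) = (- 1) ^ length p"
proof -
  let ?c = "p @ z # q"
  have pos: "i = length p" if i: "i \<in> {1..<l}" "del_at i ?c = p @ q" for i
  proof -
    obtain p' z' q' where *: "?c = p' @ z' # q'" "length p' = i" "del_at i ?c = p' @ q'"
      using del_at_split[OF assms(2) i(1)] by metis
    have eq: "p @ q = p' @ q'" using * i by simp
    have "z \<notin> set (p @ q)" using assms(1) by auto
    then have "z \<notin> set p'" "z \<notin> set q'" using eq by auto
    moreover have "z \<in> set (p' @ z' # q')" using *(1) by (metis in_set_conv_decomp)
    ultimately have "z = z'" by auto
    then have "p = p'" using *(1) \<open>z \<notin> set (p @ q)\<close> append_Cons_eq_iff[of z p q p' q'] by auto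
    then show ?thesis using * by simp
  qed
  then have "(inc l ?c (p @ q) :: 'k) = (\<Sum>i\<in>{1..<l}. if i = length p then (- 1) ^ i else 0)"
    unfolding inc_def
  proof (intro sum.cong refl)
    fix i assume i: "i \<in> {1..<l}"
    have "del_at i ?c = p @ q \<longleftrightarrow> i = length p" using pos[OF i] del_at_append[of p z q] by blast
    then show "(if del_at i ?c = p @ q then (- 1) ^ i else (0 :: 'k)) = (if i = length p then (- 1) ^ i else 0)"
      by simp
  qed
  also have "\<dots> = (- 1) ^ length p" using assms(2-4) by (cases p; cases q) auto
  finally show ?thesis .
qed

lemma inc_nonzero:
  assumes "(inc l c d :: 'k::comm_ring_1) \<noteq> 0" "length c = Suc l"
  obtains p z q where "c = p @ z # q" "d = p @ q" "p \<noteq> []" "q \<noteq> []"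
proof -
  have "\<exists>i\<in>{1..<l}. del_at i c = d"
  proof (rule ccontr)
    assume "\<not> ?thesis"
    then have "(inc l c d :: 'k) = 0" unfolding inc_def by (intro sum.neutral) auto
    then show False using assms(1) by simp
  qed
  then obtain i where i: "i \<in> {1..<l}" "del_at i c = d" by blast
  then show thesis using del_at_split[OF assms(2) i(1)] that by metis
qed

lemma del_at_comm:
  assumes "j < i" "i < length c"
  shows "del_at j (del_at i c) = del_at (i - 1) (del_at j c)"
proof (rule nth_equalityI)
  show "length (del_at j (del_at i c)) = length (del_at (i - 1) (del_at j c))"
    using assms by (simp add: length_del_at)
next
  fix k assume "k < length (del_at j (del_at i c))"
  then have "k < length c - 2" using assms by (simp add: length_del_at)
  then show "del_at j (del_at i c) ! k = del_at (i - 1) (del_at j c) ! k"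
    using assms by (auto simp: nth_del_at length_del_at)
qed

text \<open>The simplicial identity \<open>del_at_comm\<close> pairs the double deletions; it lowers
  one index by one and thereby flips the sign.\<close>

lemma double_deletion_cancels:
  assumes "length c = Suc (Suc l)"
  shows "(\<Sum>i\<in>{1..<Suc l}. \<Sum>j\<in>{1..<l}. if del_at j (del_at i c) = d then (- 1) ^ (i + j) else 0)
    = (0 :: 'k::comm_ring_1)"
proof -
  let ?t = "\<lambda>(i, j). if del_at j (del_at i c) = d then (- 1) ^ (i + j) else (0 :: 'k)"
  let ?S = "{1..<Suc l} \<times> {1..<l}"
  let ?A = "{p \<in> ?S. snd p < fst p}" and ?B = "{p \<in> ?S. fst p \<le> snd p}"
  have "sum ?t ?A = (\<Sum>p\<in>?B. - ?t p)"
  proof (rule sum.reindex_bij_witness[where i = "\<lambda>(i, j). (Suc j, i)" and j = "\<lambda>(i, j). (j, i - 1)"])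
    fix p assume "p \<in> ?A"
    then obtain i j where p: "p = (i, j)" "1 \<le> i" "i < Suc l" "1 \<le> j" "j < l" "j < i" by (cases p) auto
    show "(\<lambda>(i, j). (Suc j, i)) ((\<lambda>(i, j). (j, i - 1)) p) = p"
      "(\<lambda>(i, j). (j, i - 1)) p \<in> ?B" using p by auto
    have "Suc (j + (i - 1)) = i + j" using p by simp
    then have "(- 1) ^ (i + j) = - ((- 1 :: 'k) ^ (j + (i - 1)))" by (metis power_Suc mult_minus1)
    then show "- ?t ((\<lambda>(i, j). (j, i - 1)) p) = ?t p"
      using del_at_comm[of j i c] p assms by simp
  qed auto
  moreover have "sum ?t ?S = sum ?t ?A + sum ?t ?B"
    by (subst sum.union_disjoint[symmetric]) (auto intro!: sum.cong)
  moreover have "(\<Sum>i\<in>{1..<Suc l}. \<Sum>j\<in>{1..<l}. if del_at j (del_at i c) = d then (- 1) ^ (i + j) else 0) = sum ?t ?S"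
    by (subst sum.cartesian_product) simp
  ultimately show ?thesis by (simp add: sum_negf)
qed

lemma inc_inc:
  assumes "c \<in> chains n (Suc l)"
  shows "(\<Sum>e\<in>chains n l. inc l e d * inc (Suc l) c e) = (0 :: 'k::comm_ring_1)"
proof -
  have len: "length c = Suc (Suc l)" using assms by (simp add: chains_def)
  have mem: "del_at i c \<in> chains n l" if "i \<in> {1..<Suc l}" for i
    using del_at_split[OF len that] facet_chain assms by metis
  have "(\<Sum>e\<in>chains n l. inc l e d * (inc (Suc l) c e :: 'k))
      = (\<Sum>e\<in>chains n l. \<Sum>i\<in>{1..<Suc l}. if e = del_at i c then inc l e d * (- 1) ^ i else 0)"
    unfolding inc_def[of "Suc l"] sum_distrib_left by (intro sum.cong refl) auto
  also have "\<dots> = (\<Sum>i\<in>{1..<Suc l}. \<Sum>e\<in>chains n l. if e = del_at i c then inc l e d * (- 1) ^ i else 0)"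
    by (rule sum.swap)
  also have "\<dots> = (\<Sum>i\<in>{1..<Suc l}. inc l (del_at i c) d * (- 1) ^ i)"
    using mem finite_chains by (intro sum.cong refl) (simp add: sum.delta)
  also have "\<dots> = (\<Sum>i\<in>{1..<Suc l}. \<Sum>j\<in>{1..<l}. if del_at j (del_at i c) = d then (- 1) ^ (i + j) else 0)"
    unfolding inc_def sum_distrib_right by (intro sum.cong refl) (auto simp: power_add mult.commute)
  also have "\<dots> = 0" by (rule double_deletion_cancels[OF len])
  finally show ?thesis .
qed

lemma bd_bd: "bd n l (bd n (Suc l) f) = (\<lambda>_. 0 :: 'k::comm_ring_1)"
proof
  fix d
  have "bd n l (bd n (Suc l) f) d
      = (\<Sum>e\<in>chains n l. \<Sum>c\<in>chains n (Suc l). inc l e d * inc (Suc l) c e * f c)"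
    by (simp add: bd_inc sum_distrib_left mult.assoc)
  also have "\<dots> = (\<Sum>c\<in>chains n (Suc l). (\<Sum>e\<in>chains n l. inc l e d * inc (Suc l) c e) * f c)"
    by (subst sum.swap) (simp add: sum_distrib_right)
  also have "\<dots> = 0" by (simp add: inc_inc)
  finally show "bd n l (bd n (Suc l) f) d = 0" .
qed

lemma bd_Cmod: "bd n (Suc l) f \<in> (Cmod n l :: (_ \<Rightarrow> 'k::comm_ring_1) set)"
  unfolding Cmod_def
proof (intro CollectI allI impI)
  fix d assume d: "d \<notin> chains n l"
  have "inc (Suc l) c d = (0 :: 'k)" if "c \<in> chains n (Suc l)" for c
  proof (rule ccontr)
    assume "inc (Suc l) c d \<noteq> (0 :: 'k)"
    moreover have "length c = Suc (Suc l)" using that by (simp add: chains_def)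
    ultimately obtain p z q where "c = p @ z # q" "d = p @ q" "p \<noteq> []" "q \<noteq> []" by (rule inc_nonzero)
    then show False using facet_chain d that by blast
  qed
  then show "bd n (Suc l) f d = 0" unfolding bd_inc by simp
qed

lemma bd_diff: "bd n l (\<lambda>x. f x - g x) d = bd n l f d - bd n l g d"
  by (simp add: bd_inc right_diff_distrib sum_subtractf)

lemma boundaries_subset_cycles:
  "boundaries n l \<subseteq> (cycles n l :: (_ \<Rightarrow> 'k::comm_ring_1) set)"
  unfolding boundaries_def cycles_def using bd_bd bd_Cmod by blast

section \<open>Solving the complex along the matching\<close>

definition Ucell :: "nat \<Rightarrow> nat \<Rightarrow> mpart list set" where
  "Ucell n l = {c \<in> chains n l. MPl.upf n (rev c) \<noteq> None}"

definition upc :: "nat \<Rightarrow> mpart list \<Rightarrow> mpart list" where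
  "upc n c = rev (the (MPl.upf n (rev c)))"

text \<open>The lexicographic position of the label word as a natural number, the form in which the
  triangular systems need it.\<close>

definition wrank :: "nat \<Rightarrow> nat \<Rightarrow> mpart list \<Rightarrow> nat" where
  "wrank n l c = card {d \<in> chains n l. (MPl.wlab n (rev d), MPl.wlab n (rev c)) \<in> lexord {(a, b). a < b}}"

definition falling :: "nat \<Rightarrow> mpart list set" where
  "falling n = {c \<in> chains n (n - 1). MPl.crit n (rev c)}"

lemma wrank_less:
  assumes "d \<in> chains n l" "(MPl.wlab n (rev d), MPl.wlab n (rev c)) \<in> lexord {(a, b). a < b}"
  shows "wrank n l d < wrank n l c"
  unfolding wrank_def
proof (rule psubset_card_mono)
  let ?R = "lexord {(a :: int, b). a < b}"
  show "finite {d \<in> chains n l. (MPl.wlab n (rev d), MPl.wlab n (rev c)) \<in> ?R}" using finite_chains by simp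
  have tr: "trans ?R" by (rule lexord_transI) (auto simp: trans_def)
  have ir: "(x, x) \<notin> ?R" for x by (rule lexord_irreflexive) auto
  show "{e \<in> chains n l. (MPl.wlab n (rev e), MPl.wlab n (rev d)) \<in> ?R}
      \<subset> {e \<in> chains n l. (MPl.wlab n (rev e), MPl.wlab n (rev c)) \<in> ?R}"
    using assms tr ir by (auto simp: psubset_eq dest: transD)
qed

lemma upc_spec:
  assumes "n \<ge> 1" "c \<in> Ucell n l"
  shows "upc n c \<in> chains n (Suc l)" "MPl.upf n (rev c) = Some (rev (upc n c))"
    "\<exists>p z q. upc n c = p @ z # q \<and> c = p @ q \<and> p \<noteq> [] \<and> q \<noteq> []"
proof -
  have c: "c \<in> chains n l" using assms by (simp add: Ucell_def)
  then have dc: "MPl.dchain n (rev c)" using chains_iff[OF assms(1)] by blast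
  show up: "MPl.upf n (rev c) = Some (rev (upc n c))"
    using assms(2) by (auto simp: Ucell_def upc_def)
  have d: "MPl.dchain n (rev (upc n c))" using MPl.upf_spec[OF dc up] by blast
  obtain xs v ys where x: "rev (upc n c) = xs @ v # ys" "rev c = xs @ ys" "xs \<noteq> []" "ys \<noteq> []"
    using MPl.upf_spec[OF dc up] by blast
  then have u: "upc n c = rev ys @ v # rev xs" "c = rev ys @ rev xs"
    by (metis append_assoc append_Cons append_Nil rev.simps(2) rev_append rev_rev_ident) (metis x(2) rev_append rev_rev_ident)
  then show "\<exists>p z q. upc n c = p @ z # q \<and> c = p @ q \<and> p \<noteq> [] \<and> q \<noteq> []" using x by blast
  have "length (upc n c) = Suc (Suc l)" using u c chains_iff[OF assms(1)] by auto
  moreover have "hd (upc n c) = hd c" "last (upc n c) = last c" using u x(3,4) by auto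
  ultimately show "upc n c \<in> chains n (Suc l)" using c d chains_iff[OF assms(1)] by auto
qed

lemma inc_upc:
  assumes "n \<ge> 1" "c \<in> Ucell n l"
  shows "inc (Suc l) (upc n c) c * inc (Suc l) (upc n c) c = (1 :: 'k::comm_ring_1)"
proof -
  obtain p z q where *: "upc n c = p @ z # q" "c = p @ q" "p \<noteq> []" "q \<noteq> []"
    using upc_spec(3)[OF assms] by blast
  have ch: "upc n c \<in> chains n (Suc l)" using upc_spec(1)[OF assms] .
  have "distinct (p @ z # q)" "length (p @ z # q) = Suc (Suc l)"
    using distinct_chain[OF ch] ch by (simp_all add: *(1) chains_def)
  from inc_facet[OF this *(3,4)] have "inc (Suc l) (upc n c) c = (- 1 :: 'k) ^ length p"
    by (simp only: *(1,2)[symmetric])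
  then show ?thesis by (simp flip: power_mult_distrib)
qed

text \<open>This is \<open>MPl.upf_other_facet\<close> in matrix form: the incidence matrix between
  smaller and larger partners is triangular for \<open>wrank\<close>.\<close>

lemma upc_triangular:
  assumes "n \<ge> 1" "c \<in> Ucell n l" "d \<in> Ucell n l" "d \<noteq> c" "inc (Suc l) (upc n c) d \<noteq> (0 :: 'k::comm_ring_1)"
  shows "wrank n l d < wrank n l c"
proof (rule wrank_less)
  have c: "c \<in> chains n l" and d: "d \<in> chains n l" using assms by (auto simp: Ucell_def)
  show "d \<in> chains n l" by (rule d)
  have ch: "upc n c \<in> chains n (Suc l)" using upc_spec(1)[OF assms(1,2)] .
  then have "length (upc n c) = Suc (Suc l)" by (simp add: chains_def)
  with assms(5) obtain p z q where *: "upc n c = p @ z # q" "d = p @ q" "p \<noteq> []" "q \<noteq> []"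
    by (rule inc_nonzero)
  have "(MPl.wlab n (rev q @ rev p), MPl.wlab n (rev c)) \<in> lexord {(a, b). a < b}"
  proof (rule MPl.upf_other_facet)
    show "MPl.dchain n (rev c)" using c chains_iff[OF assms(1)] by blast
    show "MPl.upf n (rev c) = Some (rev (upc n c))" using upc_spec(2)[OF assms(1,2)] .
    show "rev (upc n c) = rev q @ z # rev p" using * by simp
    show "rev q \<noteq> []" "rev p \<noteq> []" using * by auto
    show "rev q @ rev p \<noteq> rev c" using * assms(4) by (metis rev_append rev_rev_ident)
    show "MPl.upf n (rev q @ rev p) \<noteq> None" using assms(3) * by (auto simp: Ucell_def)
  qed
  then show "(MPl.wlab n (rev d), MPl.wlab n (rev c)) \<in> lexord {(a, b). a < b}" using * by simp
qed

lemma finite_Ucell: "finite (Ucell n l)"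
  using finite_chains by (simp add: Ucell_def)

lemma falling_length:
  assumes "n \<ge> 1" "c \<in> chains n l" "MPl.crit n (rev c)"
  shows "l = n - 1"
proof -
  have c: "length c = Suc l" "card (hd c) = 1" "last c = top_mp n"
    using assms(2) chains_iff[OF assms(1)] by auto
  then have "c \<noteq> []" by auto
  then have "card (last c) + 1 = card (hd c) + length c"
    using MPl.crit_covers[OF assms(3)] by (simp add: hd_rev last_rev)
  then show ?thesis using c card_top_mp by simp
qed

lemma chain_cases:
  assumes "n \<ge> 1" "c \<in> chains n l" "c \<notin> Ucell n l" "c \<notin> falling n"
  shows "\<exists>l'. l = Suc l' \<and> c \<in> upc n ` Ucell n l'"
proof -
  have dc: "MPl.dchain n (rev c)" and len: "length c = Suc l" using assms(2) chains_iff[OF assms(1)] by auto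
  have "\<not> MPl.crit n (rev c)" using falling_length[OF assms(1,2)] assms(2,4) by (auto simp: falling_def)
  moreover have "MPl.upf n (rev c) = None" using assms(2,3) by (simp add: Ucell_def)
  moreover have "rev c \<noteq> []" using len by auto
  ultimately obtain D where D: "MPl.dchain n D" "MPl.upf n D = Some (rev c)"
    using MPl.chain_trichotomy[OF dc] by blast
  obtain xs v ys where x: "rev c = xs @ v # ys" "D = xs @ ys" "xs \<noteq> []" "ys \<noteq> []"
    using MPl.upf_spec[OF D] by blast
  then have c: "c = rev ys @ v # rev xs" "rev D = rev ys @ rev xs"
    by (metis append_assoc append_Cons append_Nil rev.simps(2) rev_append rev_rev_ident) (simp add: x(2))
  obtain l' where l': "l = Suc l'" using len c x(3,4) by (cases l) auto
  have "hd (rev D) = hd c" "last (rev D) = last c" using c x(3,4) by auto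
  moreover have "length (rev D) = Suc l'" using len c l' by simp
  ultimately have "rev D \<in> chains n l'"
    using assms(2) D(1) unfolding chains_iff[OF assms(1)] rev_rev_ident by metis
  then have "rev D \<in> Ucell n l'" using D by (simp add: Ucell_def)
  moreover have "upc n (rev D) = c" using D by (simp add: upc_def)
  ultimately show ?thesis using l' by blast
qed

text \<open>Only larger partners can still carry nonzero values, and the cycle equations at their
  smaller partners form a triangular homogeneous system.\<close>

lemma cycle_eq_zero:
  fixes f :: "mpart list \<Rightarrow> 'k::comm_ring_1"
  assumes n: "n \<ge> 1" and f: "f \<in> cycles n l" and zero: "\<And>c. c \<in> Ucell n l \<union> falling n \<Longrightarrow> f c = 0"
  shows "f = (\<lambda>_. 0)"
proof
  have f': "f \<in> Cmod n l" "\<And>d. bd n l f d = 0" using f by (auto simp: cycles_def)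
  fix c
  show "f c = 0"
  proof (cases l)
    \<comment> \<open>There is no lower degree, so no chain of degree 0 is a larger partner.\<close>
    case 0
    then show ?thesis using chain_cases[OF n, of c l] zero[of c] f'(1) by (auto simp: Cmod_def)
  next
    case (Suc l')
    show ?thesis
    proof (rule triangular_unique[where X = "chains n l" and U = "Ucell n l'" and up = "upc n"
          and I = "inc l" and N = "wrank n l'"])
      fix x assume x: "x \<notin> upc n ` Ucell n l'"
      show "f x = 0"
      proof (cases "x \<in> chains n l")
        case True
        then show ?thesis using chain_cases[OF n True] zero[of x] x Suc by blast
      next
        case False
        then show ?thesis using f' by (simp add: Cmod_def)
      qed
    next
      fix d show "(\<Sum>x\<in>chains n l. inc l x d * f x) = 0" using f'(2)[of d] by (simp add: bd_inc)
    qed (use Suc n finite_chains finite_Ucell upc_spec(1) inc_upc upc_triangular in auto)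
  qed
qed

text \<open>The same triangular system with a prescribed right-hand side. The solution is supported
  on larger partners, none of which is falling.\<close>

lemma boundary_matching_Ucell:
  fixes f :: "mpart list \<Rightarrow> 'k::comm_ring_1"
  assumes n: "n \<ge> 1"
  shows "\<exists>g\<in>Cmod n (Suc l). (\<forall>c\<in>falling n. g c = 0) \<and> (\<forall>d\<in>Ucell n l. bd n (Suc l) g d = f d)"
proof -
  obtain g where g: "\<forall>x. x \<notin> upc n ` Ucell n l \<longrightarrow> g x = 0"
    "\<forall>d\<in>Ucell n l. (\<Sum>x\<in>chains n (Suc l). inc (Suc l) x d * g x) = f d"
    using triangular_solve[where X = "chains n (Suc l)" and U = "Ucell n l" and up = "upc n"
          and I = "inc (Suc l) :: _ \<Rightarrow> _ \<Rightarrow> 'k" and N = "wrank n l", OF finite_chains finite_Ucell]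
      upc_spec(1)[OF n] inc_upc[OF n] upc_triangular[OF n] by blast
  have "upc n ` Ucell n l \<subseteq> chains n (Suc l)" using upc_spec(1)[OF n] by blast
  then have "g \<in> Cmod n (Suc l)" using g(1) unfolding Cmod_def by blast
  moreover have "g c = 0" if "c \<in> falling n" for c
  proof -
    have "c \<notin> upc n ` Ucell n l"
    proof
      assume "c \<in> upc n ` Ucell n l"
      then obtain d where d: "d \<in> Ucell n l" "c = upc n d" by blast
      then have "MPl.dchain n (rev d)" using chains_iff[OF n] by (auto simp: Ucell_def)
      then have "\<not> MPl.crit n (rev c)" using MPl.crit_not_upf upc_spec(2)[OF n d(1)] d(2) by blast
      then show False using that by (simp add: falling_def)
    qed
    then show ?thesis using g by blast
  qed
  ultimately show ?thesis using g(2) by (auto simp: bd_inc)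
qed

text \<open>Subtract a boundary so that the cycle vanishes on the smaller partners. Falling chains
  occur only in degree \<open>n - 1\<close>, so \<open>cycle_eq_zero\<close> finishes the
  argument.\<close>

lemma acyclic_below_top:
  assumes n: "n \<ge> 1" and l: "l \<noteq> n - 1"
  shows "(cycles n l :: (mpart list \<Rightarrow> 'k::comm_ring_1) set) = boundaries n l"
proof
  show "cycles n l \<subseteq> (boundaries n l :: (mpart list \<Rightarrow> 'k) set)"
  proof
    fix f :: "mpart list \<Rightarrow> 'k" assume f: "f \<in> cycles n l"
    obtain g where g: "g \<in> Cmod n (Suc l)" "\<forall>d\<in>Ucell n l. bd n (Suc l) g d = f d"
      using boundary_matching_Ucell[OF n] by blast
    have "bd n (Suc l) g \<in> cycles n l" using boundaries_subset_cycles g by (auto simp: boundaries_def)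
    then have "(\<lambda>x. f x - bd n (Suc l) g x) \<in> cycles n l"
      using f by (auto simp: cycles_def Cmod_def bd_diff fun_eq_iff)
    moreover have "f c - bd n (Suc l) g c = 0" if "c \<in> Ucell n l \<union> falling n" for c
    proof (cases "c \<in> Ucell n l")
      case False
      then have "c \<in> falling n" using that by blast
      then have "length c = Suc (n - 1)" by (simp add: falling_def chains_def)
      then have "c \<notin> chains n l" using l by (auto simp: chains_def)
      then show ?thesis using f bd_Cmod[of n l g] by (simp add: cycles_def Cmod_def)
    qed (use g in simp)
    ultimately have "(\<lambda>x. f x - bd n (Suc l) g x) = (\<lambda>_. 0)" by (rule cycle_eq_zero[OF n])
    then have "f = bd n (Suc l) g" by (simp add: fun_eq_iff)
    then show "f \<in> boundaries n l" using g by (auto simp: boundaries_def)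
  qed
qed (rule boundaries_subset_cycles)

lemma chains_above_top:
  assumes n: "n \<ge> 1"
  shows "chains n (Suc (n - 1)) = {}"
  proof (rule ccontr)
    assume "chains n (Suc (n - 1)) \<noteq> {}"
    then obtain c where c: "c \<in> chains n (Suc (n - 1))" by blast
    have gr: "MPl.dchain n C \<Longrightarrow> C \<noteq> [] \<Longrightarrow> card (last C) + length C \<le> card (hd C) + 1" for C
    proof (induction C rule: MPl.dchain.induct)
      case (3 y z zs)
      have "y \<in> MP n" "z \<in> MP n" "mp_less z y" using 3(2) MPl.dchain_V by auto
      then have "card z < card y" using mp_less_card by blast
      then show ?case using 3 by auto
    qed auto
    have "rev c \<noteq> []" "MPl.dchain n (rev c)" using c chains_iff[OF n] by auto
    then have "card (hd c) + length c \<le> card (last c) + 1" using gr[of "rev c"] by (simp add: hd_rev last_rev)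
    then show False using c chains_iff[OF n] card_top_mp by auto
  qed

lemma Ucell_top_empty: "n \<ge> 1 \<Longrightarrow> Ucell n (n - 1) = {}"
  using upc_spec(1) chains_above_top by blast

lemma top_cycle_unique:
  fixes f :: "mpart list \<Rightarrow> 'k::comm_ring_1"
  assumes "n \<ge> 1" "f \<in> cycles n (n - 1)" "\<And>c. c \<in> falling n \<Longrightarrow> f c = 0"
  shows "f = (\<lambda>_. 0)"
  using cycle_eq_zero[OF assms(1,2)] assms(3) Ucell_top_empty[OF assms(1)] by simp

text \<open>Extend the given values by zero and subtract larger partners until the boundary vanishes
  on the smaller partners. The boundary is itself a cycle one degree lower, so by
  \<open>cycle_eq_zero\<close> it vanishes altogether.\<close>

lemma top_cycle_exists:
  fixes u :: "mpart list \<Rightarrow> 'k::comm_ring_1"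
  assumes n: "n \<ge> 1"
  shows "\<exists>f\<in>cycles n (n - 1). \<forall>c\<in>falling n. f c = u c"
proof -
  define f0 where "f0 = (\<lambda>c. if c \<in> falling n then u c else 0)"
  have f0: "f0 \<in> Cmod n (n - 1)" by (auto simp: f0_def Cmod_def falling_def)
  show ?thesis
  proof (cases "n - 1")
    case 0
    have "bd n 0 f0 = (\<lambda>_. 0)" by (simp add: bd_def)
    then have "f0 \<in> cycles n (n - 1)" using f0 0 by (simp add: cycles_def)
    then show ?thesis by (intro bexI[of _ f0]) (simp_all add: f0_def)
  next
    case (Suc l)
    obtain g where g: "g \<in> Cmod n (Suc l)" "\<forall>c\<in>falling n. g c = 0"
      "\<forall>d\<in>Ucell n l. bd n (Suc l) g d = bd n (Suc l) f0 d"
      using boundary_matching_Ucell[OF n] by blast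
    let ?f = "\<lambda>x. f0 x - g x"
    have "bd n (Suc l) ?f = (\<lambda>_. 0)"
    proof (rule cycle_eq_zero[OF n])
      show "bd n (Suc l) ?f \<in> cycles n l" using bd_bd bd_Cmod by (auto simp: cycles_def)
      fix c assume c: "c \<in> Ucell n l \<union> falling n"
      show "bd n (Suc l) ?f c = 0"
      proof (cases "c \<in> Ucell n l")
        case False
        then have "length c = Suc (n - 1)" using c by (auto simp: falling_def chains_def)
        then have "c \<notin> chains n l" using Suc by (auto simp: chains_def)
        then show ?thesis using bd_Cmod[of n l ?f] by (auto simp: Cmod_def)
      qed (use g in \<open>simp add: bd_diff\<close>)
    qed
    then have "?f \<in> cycles n (n - 1)" using f0 g Suc by (auto simp: cycles_def Cmod_def)
    then show ?thesis using g by (intro bexI[of _ ?f]) (auto simp: f0_def)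
  qed
qed

lemma top_boundaries:
  assumes n: "n \<ge> 1"
  shows "boundaries n (n - 1) = {(\<lambda>_. 0 :: 'k::comm_ring_1)}"
proof -
  have z: "bd n (Suc (n - 1)) g = (\<lambda>_. 0)" for g :: "mpart list \<Rightarrow> 'k"
    using chains_above_top[OF n] by (auto simp: bd_inc)
  have "(\<lambda>_. 0) \<in> Cmod n (Suc (n - 1))" by (simp add: Cmod_def)
  then show ?thesis unfolding boundaries_def z by auto
qed

section \<open>The multilinear part of the free Lie algebra on trees\<close>

lemma tmult_Nil: "tmult a b [] = a [] * b []"
  by (simp add: tmult_def)

text \<open>Splitting off the first letter replaces the left factor by its quotient by that letter;
  identities for \<open>tmult\<close> then follow by induction on the word.\<close>

lemma tmult_Cons: "tmult a b (x # w) = a [] * b (x # w) + tmult (\<lambda>u. a (x # u)) b w"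
  by (simp add: tmult_def sum.atMost_Suc_shift del: sum.atMost_Suc)

lemma tmult_lin_left: "tmult (\<lambda>w. r * a w + b w) c = (\<lambda>w. r * tmult a c w + tmult b c w)"
  by (simp add: tmult_def fun_eq_iff sum_distrib_left sum.distrib algebra_simps)

lemma tmult_lin_right: "tmult c (\<lambda>w. r * a w + b w) = (\<lambda>w. r * tmult c a w + tmult c b w)"
  by (simp add: tmult_def fun_eq_iff sum_distrib_left sum.distrib algebra_simps)

lemma tmult_diff_left: "tmult (\<lambda>w. a w - b w) c = (\<lambda>w. tmult a c w - tmult b c w)"
  by (simp add: tmult_def fun_eq_iff sum_subtractf algebra_simps)

lemma tmult_diff_right: "tmult c (\<lambda>w. a w - b w) = (\<lambda>w. tmult c a w - tmult c b w)"
  by (simp add: tmult_def fun_eq_iff sum_subtractf algebra_simps)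

lemma tmult_assoc: "tmult (tmult a b) c w = tmult a (tmult b c) w"
proof (induction w arbitrary: a)
  case Nil
  then show ?case by (simp add: tmult_Nil mult.assoc)
next
  case (Cons x w)
  have "(\<lambda>u. tmult a b (x # u)) = (\<lambda>u. a [] * b (x # u) + tmult (\<lambda>v. a (x # v)) b u)"
    by (simp add: tmult_Cons)
  then have "tmult (tmult a b) c (x # w)
      = a [] * b [] * c (x # w) + (a [] * tmult (\<lambda>u. b (x # u)) c w + tmult (tmult (\<lambda>v. a (x # v)) b) c w)"
    by (simp add: tmult_Cons[of "tmult a b"] tmult_Nil tmult_lin_left)
  then show ?case by (simp add: Cons.IH tmult_Cons[of _ "tmult b c"] tmult_Cons[of b c] algebra_simps)
qed

lemma lie_br_lin_left: "lie_br (\<lambda>w. r * a w + b w) c = (\<lambda>w. r * lie_br a c w + lie_br b c w)"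
  unfolding lie_br_def tmult_lin_left tmult_lin_right by (simp add: algebra_simps)

lemma lie_br_lin_right: "lie_br c (\<lambda>w. r * a w + b w) = (\<lambda>w. r * lie_br c a w + lie_br c b w)"
  unfolding lie_br_def tmult_lin_left tmult_lin_right by (simp add: algebra_simps)

lemma lie_br_swap: "lie_br a b w = - lie_br b a w"
  by (simp add: lie_br_def)

text \<open>Jacobi in the form that turns a bracket nested on the right into left-normed
  ones.\<close>

lemma lie_br_jacobi: "lie_br c (lie_br a b) w = lie_br (lie_br c a) b w - lie_br (lie_br c b) a w"
  by (simp add: lie_br_def tmult_diff_left tmult_diff_right tmult_assoc algebra_simps)

lemma tmult_zero_left: "tmult (\<lambda>_. 0) b = (\<lambda>_. 0)"
  by (simp add: tmult_def)

lemma tmult_unit_left: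
  fixes b :: "'k::comm_ring_1 tens"
  shows "tmult (word []) b u = b u"
proof (cases u)
  case (Cons y u')
  have "(\<lambda>u. word [] (y # u)) = (\<lambda>_. 0 :: 'k)" by (simp add: word_def)
  then have "tmult (word []) b u = word [] [] * b (y # u')" by (simp add: Cons tmult_Cons tmult_zero_left)
  then show ?thesis by (simp add: word_def Cons)
qed (simp add: tmult_Nil word_def)

lemma tmult_letter_left: "tmult (word [v]) b w = (case w of [] \<Rightarrow> 0 | x # u \<Rightarrow> if x = v then b u else 0)"
proof (cases w)
  case (Cons x u)
  have eq: "(\<lambda>u. word [v] (x # u)) = (if x = v then word [] else (\<lambda>_. 0))"
    by (auto simp: word_def)
  have "tmult (word [v]) b w = word [v] [] * b (x # u) + tmult (\<lambda>u. word [v] (x # u)) b u"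
    by (simp add: Cons tmult_Cons)
  also have "word [v] [] = (0 :: 'a)" by (simp add: word_def)
  finally show ?thesis by (simp add: Cons eq tmult_zero_left tmult_unit_left)
qed (simp add: tmult_Nil word_def)

lemma tmult_letter_right:
  "tmult a (word [v]) [] = 0" "tmult a (word [v]) (w @ [y]) = (if y = v then a w else 0)"
proof -
  show "tmult a (word [v]) [] = 0" by (simp add: tmult_Nil word_def)
  show "tmult a (word [v]) (w @ [y]) = (if y = v then a w else 0)"
  proof (induction w arbitrary: a)
    case Nil
    then show ?case by (simp add: tmult_Cons tmult_Nil word_def)
  next
    case (Cons x w)
    then show ?case by (simp add: tmult_Cons) (simp add: word_def)
  qed
qed

section \<open>Linear spans over the coefficient ring\<close>

lemma kspan_base: "x \<in> X \<Longrightarrow> x \<in> kspan X"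
  unfolding kspan_def by (intro CollectI exI[of _ "{x}"] exI[of _ "\<lambda>_. 1"]) auto

lemma kspan_zero: "(\<lambda>_. 0) \<in> kspan X"
  unfolding kspan_def by (intro CollectI exI[of _ "{}"]) auto

lemma kspan_lin:
  fixes x y :: "'b \<Rightarrow> 'k::comm_ring_1"
  assumes "x \<in> kspan X" "y \<in> kspan X"
  shows "(\<lambda>w. r * x w + y w) \<in> kspan X"
proof -
  obtain F c where F: "finite F" "F \<subseteq> X" "x = (\<lambda>w. \<Sum>b\<in>F. c b * b w)"
    using assms(1) unfolding kspan_def by blast
  obtain G d where G: "finite G" "G \<subseteq> X" "y = (\<lambda>w. \<Sum>b\<in>G. d b * b w)"
    using assms(2) unfolding kspan_def by blast
  let ?c = "\<lambda>b. if b \<in> F then c b else 0" and ?d = "\<lambda>b. if b \<in> G then d b else 0"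
  have "x w = (\<Sum>b\<in>F \<union> G. ?c b * b w)" for w
    unfolding F(3) using F G by (intro sum.mono_neutral_cong_left) auto
  moreover have "y w = (\<Sum>b\<in>F \<union> G. ?d b * b w)" for w
    unfolding G(3) using F G by (intro sum.mono_neutral_cong_left) auto
  ultimately have "(\<lambda>w. r * x w + y w) = (\<lambda>w. \<Sum>b\<in>F \<union> G. (r * ?c b + ?d b) * b w)"
    by (simp add: fun_eq_iff sum_distrib_left sum.distrib algebra_simps)
  then show ?thesis unfolding kspan_def
    using F G by (intro CollectI exI[of _ "F \<union> G"] exI[of _ "\<lambda>b. r * ?c b + ?d b"]) auto
qed

lemma kspan_induct [consumes 1, case_names zero step]:
  fixes x :: "'b \<Rightarrow> 'k::comm_ring_1"
  assumes x: "x \<in> kspan X" and zero: "P (\<lambda>_. 0)"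
    and step: "\<And>b y r. b \<in> X \<Longrightarrow> y \<in> kspan X \<Longrightarrow> P y \<Longrightarrow> P (\<lambda>w. r * b w + y w)"
  shows "P x"
proof -
  obtain F c where F: "finite F" "F \<subseteq> X" "x = (\<lambda>w. \<Sum>b\<in>F. c b * b w)"
    using x unfolding kspan_def by blast
  have "P (\<lambda>w. \<Sum>b\<in>F. c b * b w) \<and> (\<lambda>w. \<Sum>b\<in>F. c b * b w) \<in> kspan X"
    using F(1,2)
  proof (induction F rule: finite_induct)
    case empty
    then show ?case using zero kspan_zero by simp
  next
    case (insert b F)
    then have "(\<lambda>w. \<Sum>b\<in>insert b F. c b * b w) = (\<lambda>w. c b * b w + (\<Sum>b\<in>F. c b * b w))" by simp
    then show ?case using insert step[of b _ "c b"] kspan_lin[of b X] kspan_base[of b X] by simp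
  qed
  then show ?thesis using F by simp
qed

lemma kspan_minimal:
  assumes "X \<subseteq> kspan Y"
  shows "kspan X \<subseteq> (kspan Y :: ('b \<Rightarrow> 'k::comm_ring_1) set)"
proof
  fix x :: "'b \<Rightarrow> 'k" assume "x \<in> kspan X"
  then show "x \<in> kspan Y"
    by (induction rule: kspan_induct) (use assms kspan_zero kspan_lin in blast)+
qed

lemma kspan_neg: "x \<in> kspan X \<Longrightarrow> (\<lambda>w. - x w) \<in> (kspan X :: ('b \<Rightarrow> 'k::comm_ring_1) set)"
  using kspan_lin[OF _ kspan_zero, of x X "- 1"] by simp

lemma kspan_add: "x \<in> kspan X \<Longrightarrow> y \<in> kspan X \<Longrightarrow> (\<lambda>w. x w + y w) \<in> (kspan X :: ('b \<Rightarrow> 'k::comm_ring_1) set)"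
  using kspan_lin[of x X y 1] by simp

lemma kspan_diff: "x \<in> kspan X \<Longrightarrow> y \<in> kspan X \<Longrightarrow> (\<lambda>w. x w - y w) \<in> (kspan X :: ('b \<Rightarrow> 'k::comm_ring_1) set)"
  using kspan_lin[of y X x "- 1"] by (simp add: algebra_simps)

lemma kspan_scale: "x \<in> kspan X \<Longrightarrow> (\<lambda>w. r * x w) \<in> (kspan X :: ('b \<Rightarrow> 'k::comm_ring_1) set)"
  using kspan_lin[OF _ kspan_zero, of x X r] by simp

section \<open>Left-normed brackets and their dual words\<close>

fun comb :: "mtree list \<Rightarrow> 'k::comm_ring_1 tens" where
  "comb [] = (\<lambda>_. 0)"
| "comb (u # vs) = foldl (\<lambda>a v. lie_br a (word [v])) (word [u]) vs"

lemma comb_snoc: "w \<noteq> [] \<Longrightarrow> comb (w @ [v]) = lie_br (comb w) (word [v])"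
  by (cases w) auto

abbreviation lvs :: "mtree list \<Rightarrow> nat list" where
  "lvs w \<equiv> concat (map leaves w)"

text \<open>The position of \<open>r\<close> is a normalisation: without it the left-normed brackets
  are dependent, as antisymmetry shows for two letters.\<close>

definition root_words :: "nat set \<Rightarrow> nat \<Rightarrow> mtree list set" where
  "root_words A r = {w. w \<noteq> [] \<and> distinct (lvs w) \<and> set (lvs w) = A \<and> r \<in> set (leaves (hd w))}"

lemma comb_lie_mono:
  assumes "w \<noteq> []" "distinct (lvs w)"
  shows "lie_mono (set (lvs w)) (comb w)"
  using assms
proof (induction w rule: rev_induct)
  case (snoc v w)
  show ?case
  proof (cases "w = []")
    case True
    then show ?thesis using lie_mono.gen[of v] snoc by simp
  next
    case False
    then show ?thesis
      using lie_mono.br[of "set (lvs w)" "comb w" "set (leaves v)" "word [v]"] lie_mono.gen[of v] snoc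
      by (simp add: comb_snoc)
  qed
qed simp

lemma comb_Nil: "w \<noteq> [] \<Longrightarrow> comb w [] = 0"
proof (induction w rule: rev_induct)
  case (snoc v w)
  show ?case
  proof (cases "w = []")
    case False
    then show ?thesis unfolding comb_snoc[OF False] lie_br_def tmult_Nil by (simp add: word_def)
  qed (simp add: word_def)
qed simp

text \<open>Expanding the commutators puts each further letter at one of the two ends. A word
  starting with the letter that contains \<open>r\<close> arises only if every letter goes to the
  right end, hence exactly once and with coefficient 1.\<close>

lemma comb_dual:
  assumes "w \<noteq> []" "distinct (lvs w)" "r \<in> set (leaves (hd w))" "w' \<noteq> []" "r \<in> set (leaves (hd w'))"
  shows "comb w w' = (if w = w' then 1 else (0 :: 'k::comm_ring_1))"
  using assms
proof (induction w arbitrary: w' rule: rev_induct)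
  case (snoc v w)
  show ?case
  proof (cases "w = []")
    case True
    then show ?thesis by (auto simp: word_def)
  next
    case False
    have r: "r \<in> set (lvs w)" using snoc.prems False by (cases w) auto
    then have "r \<notin> set (leaves v)" using snoc.prems by auto
    then have hd: "hd w' \<noteq> v" using snoc.prems by blast
    obtain w'' y where w': "w' = w'' @ [y]" using snoc.prems by (metis append_butlast_last_id)
    have z: "tmult (word [v]) (comb w) w' = (0 :: 'k)"
      using hd snoc.prems by (cases w') (auto simp: tmult_letter_left)
    have "comb (w @ [v]) w' = (if y = v then comb w w'' else (0 :: 'k))"
      using z by (simp add: comb_snoc[OF False] lie_br_def w' tmult_letter_right)
    also have "\<dots> = (if w @ [v] = w' then 1 else 0)"
    proof (cases "w'' = []")
      case True
      then show ?thesis using False w' by (simp add: comb_Nil)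
    next
      case ne: False
      then have "comb w w'' = (if w = w'' then 1 else (0 :: 'k))"
        using snoc.prems False w' by (intro snoc.IH) auto
      then show ?thesis using w' by auto
    qed
    finally show ?thesis .
  qed
qed simp

lemma comb_dual_root_words:
  assumes "w \<in> root_words A r" "w' \<in> root_words A r"
  shows "comb w w' = (if w = w' then 1 else 0)"
  using assms comb_dual unfolding root_words_def by blast

text \<open>Induction on the monomial \<open>b\<close>: a single tree just lengthens the words, and
  Jacobi reduces a composite \<open>b\<close> to its two factors, bracketed one after the
  other.\<close>

lemma lie_br_comb_span:
  assumes "lie_mono B b" "c \<in> kspan (comb ` root_words A r)" "A \<inter> B = {}"
  shows "lie_br c b \<in> kspan (comb ` root_words (A \<union> B) r :: 'k::comm_ring_1 tens set)"
  using assms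
proof (induction arbitrary: A c rule: lie_mono.induct)
  case (gen t)
  from gen.prems(1) show ?case
  proof (induction rule: kspan_induct)
    case zero
    then show ?case by (simp add: lie_br_def tmult_def kspan_zero)
  next
    case (step b y q)
    then obtain w where w: "w \<in> root_words A r" "b = comb w" by blast
    then have "w @ [t] \<in> root_words (A \<union> set (leaves t)) r"
      using gen by (auto simp: root_words_def)
    moreover have "w \<noteq> []" using w by (simp add: root_words_def)
    ultimately have "lie_br b (word [t]) \<in> kspan (comb ` root_words (A \<union> set (leaves t)) r)"
      using w kspan_base by (metis comb_snoc image_eqI)
    then show ?case using step kspan_lin by (simp add: lie_br_lin_left)
  qed
next
  case (br B1 b1 B2 b2)
  have "lie_br (lie_br c b1) b2 \<in> kspan (comb ` root_words ((A \<union> B1) \<union> B2) r)"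
    using br by (intro br.IH(2) br.IH(1)) auto
  moreover have "lie_br (lie_br c b2) b1 \<in> kspan (comb ` root_words ((A \<union> B2) \<union> B1) r)"
    using br by (intro br.IH(2) br.IH(1)) auto
  moreover have "(A \<union> B1) \<union> B2 = A \<union> (B1 \<union> B2)" "(A \<union> B2) \<union> B1 = A \<union> (B1 \<union> B2)" by auto
  ultimately show ?case using kspan_diff by (simp add: lie_br_jacobi[abs_def])
qed

lemma lie_mono_comb_span:
  assumes "lie_mono A a" "r \<in> A"
  shows "a \<in> kspan (comb ` root_words A r :: 'k::comm_ring_1 tens set)"
  using assms
proof (induction rule: lie_mono.induct)
  case (gen t)
  then have "[t] \<in> root_words (set (leaves t)) r" by (simp add: root_words_def)
  then have "comb [t] \<in> comb ` root_words (set (leaves t)) r" by (rule imageI)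
  then show ?case using kspan_base by simp
next
  case (br A a B b)
  show ?case
  proof (cases "r \<in> A")
    case True
    then show ?thesis using br lie_br_comb_span by blast
  next
    case False
    then have "lie_br b a \<in> kspan (comb ` root_words (B \<union> A) r)"
      using br by (intro lie_br_comb_span) auto
    then have "(\<lambda>w. - lie_br b a w) \<in> kspan (comb ` root_words (A \<union> B) r)"
      using kspan_neg by (simp add: Un_commute)
    then show ?thesis by (simp add: lie_br_swap[of a b, abs_def])
  qed
qed

lemma LieMag_eq_comb_span:
  assumes "n \<ge> 1"
  shows "LieMag n = (kspan (comb ` root_words {1..n} 1) :: 'k::comm_ring_1 tens set)"
proof
  show "LieMag n \<subseteq> (kspan (comb ` root_words {1..n} 1) :: 'k tens set)"
    unfolding LieMag_def using lie_mono_comb_span[of "{1..n}" _ 1] assms by (intro kspan_minimal) auto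
  show "kspan (comb ` root_words {1..n} 1) \<subseteq> (LieMag n :: 'k tens set)"
    unfolding LieMag_def
  proof (intro kspan_minimal image_subsetI kspan_base CollectI)
    fix w assume "w \<in> root_words {1..n} 1"
    then show "lie_mono {1..n} (comb w :: 'k tens)"
      using comb_lie_mono[of w] by (simp add: root_words_def)
  qed
qed

text \<open>By the duality of \<open>comb\<close> with the root words, the coefficient of a Lie
  element at \<open>comb w\<close> is its own value at \<open>w\<close>.\<close>

lemma LieMag_expansion:
  assumes n: "n \<ge> 1" and fin: "finite (root_words {1..n} 1)" and x: "x \<in> (LieMag n :: 'k::comm_ring_1 tens set)"
  shows "x = (\<lambda>u. \<Sum>w\<in>root_words {1..n} 1. x w * comb w u)"
proof -
  let ?W = "root_words {1..n} 1"
  have "x \<in> kspan (comb ` ?W)" using x LieMag_eq_comb_span[OF n] by blast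
  then show ?thesis
  proof (induction rule: kspan_induct)
    case (step b y r)
    then obtain v where v: "v \<in> ?W" "b = comb v" by blast
    have "b u = (\<Sum>w\<in>?W. b w * comb w u)" for u
    proof -
      have "(\<Sum>w\<in>?W. b w * comb w u) = (\<Sum>w\<in>?W. if v = w then comb w u else 0)"
        unfolding v(2)
      proof (intro sum.cong refl)
        fix w assume w: "w \<in> ?W"
        show "comb v w * comb w u = (if v = w then comb w u else 0)"
          unfolding comb_dual_root_words[OF v(1) w] by simp
      qed
      also have "\<dots> = b u" using v fin by simp
      finally show ?thesis by simp
    qed
    moreover have "y u = (\<Sum>w\<in>?W. y w * comb w u)" for u using step.IH by (rule fun_cong)
    moreover have "(\<Sum>w\<in>?W. (r * b w + y w) * comb w u)
        = r * (\<Sum>w\<in>?W. b w * comb w u) + (\<Sum>w\<in>?W. y w * comb w u)" for u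
      by (simp add: distrib_right sum.distrib mult.assoc sum_distrib_left)
    ultimately have "r * b u + y u = (\<Sum>w\<in>?W. (r * b w + y w) * comb w u)" for u by metis
    then show ?case by (rule ext)
  qed simp
qed

section \<open>Action of permutations on words of trees\<close>

lemma leaves_relabel: "leaves (relabel_tree s t) = map s (leaves t)"
  by (induction t) auto

lemma relabel_tree_comp: "relabel_tree s (relabel_tree t u) = relabel_tree (s \<circ> t) u"
  by (induction u) auto

lemma relabel_tree_id: "relabel_tree id t = t"
  by (induction t) auto

lemma map_relabel_inv:
  assumes "bij s"
  shows "map (relabel_tree (inv s)) u = w \<longleftrightarrow> u = map (relabel_tree s) w"
proof -
  have "inv s \<circ> s = id" using assms by (simp add: bij_is_inj)
  moreover have "s \<circ> inv s = id" using assms by (metis bij_is_surj surj_iff)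
  ultimately show ?thesis by (auto simp: relabel_tree_comp relabel_tree_id comp_def)
qed

lemma tens_act_word:
  assumes "bij s"
  shows "tens_act s (word w) = word (map (relabel_tree s) w)"
  by (auto simp: tens_act_def word_def fun_eq_iff map_relabel_inv[OF assms])

lemma tens_act_tmult: "tens_act s (tmult a b) = tmult (tens_act s a) (tens_act s b)"
  by (simp add: tens_act_def tmult_def take_map drop_map)

lemma tens_act_lie_br: "tens_act s (lie_br a b) = lie_br (tens_act s a) (tens_act s b)"
proof -
  have "tens_act s (lie_br a b) = (\<lambda>w. tens_act s (tmult a b) w - tens_act s (tmult b a) w)"
    by (simp add: tens_act_def lie_br_def)
  then show ?thesis unfolding tens_act_tmult lie_br_def .
qed

lemma lie_mono_tens_act:
  assumes "bij s" "lie_mono A a"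
  shows "lie_mono (s ` A) (tens_act s a)"
  using assms(2)
proof (induction rule: lie_mono.induct)
  case (gen t)
  have "distinct (leaves (relabel_tree s t))"
    using gen assms(1) by (simp add: leaves_relabel distinct_map bij_is_inj inj_on_subset[OF bij_is_inj])
  from lie_mono.gen[OF this] show ?case by (simp add: tens_act_word[OF assms(1)] leaves_relabel)
next
  case (br A a B b)
  then have "s ` A \<inter> s ` B = {}" using assms(1) by (metis bij_is_inj image_Int image_empty)
  from lie_mono.br[OF br.IH this] show ?case by (simp add: tens_act_lie_br image_Un)
qed

lemma LieMag_tens_act:
  assumes "s permutes {1..n}" "x \<in> (LieMag n :: 'k::comm_ring_1 tens set)"
  shows "tens_act s x \<in> LieMag n"
  using assms(2) unfolding LieMag_def
proof (induction rule: kspan_induct)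
  case zero
  then show ?case by (simp add: tens_act_def kspan_zero)
next
  case (step b y r)
  then have "lie_mono {1..n} (tens_act s b)"
    using lie_mono_tens_act[OF permutes_bij[OF assms(1)], of "{1..n}" b] permutes_image[OF assms(1)] by simp
  then have "tens_act s b \<in> kspan {a. lie_mono {1..n} a}" by (intro kspan_base) simp
  from kspan_lin[OF this step.IH, of r] show ?case by (simp add: tens_act_def)
qed

section \<open>Values of chains of merges\<close>

text \<open>The three merges of two blocks given in the order of their keys: the bracket, and the
  product with the left or the right block as first factor.\<close>

datatype ptype = Both | Lft | Rgt

lemma UNIV_ptype: "UNIV = {Both, Lft, Rgt}"
  using ptype.exhaust by auto

instance ptype :: finite
  by standard (simp add: UNIV_ptype)

text \<open>The bilinear extension of the product of trees. Only the coefficients at one-letter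
  words enter, so longer words contribute nothing.\<close>

definition mag :: "'k::comm_ring_1 tens \<Rightarrow> 'k tens \<Rightarrow> 'k tens" where
  "mag a b = (\<lambda>w. case w of [Node t t'] \<Rightarrow> a [t] * b [t'] | _ \<Rightarrow> 0)"

fun vop :: "ptype \<Rightarrow> 'k::comm_ring_1 tens \<Rightarrow> 'k tens \<Rightarrow> 'k tens" where
  "vop Both x y = lie_br x y"
| "vop Lft x y = mag x y"
| "vop Rgt x y = mag y x"

fun psel :: "ptype \<Rightarrow> nat set \<Rightarrow> nat set \<Rightarrow> nat set" where
  "psel Both P Q = P \<union> Q"
| "psel Lft P Q = P"
| "psel Rgt P Q = Q"

text \<open>Exchanging the two arguments turns \<open>Lft\<close> into \<open>Rgt\<close>; the sign
  makes the products change sign under this exchange, as the bracket does by antisymmetry.\<close>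

fun psgn :: "ptype \<Rightarrow> 'k::comm_ring_1" where
  "psgn Both = 1"
| "psgn Lft = 1"
| "psgn Rgt = - 1"

type_synonym 'k cell = "(nat set \<times> nat set) \<times> 'k tens"

definition opv :: "ptype \<Rightarrow> 'k::comm_ring_1 cell \<Rightarrow> 'k cell \<Rightarrow> 'k cell" where
  "opv t X Y = ((fst (fst X) \<union> fst (fst Y), psel t (snd (fst X)) (snd (fst Y))), vop t (snd X) (snd Y))"

definition mpst :: "nat set \<Rightarrow> (nat \<Rightarrow> 'k cell) \<Rightarrow> mpart" where
  "mpst M v = (\<lambda>k. fst (v k)) ` M"

definition mvs :: "nat set \<Rightarrow> (nat \<times> nat \<times> ptype) set" where
  "mvs M = {(a, b, t). a \<in> M \<and> b \<in> M \<and> a < b}"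

definition upd :: "(nat \<Rightarrow> 'k::comm_ring_1 cell) \<Rightarrow> nat \<Rightarrow> nat \<Rightarrow> ptype \<Rightarrow> nat \<Rightarrow> 'k cell" where
  "upd v a b t = v(a := opv t (v a) (v b))"

definition msgn :: "nat set \<Rightarrow> nat \<Rightarrow> ptype \<Rightarrow> 'k::comm_ring_1" where
  "msgn M b t = (- 1) ^ card {m \<in> M. m < b} * psgn t"

text \<open>A state consists of keys \<open>M\<close> and a block with an algebra element for each key.  The value of a
  chain of merges is the iterated product; merging the keys \<open>a < b\<close> keeps \<open>a\<close> and contributes the sign
  of moving \<open>b\<close> to the front of \<open>M\<close>.  At most one move leads to a given partition.\<close>
fun chain_val :: "nat set \<Rightarrow> (nat \<Rightarrow> 'k::comm_ring_1 cell) \<Rightarrow> mpart list \<Rightarrow> 'k tens" where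
  "chain_val M v [] = (\<lambda>u. \<Sum>k\<in>M. snd (v k) u)"
| "chain_val M v (z # C) = (\<lambda>u. \<Sum>(a, b, t)\<in>mvs M.
     if mpst (M - {b}) (upd v a b t) = z then msgn M b t * chain_val (M - {b}) (upd v a b t) C u else 0)"

lemma finite_mvs: "finite M \<Longrightarrow> finite (mvs M)"
  by (rule finite_subset[of _ "M \<times> M \<times> UNIV"]) (auto simp: mvs_def)

lemma mpst_cong: "(\<And>k. k \<in> M \<Longrightarrow> v k = v' k) \<Longrightarrow> mpst M v = mpst M v'"
  by (simp add: mpst_def)

lemma chain_val_cong:
  "(\<And>k. k \<in> M \<Longrightarrow> v k = v' k) \<Longrightarrow> chain_val M v C = chain_val M v' C"
proof (induction C arbitrary: M v v')
  case Nil
  then show ?case by simp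
next
  case (Cons z C)
  have u: "upd v a b t k = upd v' a b t k" if "(a, b, t) \<in> mvs M" "k \<in> M - {b}" for a b t k
    using that Cons.prems by (auto simp: upd_def mvs_def)
  have "mpst (M - {b}) (upd v a b t) = mpst (M - {b}) (upd v' a b t)"
    "chain_val (M - {b}) (upd v a b t) C = chain_val (M - {b}) (upd v' a b t) C"
    if "(a, b, t) \<in> mvs M" for a b t
    using u[OF that] by (auto intro!: mpst_cong Cons.IH)
  then show ?case by (auto simp: fun_eq_iff intro!: sum.cong)
qed

lemma mag_lin_left: "mag (\<lambda>w. r * a w + b w) c = (\<lambda>w. r * mag a c w + mag b c w)"
  by (auto simp: mag_def fun_eq_iff algebra_simps split: list.splits mtree.splits)

lemma mag_lin_right: "mag c (\<lambda>w. r * a w + b w) = (\<lambda>w. r * mag c a w + mag c b w)"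
  by (auto simp: mag_def fun_eq_iff algebra_simps split: list.splits mtree.splits)

lemma vop_lin_left: "vop t (\<lambda>w. r * a w + b w) c = (\<lambda>w. r * vop t a c w + vop t b c w)"
  by (cases t) (simp_all add: lie_br_lin_left mag_lin_left mag_lin_right)

lemma vop_lin_right: "vop t c (\<lambda>w. r * a w + b w) = (\<lambda>w. r * vop t c a w + vop t c b w)"
  by (cases t) (simp_all add: lie_br_lin_right mag_lin_left mag_lin_right)

text \<open>Every operation is bilinear. The condition on the length says that the chain ends in a
  single block; the closing sum over several keys would contain terms independent of
  \<open>x\<close> and \<open>y\<close>.\<close>

lemma chain_val_lin:
  assumes "finite M" "card M = Suc (length C)" "k \<in> M"
  shows "chain_val M (v(k := (S, \<lambda>w. r * x w + y w))) C u
    = r * chain_val M (v(k := (S, x))) C u + chain_val M (v(k := (S, y))) C u"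
  using assms
proof (induction C arbitrary: M v k S x y)
  case Nil
  then have "M = {k}" by (auto simp: card_1_singleton_iff)
  then show ?case by simp
next
  case (Cons z C)
  let ?v = "v(k := (S, \<lambda>w. r * x w + y w))" and ?x = "v(k := (S, x))" and ?y = "v(k := (S, y))"
  \<comment> \<open>After a move the three states still differ in a single cell and by the same
    linear relation: in the merged cell if the move involves \<open>k\<close>, otherwise in that of
    \<open>k\<close>.\<close>
  have "\<exists>v' k' S' x' y'. k' \<in> M - {b}
      \<and> (\<forall>m\<in>M - {b}. upd ?v a b t m = (v'(k' := (S', \<lambda>w. r * x' w + y' w))) m)
      \<and> (\<forall>m\<in>M - {b}. upd ?x a b t m = (v'(k' := (S', x'))) m)
      \<and> (\<forall>m\<in>M - {b}. upd ?y a b t m = (v'(k' := (S', y'))) m)"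
    if mv: "(a, b, t) \<in> mvs M" for a b t
  proof -
    have ab: "a \<in> M" "b \<in> M" "a \<noteq> b" using mv by (auto simp: mvs_def)
    consider "k = a" | "k = b" | "k \<noteq> a" "k \<noteq> b" by blast
    then show ?thesis
    proof cases
      case 1
      show ?thesis
        by (intro exI[of _ v] exI[of _ a] exI[of _ "fst (opv t (S, x) (v b))"]
            exI[of _ "vop t x (snd (v b))"] exI[of _ "vop t y (snd (v b))"])
          (use 1 ab in \<open>auto simp: upd_def opv_def vop_lin_left\<close>)
    next
      case 2
      show ?thesis
        by (intro exI[of _ v] exI[of _ a] exI[of _ "fst (opv t (v a) (S, x))"]
            exI[of _ "vop t (snd (v a)) x"] exI[of _ "vop t (snd (v a)) y"])
          (use 2 ab in \<open>auto simp: upd_def opv_def vop_lin_right\<close>)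
    next
      case 3
      show ?thesis
        by (intro exI[of _ "upd v a b t"] exI[of _ k] exI[of _ S] exI[of _ x] exI[of _ y])
          (use 3 ab Cons.prems in \<open>auto simp: upd_def\<close>)
    qed
  qed
  note ex = this
  have "(if mpst (M - {b}) (upd ?v a b t) = z then msgn M b t * chain_val (M - {b}) (upd ?v a b t) C u else 0)
    = r * (if mpst (M - {b}) (upd ?x a b t) = z then msgn M b t * chain_val (M - {b}) (upd ?x a b t) C u else 0)
    + (if mpst (M - {b}) (upd ?y a b t) = z then msgn M b t * chain_val (M - {b}) (upd ?y a b t) C u else 0)"
    if mv: "(a, b, t) \<in> mvs M" for a b t
  proof -
    obtain v' k' S' x' y' where e: "k' \<in> M - {b}"
      "\<forall>m\<in>M - {b}. upd ?v a b t m = (v'(k' := (S', \<lambda>w. r * x' w + y' w))) m"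
      "\<forall>m\<in>M - {b}. upd ?x a b t m = (v'(k' := (S', x'))) m"
      "\<forall>m\<in>M - {b}. upd ?y a b t m = (v'(k' := (S', y'))) m"
      using ex[OF mv] by blast
    have c: "chain_val (M - {b}) (upd ?v a b t) C = chain_val (M - {b}) (v'(k' := (S', \<lambda>w. r * x' w + y' w))) C"
      "chain_val (M - {b}) (upd ?x a b t) C = chain_val (M - {b}) (v'(k' := (S', x'))) C"
      "chain_val (M - {b}) (upd ?y a b t) C = chain_val (M - {b}) (v'(k' := (S', y'))) C"
      using e by (auto intro!: chain_val_cong)
    have m: "mpst (M - {b}) (upd ?v a b t) = mpst (M - {b}) (upd ?x a b t)"
      "mpst (M - {b}) (upd ?y a b t) = mpst (M - {b}) (upd ?x a b t)"
      unfolding mpst_def by (intro image_cong refl, simp add: e(2-4)[rule_format])+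
    have "card (M - {b}) = Suc (length C)" using Cons.prems mv by (auto simp: mvs_def)
    then have "chain_val (M - {b}) (v'(k' := (S', \<lambda>w. r * x' w + y' w))) C u
      = r * chain_val (M - {b}) (v'(k' := (S', x'))) C u + chain_val (M - {b}) (v'(k' := (S', y'))) C u"
      using Cons.IH[of "M - {b}" k' v' S' x' y'] Cons.prems(1) e(1) by (simp del: fun_upd_apply)
    then show ?thesis unfolding m c
      by (simp add: distrib_left mult.left_commute del: fun_upd_apply)
  qed
  then have "chain_val M ?v (z # C) u = (\<Sum>(a, b, t)\<in>mvs M.
      r * (if mpst (M - {b}) (upd ?x a b t) = z then msgn M b t * chain_val (M - {b}) (upd ?x a b t) C u else 0)
    + (if mpst (M - {b}) (upd ?y a b t) = z then msgn M b t * chain_val (M - {b}) (upd ?y a b t) C u else 0))"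
    unfolding chain_val.simps by (intro sum.cong refl) (auto simp del: fun_upd_apply)
  also have "\<dots> = r * chain_val M ?x (z # C) u + chain_val M ?y (z # C) u"
    by (simp add: sum.distrib sum_distrib_left case_prod_unfold)
  finally show ?case .
qed

lemma chain_val_neg:
  assumes "finite M" "card M = Suc (length C)" "k \<in> M"
  shows "chain_val M (v(k := (S, \<lambda>w. - x w))) C u = - chain_val M (v(k := (S, x))) C u"
proof -
  have z: "chain_val M (v(k := (S, \<lambda>_. 0))) C u = 0"
    using chain_val_lin[OF assms, of v S "-1" "\<lambda>_. 0" "\<lambda>_. 0" u] by simp
  show ?thesis using chain_val_lin[OF assms, of v S "- 1" x "\<lambda>_. 0" u] z by simp
qed

text \<open>The keys matter only through their order, which decides the admissible moves and the
  signs.\<close>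

lemma chain_val_rename:
  assumes "finite M" "strict_mono_on M h" "\<And>k. k \<in> M \<Longrightarrow> v' (h k) = v k"
  shows "chain_val (h ` M) v' C = chain_val M v C"
  using assms
proof (induction C arbitrary: M v v')
  case Nil
  have inj: "inj_on h M" using Nil(2) by (rule strict_mono_on_imp_inj_on)
  have "(\<Sum>k\<in>h ` M. snd (v' k) u) = (\<Sum>k\<in>M. snd (v k) u)" for u
    using Nil by (simp add: sum.reindex[OF inj])
  then show ?case by simp
next
  case (Cons z C)
  have inj: "inj_on h M" using Cons.prems(2) by (rule strict_mono_on_imp_inj_on)
  have less: "h a < h b \<longleftrightarrow> a < b" if "a \<in> M" "b \<in> M" for a b
    using that Cons.prems(2) by (metis linorder_neqE_nat order_less_asym strict_mono_onD)
  show ?case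
  proof
    fix u
    show "chain_val (h ` M) v' (z # C) u = chain_val M v (z # C) u"
      unfolding chain_val.simps
    proof (rule sum.reindex_cong[where l = "\<lambda>(a, b, t). (h a, h b, t)"])
      show "inj_on (\<lambda>(a, b, t). (h a, h b, t)) (mvs M)"
        using inj by (auto simp: inj_on_def mvs_def)
      show "mvs (h ` M) = (\<lambda>(a, b, t). (h a, h b, t)) ` mvs M"
      proof (intro equalityI subsetI)
        fix p assume "p \<in> mvs (h ` M)"
        then obtain a b t where p: "p = (h a, h b, t)" "a \<in> M" "b \<in> M" "h a < h b" by (auto simp: mvs_def)
        then have "(a, b, t) \<in> mvs M" using less by (simp add: mvs_def)
        then show "p \<in> (\<lambda>(a, b, t). (h a, h b, t)) ` mvs M" using p by force
      qed (use less in \<open>auto simp: mvs_def\<close>)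
      fix p assume "p \<in> mvs M"
      then obtain a b t where p: "p = (a, b, t)" "a \<in> M" "b \<in> M" "a < b" by (auto simp: mvs_def)
      have im: "h ` M - {h b} = h ` (M - {b})" using inj p by (auto simp: inj_on_def)
      have upd: "upd v' (h a) (h b) t (h k) = upd v a b t k" if "k \<in> M - {b}" for k
        using that p inj Cons.prems(3) by (auto simp: upd_def inj_on_def)
      have "mpst (h ` (M - {b})) (upd v' (h a) (h b) t) = mpst (M - {b}) (upd v a b t)"
        unfolding mpst_def image_image using upd by (intro image_cong refl) simp
      moreover have "chain_val (h ` (M - {b})) (upd v' (h a) (h b) t) C = chain_val (M - {b}) (upd v a b t) C"
        using Cons.prems upd by (intro Cons.IH) (auto intro: monotone_on_subset)
      moreover have "{m \<in> h ` M. m < h b} = h ` {m \<in> M. m < b}" using less p by auto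
      then have "card {m \<in> h ` M. m < h b} = card {m \<in> M. m < b}"
        using inj by (simp add: card_image inj_on_subset)
      ultimately show "(case (case p of (a, b, t) \<Rightarrow> (h a, h b, t)) of (a, b, t) \<Rightarrow>
          if mpst (h ` M - {b}) (upd v' a b t) = z
          then msgn (h ` M) b t * chain_val (h ` M - {b}) (upd v' a b t) C u else 0)
        = (case p of (a, b, t) \<Rightarrow> if mpst (M - {b}) (upd v a b t) = z
          then msgn M b t * chain_val (M - {b}) (upd v a b t) C u else 0)"
        by (simp add: p im msgn_def)
    qed
  qed
qed

definition pairs :: "nat set \<Rightarrow> (nat \<times> nat) set" where
  "pairs M = {(a, b). a \<in> M \<and> b \<in> M \<and> a < b}"

definition mv_term :: "nat set \<Rightarrow> (nat \<Rightarrow> 'k::comm_ring_1 cell) \<Rightarrow> mpart \<Rightarrow> mpart list \<Rightarrow> mtree list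
    \<Rightarrow> nat \<Rightarrow> nat \<Rightarrow> ptype \<Rightarrow> 'k" where
  "mv_term M v z C u a b t = (if mpst (M - {b}) (upd v a b t) = z
     then msgn M b t * chain_val (M - {b}) (upd v a b t) C u else 0)"

lemma chain_val_pairs:
  assumes "finite M"
  shows "chain_val M v (z # C) u = (\<Sum>(a, b)\<in>pairs M. \<Sum>t\<in>UNIV. mv_term M v z C u a b t)"
proof -
  have "(\<Sum>(a, b)\<in>pairs M. \<Sum>t\<in>UNIV. mv_term M v z C u a b t)
      = (\<Sum>p\<in>pairs M. \<Sum>t\<in>UNIV. mv_term M v z C u (fst p) (snd p) t)"
    by (simp add: case_prod_unfold)
  also have "\<dots> = (\<Sum>(p, t)\<in>pairs M \<times> UNIV. mv_term M v z C u (fst p) (snd p) t)"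
    by (simp add: sum.cartesian_product)
  also have "\<dots> = (\<Sum>(a, b, t)\<in>mvs M. mv_term M v z C u a b t)"
    by (rule sum.reindex_bij_witness[where i = "\<lambda>(a, b, t). ((a, b), t)" and j = "\<lambda>((a, b), t). (a, b, t)"])
      (auto simp: mvs_def pairs_def)
  finally show ?thesis by (simp add: mv_term_def cong: if_cong)
qed

text \<open>The moves of the two states are matched by the transposition. If the removed key is
  neither \<open>p\<close> nor \<open>q\<close>, the induction hypothesis gives the sign; if
  \<open>q\<close> is removed in place of \<open>p\<close>, there is one more smaller key; merging
  \<open>p\<close> with \<open>q\<close> is antisymmetric by \<open>psgn\<close> and by the
  bracket.\<close>

lemma chain_val_transpose_adjacent:
  fixes v :: "nat \<Rightarrow> 'k::comm_ring_1 cell"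
  assumes "finite M" "card M = Suc (length C)" "p \<in> M" "q \<in> M" "p < q" "\<And>m. m \<in> M \<Longrightarrow> \<not> (p < m \<and> m < q)"
  shows "chain_val M (v \<circ> transpose p q) C u = - chain_val M v C u"
  using assms
proof (induction C arbitrary: M v)
  case Nil
  then show ?case by (auto simp: card_1_singleton_iff)
next
  case (Cons z C)
  note M = Cons.prems
  let ?\<pi> = "transpose p q"
  have cardM: "card (M - {b}) = Suc (length C)" if "b \<in> M" for b using M that by simp
  have sep: "m < p \<or> m = p \<or> m = q \<or> q < m" if "m \<in> M" for m using M(6)[OF that] M(5) by linarith
  have \<pi>M: "?\<pi> m \<in> M \<longleftrightarrow> m \<in> M" for m using M(3,4) by (auto simp: transpose_def)
  have vv: "(v \<circ> ?\<pi>) \<circ> ?\<pi> = v" for v :: "nat \<Rightarrow> 'k cell" by (simp add: fun_eq_iff)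
  \<comment> \<open>The pair \<open>(p, q)\<close> stays fixed because its transpose would be
    decreasing. All other increasing pairs remain increasing, as no key lies between
    \<open>p\<close> and \<open>q\<close>.\<close>
  define \<phi> where "\<phi> = (\<lambda>(a, b). if (a, b) = (p, q) then (p, q) else (?\<pi> a, ?\<pi> b))"
  have \<phi>: "\<phi> ab \<in> pairs M" "\<phi> (\<phi> ab) = ab" if abM: "ab \<in> pairs M" for ab
  proof -
    obtain a b where ab: "ab = (a, b)" "a \<in> M" "b \<in> M" "a < b" using abM by (auto simp: pairs_def)
    show "\<phi> ab \<in> pairs M"
      using ab M(3-5) sep[of a] sep[of b] by (auto simp: \<phi>_def pairs_def transpose_def split: if_splits)
    show "\<phi> (\<phi> ab) = ab"
      using ab M(5) by (auto simp: \<phi>_def transpose_def split: if_splits)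
  qed
  have b_away: "mv_term M (v \<circ> ?\<pi>) z C u (?\<pi> a) b t = - mv_term M v z C u a b t"
    if ab: "a \<in> M" "b \<in> M" "a < b" "b \<noteq> p" "b \<noteq> q" for v :: "nat \<Rightarrow> 'k cell" and a b t
  proof -
    have upd: "upd (v \<circ> ?\<pi>) (?\<pi> a) b t = upd v a b t \<circ> ?\<pi>"
      using ab by (auto simp: upd_def fun_eq_iff transpose_def)
    have im: "?\<pi> ` (M - {b}) = M - {b}"
      using \<pi>M ab M(3,4) by (auto simp: transpose_def image_iff split: if_splits)
    have "mpst (M - {b}) (upd v a b t \<circ> ?\<pi>) = mpst (?\<pi> ` (M - {b})) (upd v a b t)"
      by (simp add: mpst_def image_image)
    moreover have "chain_val (M - {b}) (upd v a b t \<circ> ?\<pi>) C u = - chain_val (M - {b}) (upd v a b t) C u"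
      using ab M by (intro Cons.IH) auto
    ultimately show ?thesis by (simp add: mv_term_def upd im)
  qed
  have b_p: "mv_term M (v \<circ> ?\<pi>) z C u a q t = - mv_term M v z C u a p t"
    if ab: "a \<in> M" "a < p" for v :: "nat \<Rightarrow> 'k cell" and a t
  proof -
    let ?h = "\<lambda>m. if m = q then p else m"
    let ?w = "upd (v \<circ> ?\<pi>) a q t" and ?x = "upd v a p t"
    have h: "?h ` (M - {p}) = M - {q}" using M(3-5) by (auto simp: image_iff)
    have mono: "strict_mono_on (M - {p}) ?h"
    proof (rule strict_mono_onI)
      fix r s assume "r \<in> M - {p}" "s \<in> M - {p}" "r < s"
      then show "?h r < ?h s" using sep[of r] sep[of s] M(5) by auto
    qed
    have wx: "?w (?h m) = ?x m" if "m \<in> M - {p}" for m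
      using that ab M(5) by (auto simp: upd_def transpose_def)
    have cv: "chain_val (M - {q}) ?w C = chain_val (M - {p}) ?x C"
      using chain_val_rename[of "M - {p}" ?h ?w ?x C] M(1) mono wx h by simp
    have mp: "mpst (M - {q}) ?w = mpst (M - {p}) ?x"
      unfolding mpst_def h[symmetric] image_image using wx by (intro image_cong refl) simp
    have "m \<in> {m \<in> M. m < q} \<longleftrightarrow> m \<in> insert p {m \<in> M. m < p}" for m
      using sep[of m] M(3-5) by (cases "m \<in> M") auto
    then have "{m \<in> M. m < q} = insert p {m \<in> M. m < p}" by blast
    then have "card {m \<in> M. m < q} = Suc (card {m \<in> M. m < p})" using M(1) by simp
    then have "msgn M q t = - (msgn M p t :: 'k)" by (simp add: msgn_def)
    then show ?thesis by (simp add: mv_term_def cv mp)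
  qed
  have pq: "(\<Sum>t\<in>UNIV. mv_term M (v \<circ> ?\<pi>) z C u p q t) = - (\<Sum>t\<in>UNIV. mv_term M v z C u p q t)"
  proof -
    let ?N = "M - {q}"
    have pN: "p \<in> ?N" "finite ?N" using M by auto
    have agree: "upd (v \<circ> ?\<pi>) p q t m = (v(p := opv t (v q) (v p))) m"
      "upd v p q t m = (v(p := opv t (v p) (v q))) m" if "m \<in> ?N" for t m
      using that by (auto simp: upd_def transpose_def)
    have cv: "chain_val ?N (upd (v \<circ> ?\<pi>) p q t) C = chain_val ?N (v(p := opv t (v q) (v p))) C"
      "chain_val ?N (upd v p q t) C = chain_val ?N (v(p := opv t (v p) (v q))) C"
      "mpst ?N (upd (v \<circ> ?\<pi>) p q t) = mpst ?N (v(p := opv t (v q) (v p)))"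
      "mpst ?N (upd v p q t) = mpst ?N (v(p := opv t (v p) (v q)))" for t
      by (rule chain_val_cong mpst_cong, erule agree)+
    have LR: "opv Lft (v q) (v p) = opv Rgt (v p) (v q)" "opv Rgt (v q) (v p) = opv Lft (v p) (v q)"
      by (auto simp: opv_def)
    obtain S x where Sx: "opv Both (v p) (v q) = (S, x)" by (cases "opv Both (v p) (v q)")
    then have B: "opv Both (v q) (v p) = (S, \<lambda>w. - x w)"
      by (auto simp: opv_def lie_br_swap[of "snd (v q)", abs_def])
    have mS: "mpst ?N (v(p := (S, x))) = mpst ?N (v(p := (S, y)))" for x y
      unfolding mpst_def by (intro image_cong refl) simp
    have "mv_term M (v \<circ> ?\<pi>) z C u p q Both = - mv_term M v z C u p q Both"
      using chain_val_neg[OF pN(2) cardM[OF M(4)] pN(1), of v S x u] mS[of "\<lambda>w. - x w" x]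
      by (simp add: mv_term_def cv B Sx del: fun_upd_apply)
    moreover have "mv_term M (v \<circ> ?\<pi>) z C u p q Lft = - mv_term M v z C u p q Rgt"
      "mv_term M (v \<circ> ?\<pi>) z C u p q Rgt = - mv_term M v z C u p q Lft"
      by (simp_all add: mv_term_def cv LR msgn_def del: fun_upd_apply)
    ultimately show ?thesis by (simp add: UNIV_ptype)
  qed
  have main: "(\<Sum>t\<in>UNIV. mv_term M (v \<circ> ?\<pi>) z C u (fst (\<phi> ab)) (snd (\<phi> ab)) t)
      = - (\<Sum>t\<in>UNIV. mv_term M v z C u (fst ab) (snd ab) t)" if abM: "ab \<in> pairs M" for ab
  proof -
    obtain a b where ab: "ab = (a, b)" "a \<in> M" "b \<in> M" "a < b" using abM by (auto simp: pairs_def)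
    consider "b \<noteq> p" "b \<noteq> q" | "b = p" | "b = q" "a = p" | "b = q" "a \<noteq> p" by blast
    then show ?thesis
    proof cases
      case 1
      then have "\<phi> ab = (?\<pi> a, b)" using ab by (auto simp: \<phi>_def)
      then show ?thesis using b_away[OF ab(2-4) 1, of v] by (simp add: ab(1) sum_negf)
    next
      case 2
      then have "\<phi> ab = (a, q)" using ab M(5) by (auto simp: \<phi>_def transpose_def)
      then show ?thesis using b_p[OF ab(2), of v] ab 2 by (simp add: sum_negf)
    next
      case 3
      then have "\<phi> ab = (p, q)" using ab by (auto simp: \<phi>_def)
      then show ?thesis using pq 3 ab by simp
    next
      case 4
      then have a: "a < p" using ab sep[of a] by auto
      have "\<phi> ab = (a, p)" using ab 4 a by (auto simp: \<phi>_def transpose_def)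
      moreover have "mv_term M v z C u a q t = - mv_term M (v \<circ> ?\<pi>) z C u a p t" for t
        using b_p[OF ab(2) a, of "v \<circ> ?\<pi>"] vv by simp
      ultimately show ?thesis using 4 ab by (simp add: sum_negf)
    qed
  qed
  have "chain_val M (v \<circ> ?\<pi>) (z # C) u
      = (\<Sum>ab\<in>pairs M. \<Sum>t\<in>UNIV. mv_term M (v \<circ> ?\<pi>) z C u (fst ab) (snd ab) t)"
    unfolding chain_val_pairs[OF M(1)] by (simp add: case_prod_unfold)
  also have "\<dots> = (\<Sum>ab\<in>pairs M. \<Sum>t\<in>UNIV. mv_term M (v \<circ> ?\<pi>) z C u (fst (\<phi> ab)) (snd (\<phi> ab)) t)"
    by (rule sum.reindex_bij_witness[where i = \<phi> and j = \<phi>]) (simp_all add: \<phi>)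
  also have "\<dots> = (\<Sum>ab\<in>pairs M. - (\<Sum>t\<in>UNIV. mv_term M v z C u (fst ab) (snd ab) t))"
    using main by (intro sum.cong refl)
  also have "\<dots> = - chain_val M v (z # C) u"
    unfolding chain_val_pairs[OF M(1)] by (simp add: sum_negf case_prod_unfold)
  finally show ?case .
qed

text \<open>A transposition of distant keys is an adjacent one, conjugated step by step; each
  conjugation adds two changes of sign.\<close>

lemma chain_val_transpose:
  fixes v :: "nat \<Rightarrow> 'k::comm_ring_1 cell"
  assumes "card {1..n} = Suc (length C)" "p \<in> {1..n}" "p + Suc d \<in> {1..n}"
  shows "chain_val {1..n} (v \<circ> transpose p (p + Suc d)) C u = - chain_val {1..n} v C u"
  using assms(3)
proof (induction d arbitrary: v)
  case 0
  then show ?case using assms by (intro chain_val_transpose_adjacent) auto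
next
  case (Suc d)
  let ?q = "p + Suc d"
  let ?s = "transpose ?q (Suc ?q)"
  have adj: "chain_val {1..n} (w \<circ> ?s) C u = - chain_val {1..n} w C u" for w :: "nat \<Rightarrow> 'k cell"
    using assms Suc.prems by (intro chain_val_transpose_adjacent) auto
  have "transpose p (p + Suc (Suc d)) = (?s \<circ> transpose p ?q) \<circ> ?s"
    by (auto simp: fun_eq_iff transpose_def)
  then have "chain_val {1..n} (v \<circ> transpose p (p + Suc (Suc d))) C u
      = chain_val {1..n} (((v \<circ> ?s) \<circ> transpose p ?q) \<circ> ?s) C u"
    by (simp add: o_assoc)
  also have "\<dots> = - chain_val {1..n} ((v \<circ> ?s) \<circ> transpose p ?q) C u" by (rule adj)
  also have "chain_val {1..n} ((v \<circ> ?s) \<circ> transpose p ?q) C u = - chain_val {1..n} (v \<circ> ?s) C u"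
    using Suc.prems by (intro Suc.IH) simp
  also have "chain_val {1..n} (v \<circ> ?s) C u = - chain_val {1..n} v C u" by (rule adj)
  finally show ?case by simp
qed

lemma chain_val_permutes:
  fixes v :: "nat \<Rightarrow> 'k::comm_ring_1 cell"
  assumes "s permutes {1..n}" "card {1..n} = Suc (length C)"
  shows "chain_val {1..n} (v \<circ> s) C u = of_int (sign s) * chain_val {1..n} v C u"
proof -
  from finite_atLeastAtMost assms(1) show ?thesis
  proof (induction arbitrary: v rule: permutes_rev_induct)
    case id
    then show ?case by simp
  next
    case (swap a b p)
    have tr: "chain_val {1..n} (w \<circ> transpose a b) C u = - chain_val {1..n} w C u" if "a \<noteq> b" for w :: "nat \<Rightarrow> 'k cell"
    proof -
      have main: "chain_val {1..n} (w \<circ> transpose a b) C u = - chain_val {1..n} w C u"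
        if "a < b" "a \<in> {1..n}" "b \<in> {1..n}" for a b
        using chain_val_transpose[OF assms(2) that(2), of "b - Suc a" w u] that by simp
      show ?thesis using main[of a b] main[of b a] swap that
        by (metis linorder_neqE_nat transpose_commute)
    qed
    show ?case
    proof (cases "a = b")
      case True
      then show ?thesis using swap by simp
    next
      case False
      have "permutation p" using swap permutes_imp_permutation by blast
      then have "sign (p \<circ> transpose a b) = - sign p"
        using False by (simp add: sign_compose permutation_swap_id sign_swap_id)
      moreover have "chain_val {1..n} (v \<circ> (p \<circ> transpose a b)) C u = - chain_val {1..n} (v \<circ> p) C u"
        using tr[OF False, of "v \<circ> p"] by (simp add: o_assoc)
      ultimately show ?thesis using swap.IH[of v] swap(4) by (simp only: of_int_minus) simp
    qed
  qed
qed

lemma tens_act_mag: "tens_act s (mag a b) = mag (tens_act s a) (tens_act s b)"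
  by (auto simp: tens_act_def mag_def fun_eq_iff split: list.splits mtree.splits)

definition cell_act :: "(nat \<Rightarrow> nat) \<Rightarrow> 'k::comm_ring_1 cell \<Rightarrow> 'k cell" where
  "cell_act s X = ((s ` fst (fst X), s ` snd (fst X)), tens_act s (snd X))"

lemma opv_cell_act: "opv t (cell_act s X) (cell_act s Y) = cell_act s (opv t X Y)"
  by (cases t) (simp_all add: opv_def cell_act_def image_Un tens_act_mag tens_act_lie_br)

lemma mp_relabel_mpst: "mpst M (cell_act s \<circ> v) = mp_relabel s (mpst M v)"
  by (simp add: mpst_def mp_relabel_def cell_act_def image_image case_prod_unfold)

lemma inj_mp_relabel:
  assumes "inj s"
  shows "mp_relabel s x = mp_relabel s y \<longleftrightarrow> x = y"
proof -
  have "inj (\<lambda>(B, P). (s ` B, s ` P))"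
    using assms by (auto simp: inj_on_def inj_image_eq_iff)
  then show ?thesis unfolding mp_relabel_def by (simp add: inj_image_eq_iff)
qed

lemma chain_val_cell_act:
  assumes "inj s"
  shows "chain_val M (cell_act s \<circ> v) (map (mp_relabel s) C) = tens_act s (chain_val M v C)"
proof (induction C arbitrary: M v)
  case Nil
  then show ?case by (simp add: tens_act_def cell_act_def)
next
  case (Cons z C)
  have upd: "upd (cell_act s \<circ> v) a b t = cell_act s \<circ> upd v a b t" for a b t
    by (auto simp: upd_def fun_eq_iff opv_cell_act)
  show ?case
    unfolding list.map chain_val.simps upd Cons.IH mp_relabel_mpst inj_mp_relabel[OF assms]
    by (simp add: tens_act_def cong: if_cong)
qed

definition init_cell :: "nat \<Rightarrow> 'k::comm_ring_1 cell" where
  "init_cell k = (({k}, {k}), word [Leaf k])"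

lemma cell_act_init: "bij s \<Longrightarrow> cell_act s (init_cell k) = init_cell (s k)"
  by (simp add: cell_act_def init_cell_def tens_act_word)

definition top_val :: "nat \<Rightarrow> mpart list \<Rightarrow> 'k::comm_ring_1 tens" where
  "top_val n C = chain_val {1..n} init_cell C"

text \<open>This is where the sign representation enters. Relabelling commutes with all operations,
  so the relabelled chain is the same evaluation with permuted initial cells, and sorting them back
  costs the sign.\<close>

lemma top_val_relabel:
  assumes "s permutes {1..n}" "n = Suc (length C)"
  shows "(top_val n (map (mp_relabel s) C) :: 'k::comm_ring_1 tens)
    = (\<lambda>u. of_int (sign s) * tens_act s (top_val n C) u)"
proof
  fix u
  have bij: "bij s" using assms(1) by (rule permutes_bij)
  have eq: "cell_act s \<circ> init_cell = (init_cell \<circ> s :: nat \<Rightarrow> 'k cell)"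
    by (simp add: fun_eq_iff cell_act_init[OF bij])
  have "tens_act s (top_val n C) u = chain_val {1..n} (init_cell \<circ> s :: nat \<Rightarrow> 'k cell) (map (mp_relabel s) C) u"
    unfolding top_val_def using chain_val_cell_act[OF bij_is_inj[OF bij], of "{1..n}" init_cell C] eq by metis
  also have "\<dots> = of_int (sign s) * top_val n (map (mp_relabel s) C) u"
    unfolding top_val_def using assms by (intro chain_val_permutes) simp_all
  finally have "tens_act s (top_val n C) u = of_int (sign s) * (top_val n (map (mp_relabel s) C) u :: 'k)" .
  then show "(top_val n (map (mp_relabel s) C) u :: 'k) = of_int (sign s) * tens_act s (top_val n C) u"
    by (cases s rule: sign_cases) simp_all
qed

section \<open>States realise partitions; relations among double moves\<close>

definition valid_state :: "nat \<Rightarrow> nat set \<Rightarrow> (nat \<Rightarrow> 'k cell) \<Rightarrow> bool" where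
  "valid_state n M v \<longleftrightarrow> finite M \<and> mpst M v \<in> MP n \<and> inj_on (\<lambda>k. fst (v k)) M"

lemma pts_mrg:
  assumes y: "y \<in> MP n" and bc: "b \<in> y" "c \<in> y" "b \<noteq> c" and P: "P = snd b \<union> snd c \<or> P = snd b"
  shows "pts (mrg y b c P) \<subseteq> pts y" "pts (mrg y b c P) = pts y \<longleftrightarrow> P = snd b \<union> snd c"
proof -
  note m = mrg_props[OF assms]
  show "pts (mrg y b c P) \<subseteq> pts y" using bc P by (auto simp: pts_def mrg_def)
  have "0 < min (key b) (key c)" using key_pos[OF y] bc by simp
  then show "pts (mrg y b c P) = pts y \<longleftrightarrow> P = snd b \<union> snd c"
    using m(5) unfolding mlab_def Let_def by (auto split: if_splits)
qed

text \<open>Each move performs a merge of the underlying partition, so the facts on covers transfer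
  to states.\<close>

lemma state_step:
  fixes v :: "nat \<Rightarrow> 'k::comm_ring_1 cell" and t :: ptype
  assumes v: "valid_state n M v" and ab: "a \<in> M" "b \<in> M" "a \<noteq> b"
  defines "x \<equiv> mpst (M - {b}) (upd v a b t)"
  shows "valid_state n (M - {b}) (upd v a b t)"
    and "x \<in> MP n" "mp_less x (mpst M v)" "Suc (card x) = card (mpst M v)"
    and "pts x \<subseteq> pts (mpst M v)" "pts x = pts (mpst M v) \<longleftrightarrow> t = Both"
    and "x - mpst M v = {fst (opv t (v a) (v b))}"
    and "mlab (mpst M v) x = (if t = Both then - int (min (key (fst (v a))) (key (fst (v b))))
          else int (min (key (fst (v a))) (key (fst (v b)))))"
proof -
  let ?y = "mpst M v"
  have y: "?y \<in> MP n" and fin: "finite M" and inj: "inj_on (\<lambda>k. fst (v k)) M"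
    using v by (auto simp: valid_state_def)
  let ?A = "fst (v a)" and ?B = "fst (v b)" and ?N = "fst (opv t (v a) (v b))"
  have AB: "?A \<in> ?y" "?B \<in> ?y" "?A \<noteq> ?B" using ab inj by (auto simp: mpst_def inj_on_def)
  have rest: "(\<lambda>k. fst (v k)) ` (M - {a, b}) = ?y - {?A, ?B}"
    using ab inj by (auto simp: mpst_def inj_on_def)
  have Mb: "M - {b} = insert a (M - {a, b})" using ab by auto
  then have "x = insert ?N ((\<lambda>k. fst (upd v a b t k)) ` (M - {a, b}))"
    by (simp add: x_def mpst_def upd_def)
  also have "(\<lambda>k. fst (upd v a b t k)) ` (M - {a, b}) = (\<lambda>k. fst (v k)) ` (M - {a, b})"
    by (intro image_cong refl) (auto simp: upd_def)
  finally have x: "x = insert ?N (?y - {?A, ?B})" unfolding rest .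
  obtain b' c' P where m: "b' \<in> ?y" "c' \<in> ?y" "b' \<noteq> c'" "P = snd b' \<union> snd c' \<or> P = snd b'"
    "?N = (fst b' \<union> fst c', P)" "{b', c'} = {?A, ?B}" "t = Both \<longleftrightarrow> P = snd b' \<union> snd c'"
    "min (key b') (key c') = min (key ?A) (key ?B)"
  proof (cases t)
    case Both
    then show thesis using that[of ?A ?B "snd ?A \<union> snd ?B"] AB by (simp add: opv_def)
  next
    case Lft
    then show thesis using that[of ?A ?B "snd ?A"] AB left_ne_both[OF y AB] by (simp add: opv_def)
  next
    case Rgt
    then show thesis using that[of ?B ?A "snd ?B"] AB left_ne_both[OF y AB(2,1)]
      by (simp add: opv_def Un_commute insert_commute min.commute)
  qed
  have xm: "x = mrg ?y b' c' P" unfolding x mrg_def m(5)[symmetric] m(6) ..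
  note mp = mrg_props[OF y m(1-4)] and pm = pts_mrg[OF y m(1-4)]
  show xMP: "x \<in> MP n" "mp_less x ?y" "Suc (card x) = card ?y" using mp xm by simp_all
  show "pts x \<subseteq> pts ?y" "pts x = pts ?y \<longleftrightarrow> t = Both" using pm xm m(7) by simp_all
  have N: "?N \<notin> ?y" using mp(4) m(5) by simp
  then show "x - ?y = {?N}" unfolding x by auto
  show "mlab ?y x = (if t = Both then - int (min (key ?A) (key ?B)) else int (min (key ?A) (key ?B)))"
    using mp(5) xm m(7,8) by simp
  have "inj_on (\<lambda>k. fst (upd v a b t k)) (insert a (M - {a, b}))"
  proof (subst inj_on_insert, intro conjI)
    show "inj_on (\<lambda>k. fst (upd v a b t k)) (M - {a, b})"
      using inj by (auto simp: inj_on_def upd_def)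
    have "(\<lambda>k. fst (upd v a b t k)) ` (M - {a, b}) = ?y - {?A, ?B}"
      unfolding rest[symmetric] by (intro image_cong refl) (auto simp: upd_def)
    then show "fst (upd v a b t a) \<notin> (\<lambda>k. fst (upd v a b t k)) ` (M - {a, b} - {a})"
      using N by (auto simp: upd_def)
  qed
  then have "inj_on (\<lambda>k. fst (upd v a b t k)) (M - {b})" unfolding Mb .
  then show "valid_state n (M - {b}) (upd v a b t)"
    unfolding valid_state_def using xMP(1) fin by (simp add: x_def)
qed

text \<open>Disjoint moves cancel because exchanging them changes the sign; the remaining terms cancel by the
  Jacobi identity.\<close>
lemma double_move_sum:
  fixes v :: "nat \<Rightarrow> 'k::comm_ring_1 cell"
  assumes fin: "finite M" and card: "card M = Suc (Suc (Suc (length C)))"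
    and H: "\<And>a b t a' b' t'. (a, b, t) \<in> mvs M \<Longrightarrow> (a', b', t') \<in> mvs (M - {b}) \<Longrightarrow> a' = a \<or> b' = a
      \<Longrightarrow> mpst (M - {b} - {b'}) (upd (upd v a b t) a' b' t') = w \<Longrightarrow> t = Both \<and> t' = Both"
  shows "(\<Sum>(a, b, t)\<in>mvs M. msgn M b t * chain_val (M - {b}) (upd v a b t) (w # C) u) = 0"
proof -
  define F where "F = (\<lambda>((a, b, t), (a', b', t')).
    if mpst (M - {b} - {b'}) (upd (upd v a b t) a' b' t') = w
    then msgn M b t * (msgn (M - {b}) b' t' * chain_val (M - {b} - {b'}) (upd (upd v a b t) a' b' t') C u)
    else 0)"
  define Q where "Q = (SIGMA p : mvs M. mvs (M - {fst (snd p)}))"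
  \<comment> \<open>\<open>Q1\<close> and \<open>Q2\<close> collect the double moves on disjoint
    pairs of keys, according to which removed key is smaller. In \<open>Q3\<close> the second move
    uses the block made by the first.\<close>
  define Q1 where "Q1 = {((a, b, t), (a', b', t')) | a b t a' b' t'. ((a, b, t), (a', b', t')) \<in> Q \<and> a' \<noteq> a \<and> b' \<noteq> a \<and> b < b'}"
  define Q2 where "Q2 = {((a, b, t), (a', b', t')) | a b t a' b' t'. ((a, b, t), (a', b', t')) \<in> Q \<and> a' \<noteq> a \<and> b' \<noteq> a \<and> b' < b}"
  define Q3 where "Q3 = {((a, b, t), (a', b', t')) | a b t a' b' t'. ((a, b, t), (a', b', t')) \<in> Q \<and> (a' = a \<or> b' = a)}"
  have finQ: "finite Q" unfolding Q_def using fin by (intro finite_SigmaI finite_mvs) auto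
  have Qm: "((a, b, t), (a', b', t')) \<in> Q \<longleftrightarrow> a \<in> M \<and> b \<in> M \<and> a < b \<and> a' \<in> M \<and> b' \<in> M \<and> a' \<noteq> b \<and> b' \<noteq> b \<and> a' < b'"
    for a b t a' b' t' by (auto simp: Q_def mvs_def)
  have "(\<Sum>(a, b, t)\<in>mvs M. msgn M b t * chain_val (M - {b}) (upd v a b t) (w # C) u)
      = (\<Sum>p\<in>mvs M. \<Sum>q\<in>mvs (M - {fst (snd p)}). F (p, q))"
    by (simp add: sum_distrib_left F_def case_prod_unfold if_distrib cong: if_cong)
  also have "\<dots> = sum F Q" unfolding Q_def using fin by (subst sum.Sigma) (auto intro: finite_mvs)
  also have "\<dots> = sum F (Q1 \<union> Q2 \<union> Q3)"
  proof -
    have "p \<in> Q1 \<union> Q2 \<union> Q3" if "p \<in> Q" for p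
    proof -
      obtain a b t a' b' t' where "p = ((a, b, t), (a', b', t'))" by (metis prod.exhaust)
      then show ?thesis using that Qm[of a b t a' b' t'] unfolding Q1_def Q2_def Q3_def by (auto simp: neq_iff)
    qed
    moreover have "Q1 \<union> Q2 \<union> Q3 \<subseteq> Q" by (auto simp: Q1_def Q2_def Q3_def)
    ultimately show ?thesis by (metis subsetI subset_antisym)
  qed
  also have "\<dots> = sum F Q1 + sum F Q2 + sum F Q3"
  proof -
    have "finite Q1" "finite Q2" "finite Q3"
      using finQ by (auto intro: finite_subset[of _ Q] simp: Q1_def Q2_def Q3_def)
    moreover have "Q1 \<inter> Q2 = {}" "(Q1 \<union> Q2) \<inter> Q3 = {}" by (auto simp: Q1_def Q2_def Q3_def)
    ultimately show ?thesis by (simp add: sum.union_disjoint)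
  qed
  also have "sum F Q1 + sum F Q2 = 0"
  proof -
    have "sum F Q1 = (\<Sum>p\<in>Q2. - F p)"
    proof (rule sum.reindex_bij_witness[where i = "\<lambda>(p, q). (q, p)" and j = "\<lambda>(p, q). (q, p)"])
      fix p assume "p \<in> Q1"
      then obtain a b t a' b' t' where p: "p = ((a, b, t), (a', b', t'))" "p \<in> Q" "a' \<noteq> a" "b' \<noteq> a" "b < b'"
        unfolding Q1_def by blast
      then have m: "a \<in> M" "b \<in> M" "a < b" "a' \<in> M" "b' \<in> M" "a' \<noteq> b" "b' \<noteq> b" "a' < b'" using Qm by auto
      show "(\<lambda>(p, q). (q, p)) p \<in> Q2" using p m Qm by (auto simp: Q2_def)
      have M2: "M - {b'} - {b} = M - {b} - {b'}" by auto
      have u2: "upd (upd v a' b' t') a b t = upd (upd v a b t) a' b' t'"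
        using p m by (auto simp: upd_def fun_eq_iff)
      have "{m \<in> M - {b'}. m < b} = {m \<in> M. m < b}" using p by auto
      then have c1: "card {m \<in> M. m \<noteq> b' \<and> m < b} = card {m \<in> M. m < b}" by simp
      \<comment> \<open>The source of the sign: \<open>b\<close> counts below \<open>b'\<close> only
        as long as it has not been removed.\<close>
      have "{m \<in> M. m < b'} = insert b {m \<in> M - {b}. m < b'}" using p m by auto
      then have c2: "card {m \<in> M. m < b'} = Suc (card {m \<in> M - {b}. m < b'})" using fin by simp
      show "- F ((\<lambda>(p, q). (q, p)) p) = F p"
        by (simp add: p(1) F_def M2 u2 msgn_def c1 c2 algebra_simps)
    qed (auto simp: Q1_def Q2_def Qm)
    then show ?thesis by (simp add: sum_negf)
  qed
  also have "sum F Q3 = 0"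
  proof -
    \<comment> \<open>Three keys \<open>i < j < k\<close> can be bracketed into \<open>i\<close> in
      three ways, given by \<open>g1\<close>, \<open>g2\<close> and \<open>g3\<close>. Their signs
      are those of the Jacobi identity.\<close>
    define T where "T = {(i, j, k). i \<in> M \<and> j \<in> M \<and> k \<in> M \<and> i < j \<and> j < k}"
    define g1 where "g1 = (\<lambda>(i, j, k :: nat). ((i :: nat, j :: nat, Both), (i, k, Both)))"
    define g2 where "g2 = (\<lambda>(i, j, k :: nat). ((i :: nat, k, Both), (i, j :: nat, Both)))"
    define g3 where "g3 = (\<lambda>(i :: nat, j :: nat, k :: nat). ((j, k, Both), (i, j, Both)))"
    have finT: "finite T" by (rule finite_subset[of _ "M \<times> M \<times> M"]) (use fin in \<open>auto simp: T_def\<close>)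
    have inj: "inj_on g1 T" "inj_on g2 T" "inj_on g3 T" by (auto simp: inj_on_def g1_def g2_def g3_def)
    have dis: "g1 ` T \<inter> g2 ` T = {}" "(g1 ` T \<union> g2 ` T) \<inter> g3 ` T = {}"
      by (auto simp: T_def g1_def g2_def g3_def)
    have sub: "g1 ` T \<union> g2 ` T \<union> g3 ` T \<subseteq> Q3"
      by (auto simp: T_def g1_def g2_def g3_def Q3_def Qm)
    have "F p = 0" if p3: "p \<in> Q3 - (g1 ` T \<union> g2 ` T \<union> g3 ` T)" for p
    proof (rule ccontr)
      assume nz: "F p \<noteq> 0"
      obtain a b t a' b' t' where p: "p = ((a, b, t), (a', b', t'))" "p \<in> Q" "a' = a \<or> b' = a"
        using p3 unfolding Q3_def by blast
      then have m: "a \<in> M" "b \<in> M" "a < b" "a' \<in> M" "b' \<in> M" "a' \<noteq> b" "b' \<noteq> b" "a' < b'" using Qm by auto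
      have "mpst (M - {b} - {b'}) (upd (upd v a b t) a' b' t') = w"
        using nz by (auto simp: p(1) F_def split: if_splits)
      then have tt: "t = Both" "t' = Both" using H[of a b t a' b' t'] p m by (auto simp: mvs_def)
      consider "a' = a" "b < b'" | "a' = a" "b' < b" | "b' = a" using p(3) m by linarith
      then have "p \<in> g1 ` T \<union> g2 ` T \<union> g3 ` T"
      proof cases
        case 1
        then have "p = g1 (a, b, b')" "(a, b, b') \<in> T" using p m tt by (auto simp: g1_def T_def)
        then show ?thesis by blast
      next
        case 2
        then have "p = g2 (a, b', b)" "(a, b', b) \<in> T" using p m tt by (auto simp: g2_def T_def)
        then show ?thesis by blast
      next
        case 3
        then have "p = g3 (a', a, b)" "(a', a, b) \<in> T" using p m tt by (auto simp: g3_def T_def)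
        then show ?thesis by blast
      qed
      then show False using p3 by blast
    qed
    then have "sum F Q3 = sum F (g1 ` T \<union> g2 ` T \<union> g3 ` T)"
      using sub finQ by (intro sum.mono_neutral_right) (auto intro: finite_subset[of _ Q] simp: Q3_def)
    also have "\<dots> = sum F (g1 ` T) + sum F (g2 ` T) + sum F (g3 ` T)"
      using finT dis by (simp add: sum.union_disjoint)
    also have "\<dots> = (\<Sum>p\<in>T. F (g1 p) + F (g2 p) + F (g3 p))"
      by (simp add: sum.reindex inj sum.distrib)
    also have "\<dots> = 0"
    proof (rule sum.neutral, rule ballI)
      fix p assume "p \<in> T"
      then obtain i j k where p: "p = (i, j, k)" "i \<in> M" "j \<in> M" "k \<in> M" "i < j" "j < k"
        by (auto simp: T_def)
      let ?N = "M - {j} - {k}"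
      have N: "i \<in> ?N" "finite ?N" "card ?N = Suc (length C)" using p fin card by auto
      have N': "M - {k} - {j} = ?N" by auto
      define S where "S = (fst (fst (v i)) \<union> fst (fst (v j)) \<union> fst (fst (v k)),
        snd (fst (v i)) \<union> snd (fst (v j)) \<union> snd (fst (v k)))"
      let ?x = "snd (v i)" and ?y = "snd (v j)" and ?z = "snd (v k)"
      have u: "upd (upd v i j Both) i k Both m = (v(i := (S, lie_br (lie_br ?x ?y) ?z))) m"
        "upd (upd v i k Both) i j Both m = (v(i := (S, lie_br (lie_br ?x ?z) ?y))) m"
        "upd (upd v j k Both) i j Both m = (v(i := (S, lie_br ?x (lie_br ?y ?z)))) m" if "m \<in> ?N" for m
        using that p by (auto simp: upd_def opv_def S_def)
      have cv: "chain_val ?N (upd (upd v i j Both) i k Both) C = chain_val ?N (v(i := (S, lie_br (lie_br ?x ?y) ?z))) C"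
        "chain_val ?N (upd (upd v i k Both) i j Both) C = chain_val ?N (v(i := (S, lie_br (lie_br ?x ?z) ?y))) C"
        "chain_val ?N (upd (upd v j k Both) i j Both) C = chain_val ?N (v(i := (S, lie_br ?x (lie_br ?y ?z)))) C"
        by (rule chain_val_cong, erule u)+
      have ms: "mpst ?N (v(i := (S, X))) = mpst ?N (v(i := (S, Y)))" for X Y
        unfolding mpst_def by (intro image_cong refl) simp
      have mp: "mpst ?N (upd (upd v i j Both) i k Both) = mpst ?N (v(i := (S, ?x)))"
        "mpst ?N (upd (upd v i k Both) i j Both) = mpst ?N (v(i := (S, ?x)))"
        "mpst ?N (upd (upd v j k Both) i j Both) = mpst ?N (v(i := (S, ?x)))"
        by (subst ms[of ?x], rule mpst_cong, erule u)+
      have "{m \<in> M - {k}. m < j} = {m \<in> M. m < j}" using p by auto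
      then have c1: "card {m \<in> M. m \<noteq> k \<and> m < j} = card {m \<in> M. m < j}" by simp
      have "{m \<in> M. m < k} = insert j {m \<in> M - {j}. m < k}" using p by auto
      then have c2: "card {m \<in> M. m < k} = Suc (card {m \<in> M - {j}. m < k})" using fin by simp
      define \<epsilon> where "\<epsilon> = (- 1 :: 'k) ^ card {m \<in> M. m < j} * (- 1) ^ card {m \<in> M - {j}. m < k}"
      have J: "chain_val ?N (v(i := (S, lie_br ?x (lie_br ?y ?z)))) C u
          = chain_val ?N (v(i := (S, lie_br (lie_br ?x ?y) ?z))) C u
            - chain_val ?N (v(i := (S, lie_br (lie_br ?x ?z) ?y))) C u"
      proof -
        have "lie_br ?x (lie_br ?y ?z) = (\<lambda>w. - 1 * lie_br (lie_br ?x ?z) ?y w + lie_br (lie_br ?x ?y) ?z w)"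
          by (simp add: fun_eq_iff lie_br_jacobi)
        then show ?thesis using chain_val_lin[OF N(2,3,1), of v S "- 1" _ _ u] by simp
      qed
      have G1: "F (g1 p) = (if mpst ?N (v(i := (S, ?x))) = w
          then \<epsilon> * chain_val ?N (v(i := (S, lie_br (lie_br ?x ?y) ?z))) C u else 0)"
        by (simp add: F_def g1_def p(1) cv mp msgn_def \<epsilon>_def mult.assoc del: fun_upd_apply)
      have G2: "F (g2 p) = (if mpst ?N (v(i := (S, ?x))) = w
          then - \<epsilon> * chain_val ?N (v(i := (S, lie_br (lie_br ?x ?z) ?y))) C u else 0)"
        by (simp add: F_def g2_def p(1) N' cv mp msgn_def \<epsilon>_def c1 c2 algebra_simps del: fun_upd_apply)
      have G3: "F (g3 p) = (if mpst ?N (v(i := (S, ?x))) = w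
          then - \<epsilon> * chain_val ?N (v(i := (S, lie_br ?x (lie_br ?y ?z)))) C u else 0)"
        by (simp add: F_def g3_def p(1) N' cv mp msgn_def \<epsilon>_def c1 c2 algebra_simps del: fun_upd_apply)
      show "F (g1 p) + F (g2 p) + F (g3 p) = 0"
        unfolding G1 G2 G3 J by (simp add: right_diff_distrib del: fun_upd_apply)
    qed
    finally show ?thesis .
  qed
  finally show ?thesis by simp
qed

section \<open>Relations between the values of neighbouring chains\<close>

definition btw :: "nat \<Rightarrow> mpart \<Rightarrow> mpart \<Rightarrow> mpart set" where
  "btw n y w = {z \<in> MP n. mp_less z y \<and> mp_less w z \<and> Suc (card z) = card y \<and> Suc (card w) = card z}"

lemma finite_btw: "finite (btw n y w)"
  by (rule finite_subset[OF _ finite_MP]) (auto simp: btw_def)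

text \<open>The second merge absorbs the block made by the first. Hence two new blocks show that the
  merges were disjoint.\<close>

lemma connected_moves_new_blocks:
  assumes v: "valid_state n M v" and "a \<in> M" "b \<in> M" "a' \<in> M - {b}" "b' \<in> M - {b}" "a' = a \<or> b' = a"
  shows "card (mpst (M - {b} - {b'}) (upd (upd v a b t) a' b' t') - mpst M v) \<le> 1"
proof -
  let ?v = "upd (upd v a b t) a' b' t'"
  have "mpst (M - {b} - {b'}) ?v - mpst M v \<subseteq> {fst (?v a')}"
  proof
    fix x assume x: "x \<in> mpst (M - {b} - {b'}) ?v - mpst M v"
    then obtain k where k: "k \<in> M - {b} - {b'}" "x = fst (?v k)" by (auto simp: mpst_def)
    have "k = a'"
    proof (rule ccontr)
      assume "k \<noteq> a'"
      then have "?v k = v k" using k assms(6) by (auto simp: upd_def)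
      then show False using x k by (auto simp: mpst_def)
    qed
    then show "x \<in> {fst (?v a')}" using k by simp
  qed
  then have "card (mpst (M - {b} - {b'}) ?v - mpst M v) \<le> card {fst (?v a')}" by (intro card_mono) auto
  then show ?thesis by simp
qed

text \<open>The condition on \<open>w\<close> selects intervals on which the algebra has a relation:
  equal pointed sets leave only brackets, and two new blocks leave only disjoint merges. The prefix
  \<open>P\<close> is peeled off by induction, since its moves only change the starting
  state.\<close>

lemma chain_val_interval_sum:
  fixes v :: "nat \<Rightarrow> 'k::comm_ring_1 cell"
  assumes "valid_state n M v" "card M = length P + length C + 3"
    and "pts w = pts (last (mpst M v # P)) \<or> card (w - last (mpst M v # P)) = 2"
  shows "(\<Sum>z\<in>btw n (last (mpst M v # P)) w. chain_val M v (P @ z # w # C) u) = 0"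
  using assms
proof (induction P arbitrary: M v)
  case Nil
  let ?y = "mpst M v"
  have fin: "finite M" using Nil(1) by (simp add: valid_state_def)
  \<comment> \<open>A move that can be continued to \<open>w\<close> leads into \<open>btw\<close>,
    so the sum over \<open>z\<close> counts every contributing move once.\<close>
  have inZ: "mpst (M - {b}) (upd v a b t) \<in> btw n ?y w"
    if mv: "(a, b, t) \<in> mvs M" and nz: "chain_val (M - {b}) (upd v a b t) (w # C) u \<noteq> 0" for a b t
  proof -
    have ab: "a \<in> M" "b \<in> M" "a \<noteq> b" using mv by (auto simp: mvs_def)
    note st = state_step[OF Nil(1) ab, of t]
    have "\<exists>a' b' t'. (a', b', t') \<in> mvs (M - {b}) \<and> mpst (M - {b} - {b'}) (upd (upd v a b t) a' b' t') = w"
    proof (rule ccontr)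
      assume "\<not> ?thesis"
      then have "chain_val (M - {b}) (upd v a b t) (w # C) u = 0"
        unfolding chain_val.simps by (intro sum.neutral) auto
      then show False using nz by simp
    qed
    then obtain a' b' t' where "(a', b', t') \<in> mvs (M - {b})"
      "mpst (M - {b} - {b'}) (upd (upd v a b t) a' b' t') = w" by blast
    then have "mp_less w (mpst (M - {b}) (upd v a b t))" "Suc (card w) = card (mpst (M - {b}) (upd v a b t))"
      using state_step[OF st(1), of a' b' t'] by (auto simp: mvs_def)
    then show ?thesis using st(2-4) by (simp add: btw_def)
  qed
  have "(\<Sum>z\<in>btw n ?y w. chain_val M v (z # w # C) u)
      = (\<Sum>p\<in>mvs M. \<Sum>z\<in>btw n ?y w. case p of (a, b, t) \<Rightarrow>
          if mpst (M - {b}) (upd v a b t) = z then msgn M b t * chain_val (M - {b}) (upd v a b t) (w # C) u else 0)"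
    unfolding chain_val.simps(2)[of M v] by (rule sum.swap)
  also have "\<dots> = (\<Sum>(a, b, t)\<in>mvs M. msgn M b t * chain_val (M - {b}) (upd v a b t) (w # C) u)"
  proof (intro sum.cong refl)
    fix p assume p: "p \<in> mvs M"
    obtain a b t where abt: "p = (a, b, t)" by (cases p)
    show "(\<Sum>z\<in>btw n ?y w. case p of (a, b, t) \<Rightarrow>
          if mpst (M - {b}) (upd v a b t) = z then msgn M b t * chain_val (M - {b}) (upd v a b t) (w # C) u else 0)
        = (case p of (a, b, t) \<Rightarrow> msgn M b t * chain_val (M - {b}) (upd v a b t) (w # C) u)"
      using inZ[of a b t] p finite_btw[of n ?y w] unfolding abt
      by (cases "chain_val (M - {b}) (upd v a b t) (w # C) u = 0")
        (simp_all add: sum.delta' del: chain_val.simps cong: if_cong)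
  qed
  also have "\<dots> = 0"
  proof (rule double_move_sum[OF fin])
    show "card M = Suc (Suc (Suc (length C)))" using Nil by simp
    fix a b t a' b' t'
    assume mv: "(a, b, t) \<in> mvs M" "(a', b', t') \<in> mvs (M - {b})" and con: "a' = a \<or> b' = a"
      and w: "mpst (M - {b} - {b'}) (upd (upd v a b t) a' b' t') = w"
    have ab: "a \<in> M" "b \<in> M" "a \<noteq> b" "a' \<in> M - {b}" "b' \<in> M - {b}" "a' \<noteq> b'" using mv by (auto simp: mvs_def)
    note st = state_step[OF Nil(1) ab(1-3), of t]
    note st' = state_step[OF st(1) ab(4-6), of t', unfolded w]
    have "card (w - ?y) \<le> 1"
      using connected_moves_new_blocks[OF Nil(1) ab(1,2,4,5) con, of t t'] w by simp
    then have "pts w = pts ?y" using Nil(3) by simp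
    then show "t = Both \<and> t' = Both" using st(5,6) st'(5,6) by blast
  qed
  finally show ?case by simp
next
  case (Cons p P)
  let ?y = "last (p # P)"
  have "(\<Sum>z\<in>btw n ?y w. chain_val M v (p # P @ z # w # C) u)
      = (\<Sum>q\<in>mvs M. \<Sum>z\<in>btw n ?y w. case q of (a, b, t) \<Rightarrow>
          if mpst (M - {b}) (upd v a b t) = p
          then msgn M b t * chain_val (M - {b}) (upd v a b t) (P @ z # w # C) u else 0)"
    unfolding chain_val.simps(2)[of M v] by (rule sum.swap)
  also have "\<dots> = 0"
  proof (rule sum.neutral, rule ballI)
    fix q assume q: "q \<in> mvs M"
    obtain a b t where abt: "q = (a, b, t)" by (cases q)
    have ab: "a \<in> M" "b \<in> M" "a \<noteq> b" using q abt by (auto simp: mvs_def)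
    have fin: "finite M" using Cons.prems by (simp add: valid_state_def)
    show "(\<Sum>z\<in>btw n ?y w. case q of (a, b, t) \<Rightarrow>
          if mpst (M - {b}) (upd v a b t) = p
          then msgn M b t * chain_val (M - {b}) (upd v a b t) (P @ z # w # C) u else 0) = 0"
    proof (cases "mpst (M - {b}) (upd v a b t) = p")
      case True
      have "(\<Sum>z\<in>btw n ?y w. chain_val (M - {b}) (upd v a b t) (P @ z # w # C) u) = 0"
        using Cons.IH[OF state_step(1)[OF Cons.prems(1) ab, of t]] Cons.prems ab fin True by simp
      then show ?thesis using True abt by (simp flip: sum_distrib_left)
    next
      case False
      then show ?thesis using abt by simp
    qed
  qed
  finally show ?case by simp
qed

lemma init_state: "valid_state n {1..n} init_cell" "mpst {1..n} init_cell = top_mp n"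
proof -
  show m: "mpst {1..n} init_cell = top_mp n" by (simp add: mpst_def init_cell_def top_mp_def)
  show "valid_state n {1..n} init_cell"
    unfolding valid_state_def m using top_mp_MP by (auto simp: inj_on_def init_cell_def)
qed

lemma top_val_interval_sum:
  assumes "n = length P + length C + 3" "y = last (top_mp n # P)" "pts w = pts y \<or> card (w - y) = 2"
  shows "(\<Sum>z\<in>btw n y w. top_val n (P @ z # w # C) u) = (0 :: 'k::comm_ring_1)"
proof -
  have "(\<Sum>z\<in>btw n (last (mpst {1..n} (init_cell :: nat \<Rightarrow> 'k cell) # P)) w.
      chain_val {1..n} init_cell (P @ z # w # C) u) = (0 :: 'k)"
  proof (rule chain_val_interval_sum[OF init_state(1)])
    show "card {1..n} = length P + length C + 3" using assms(1) by simp
    show "pts w = pts (last (mpst {1..n} init_cell # P)) \<or> card (w - last (mpst {1..n} init_cell # P)) = 2"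
      unfolding init_state(2) using assms(2,3) by blast
  qed
  then show ?thesis unfolding init_state(2) top_val_def assms(2) .
qed

text \<open>From fine to coarse: once a merge keeps all points, so do the later ones.\<close>
fun good :: "mpart list \<Rightarrow> bool" where
  "good (y # z # w # R) = ((pts z = pts y \<longrightarrow> pts w = pts z) \<and> good (z # w # R))"
| "good _ = True"

text \<open>\<open>good\<close> sees only which consecutive partitions have equal pointed
  sets.\<close>

lemma good_replace:
  assumes "good (P @ y # z # w # R)" "pts z = pts y \<longleftrightarrow> pts z' = pts y" "pts w = pts z \<longleftrightarrow> pts w = pts z'"
  shows "good (P @ y # z' # w # R)"
  using assms(1)
proof (induction P rule: induct_list012)
  case 1
  then show ?case using assms by (cases R) auto
next
  case (2 x)
  then have g: "good (x # y # z # w # R)" by simp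
  then have "pts y = pts x \<longrightarrow> pts z = pts y" "good (y # z # w # R)" by simp_all
  moreover from this(2) have "good (y # z' # w # R)" using assms(2,3) by (cases R) auto
  moreover have "pts y = pts x \<longrightarrow> pts z' = pts y" using calculation(1) assms(2) by blast
  ultimately show ?case by simp
next
  case (3 x x' P)
  then show ?case by (cases P) auto
qed

lemma pts_le: "x \<in> MP n \<Longrightarrow> y \<in> MP n \<Longrightarrow> mp_less x y \<Longrightarrow> pts x \<subseteq> pts y"
  using mp_le_iff unfolding mp_less_def by blast

lemma mlab_sign:
  assumes "y \<in> MP n" "x \<in> MP n" "mp_less x y" "Suc (card x) = card y"
  shows "pts x = pts y \<longleftrightarrow> mlab y x < 0"
proof -
  have "mp_le x y" using assms(3) by (simp add: mp_less_def)
  from cover_cases[OF assms(2,1) this assms(4)] obtain b c P where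
    m: "b \<in> y" "c \<in> y" "b \<noteq> c" "P = snd b \<union> snd c \<or> P = snd b" "x = mrg y b c P" by blast
  define k where "k = min (key b) (key c)"
  have "0 < k" using key_pos[OF assms(1)] m by (simp add: k_def)
  moreover have "mlab y x = (if P = snd b \<union> snd c then - int k else int k)"
    unfolding m(5) k_def by (rule mrg_props(5)[OF assms(1) m(1-4)])
  moreover have "pts x = pts y \<longleftrightarrow> P = snd b \<union> snd c"
    unfolding m(5) by (rule pts_mrg(2)[OF assms(1) m(1-4)])
  ultimately show ?thesis by (cases "P = snd b \<union> snd c") simp_all
qed

text \<open>A product followed by a larger label is followed by a product. The block just made has
  the previous label as its key, so a merge involving it could not have a larger one; the second
  product therefore avoids it. The dropped points in both new blocks allow the products to be
  recognised in either order.\<close>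

lemma disjoint_left_merges:
  assumes y: "y \<in> MP n" and z: "z \<in> MP n" and w: "w \<in> MP n"
    and zy: "mp_less z y" "Suc (card z) = card y" and wz: "mp_less w z" "Suc (card w) = card z"
    and lab: "mlab y z < mlab z w" and nb: "pts z \<noteq> pts y"
  shows "card (w - y) = 2" "\<And>N. N \<in> w - y \<Longrightarrow> \<exists>i. i \<in> pts y \<and> i \<in> fst N \<and> i \<notin> snd N"
    "pts w \<noteq> pts z"
proof -
  have le: "mp_le z y" "mp_le w z" using zy wz by (auto simp: mp_less_def)
  obtain b c P where m: "b \<in> y" "c \<in> y" "b \<noteq> c" "P = snd b \<union> snd c \<or> P = snd b" "z = mrg y b c P"
    using cover_cases[OF z y le(1) zy(2)] by blast
  note mp = mrg_props[OF y m(1-4)]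
  have Pb: "P = snd b" "P \<noteq> snd b \<union> snd c" using m pts_mrg(2)[OF y m(1-4)] nb by auto
  have pos: "0 < mlab y z" using mp(5) m(5) Pb(2) key_pos[OF y] m(1,2) by simp
  obtain d e R where m': "d \<in> z" "e \<in> z" "d \<noteq> e" "R = snd d \<union> snd e \<or> R = snd d" "w = mrg z d e R"
    using cover_cases[OF w z le(2) wz(2)] by blast
  note mp' = mrg_props[OF z m'(1-4)]
  show nw: "pts w \<noteq> pts z" using mlab_sign[OF z w wz] lab pos by auto
  have Rd: "R = snd d" "R \<noteq> snd d \<union> snd e" using m' pts_mrg(2)[OF z m'(1-4)] nw by auto
  have l: "min (key b) (key c) < min (key d) (key e)"
    using lab mp(5) mp'(5) m(5) m'(5) Pb Rd by simp
  let ?N = "(fst b \<union> fst c, snd b)" and ?N2 = "(fst d \<union> fst e, snd d)"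
  have kN: "key ?N = min (key b) (key c)" using MP_block(4,5)[OF y] m by (simp add: Min_Un)
  have ne: "d \<noteq> ?N" "e \<noteq> ?N" using l kN by auto
  have de: "d \<in> y - {b, c}" "e \<in> y - {b, c}" using m'(1,2) ne m(5) Pb by (auto simp: mrg_def)
  have N2: "?N2 \<notin> y" using mp'(4) Rd mrg_props(4)[OF y _ _ m'(3), of "snd d"] de by simp
  have NN: "?N \<noteq> ?N2" using mp'(4) Rd m(5) Pb by (auto simp: mrg_def)
  have N1: "?N \<notin> y" using mp(4) Pb by simp
  have wy: "w - y = {?N, ?N2}"
  proof -
    have "w = insert ?N2 (insert ?N (y - {b, c}) - {d, e})" using m(5) m'(5) Pb Rd by (simp add: mrg_def)
    then show ?thesis using N1 N2 ne by auto
  qed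
  then show "card (w - y) = 2" using NN by simp
  fix N assume "N \<in> w - y"
  then consider "N = ?N" | "N = ?N2" using wy by blast
  then show "\<exists>i. i \<in> pts y \<and> i \<in> fst N \<and> i \<notin> snd N"
  proof cases
    case 1
    obtain i where i: "i \<in> snd c" using MP_block(1)[OF y m(2)] by blast
    then have "i \<in> fst c" using MP_snd_fst[OF y m(2)] by blast
    moreover have "i \<notin> snd b" using MP_snd_fst[OF y m(1)] MP_disj[OF y m(1,2)] calculation m(3) by blast
    ultimately show ?thesis using i m(2) 1 by (intro exI[of _ i]) (auto simp: pts_def)
  next
    case 2
    have ey: "e \<in> y" "d \<in> y" using de by auto
    obtain i where i: "i \<in> snd e" using MP_block(1)[OF y ey(1)] by blast
    then have "i \<in> fst e" using MP_snd_fst[OF y ey(1)] by blast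
    moreover have "i \<notin> snd d" using MP_snd_fst[OF y ey(2)] MP_disj[OF y ey(2,1)] calculation m'(3) by blast
    ultimately show ?thesis using i ey(1) 2 by (intro exI[of _ i]) (auto simp: pts_def)
  qed
qed

text \<open>Every chain through the interval of such an ascent has merges of the same kinds. After a
  bracket goodness leaves the pointed set constant, so nothing is lost on the way. For two products
  both new blocks contain a lost point, so each merge is a product whichever comes first.\<close>

lemma ascent_interval_types:
  assumes y: "y \<in> MP n" and w: "w \<in> MP n" and z: "z \<in> btw n y w" and z': "z' \<in> btw n y w"
    and lab: "mlab y z < mlab z w" and g: "pts z = pts y \<longrightarrow> pts w = pts z"
  shows "pts w = pts y \<or> card (w - y) = 2"
    "pts z = pts y \<longleftrightarrow> pts z' = pts y" "pts w = pts z \<longleftrightarrow> pts w = pts z'"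
proof -
  have zz: "z \<in> MP n" "mp_less z y" "Suc (card z) = card y" "mp_less w z" "Suc (card w) = card z"
    and zz': "z' \<in> MP n" "mp_less z' y" "Suc (card z') = card y" "mp_less w z'" "Suc (card w) = card z'"
    using z z' by (auto simp: btw_def)
  have sub: "pts w \<subseteq> pts z'" "pts z' \<subseteq> pts y" using pts_le w y zz' by blast+
  have "(pts w = pts y \<or> card (w - y) = 2) \<and> (pts z = pts y \<longleftrightarrow> pts z' = pts y)
      \<and> (pts w = pts z \<longleftrightarrow> pts w = pts z')"
  proof (cases "pts z = pts y")
    case True
    then show ?thesis using g sub by auto
  next
    case False
    note dl = disjoint_left_merges[OF y zz(1) w zz(2-5) lab False]
    have le: "mp_le z' y" "mp_le w z'" using zz' by (auto simp: mp_less_def)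
    obtain b c P where m: "b \<in> y" "c \<in> y" "b \<noteq> c" "P = snd b \<union> snd c \<or> P = snd b" "z' = mrg y b c P"
      using cover_cases[OF zz'(1) y le(1) zz'(3)] by blast
    obtain d e R where m': "d \<in> z'" "e \<in> z'" "d \<noteq> e" "R = snd d \<union> snd e \<or> R = snd d" "w = mrg z' d e R"
      using cover_cases[OF w zz'(1) le(2) zz'(5)] by blast
    let ?N = "(fst b \<union> fst c, P)" and ?N2 = "(fst d \<union> fst e, R)"
    have weq: "w = insert ?N2 (insert ?N (y - {b, c}) - {d, e})" using m(5) m'(5) by (simp add: mrg_def)
    have ne: "d \<noteq> ?N" "e \<noteq> ?N"
    proof -
      have "d \<noteq> ?N \<and> e \<noteq> ?N"
      proof (rule ccontr)
        assume "\<not> ?thesis"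
        then have "w - y \<subseteq> {?N2}" unfolding weq by auto
        then have "card (w - y) \<le> card {?N2}" by (intro card_mono) auto
        then show False using dl(1) by simp
      qed
      then show "d \<noteq> ?N" "e \<noteq> ?N" by auto
    qed
    then have de: "d \<in> y" "e \<in> y" using m'(1,2) m(5) by (auto simp: mrg_def)
    have N: "?N \<in> w - y" "?N2 \<in> w - y"
    proof -
      have "?N \<notin> y" using mrg_props(4)[OF y m(1-4)] .
      then show "?N \<in> w - y" unfolding weq using ne by auto
      have "?N2 \<notin> y" using mrg_props(4)[OF y de m'(3,4)] .
      then show "?N2 \<in> w - y" unfolding weq by auto
    qed
    have NMP: "?N \<in> z'" "?N2 \<in> w" using m(5) m'(5) by (auto simp: mrg_def)
    obtain i where i: "i \<in> pts y" "i \<in> fst ?N" "i \<notin> snd ?N" using dl(2)[OF N(1)] by blast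
    then have 1: "pts z' \<noteq> pts y" using pts_block[OF zz'(1) NMP(1)] by blast
    obtain j where j: "j \<in> pts y" "j \<in> fst ?N2" "j \<notin> snd ?N2" using dl(2)[OF N(2)] by blast
    then have "j \<notin> pts w" using pts_block[OF w NMP(2)] by blast
    moreover have "j \<in> fst d \<or> j \<in> fst e" using j by auto
    then have "j \<in> snd d \<or> j \<in> snd e" using j(1) pts_block[OF y de(1)] pts_block[OF y de(2)] by blast
    then have "j \<in> pts z'" using m'(1,2) by (auto simp: pts_def)
    ultimately have "pts w \<noteq> pts z'" by blast
    then show ?thesis using 1 False dl(1,3) by blast
  qed
  then show "pts w = pts y \<or> card (w - y) = 2"
    "pts z = pts y \<longleftrightarrow> pts z' = pts y" "pts w = pts z \<longleftrightarrow> pts w = pts z'" by blast+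
qed

context el_labelling
begin

lemma not_crit_split:
  assumes "\<not> crit C"
  shows "\<exists>P y z R. C = P @ y # z # R \<and> (rk y \<noteq> Suc (rk z) \<or> (\<exists>w R'. R = w # R' \<and> z = fst_step w y))"
  using assms
proof (induction C rule: crit.induct)
  case (1 y z zs)
  show ?case
  proof (cases "crit (z # zs)")
    case True
    then have "rk y \<noteq> Suc (rk z) \<or> (zs \<noteq> [] \<and> z = fst_step (hd zs) y)" using 1 by auto
    then show ?thesis by (intro exI[of _ "[]"] exI[of _ y] exI[of _ z] exI[of _ zs]) (cases zs; auto)
  next
    case False
    then obtain P y' z' R where "z # zs = P @ y' # z' # R"
      "rk y' \<noteq> Suc (rk z') \<or> (\<exists>w R'. R = w # R' \<and> z' = fst_step w y')" using 1 by blast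
    then show ?thesis by (intro exI[of _ "y # P"] exI[of _ y'] exI[of _ z'] exI[of _ R]) simp
  qed
qed auto

lemma dchain_append: "dchain (P @ Q) \<Longrightarrow> dchain P \<and> dchain Q"
  by (auto simp: dchain_iff_sorted sorted_wrt_append)

lemma dchain_length: "dchain C \<Longrightarrow> C \<noteq> [] \<Longrightarrow> rk (last C) + length C \<le> rk (hd C) + 1"
proof (induction C rule: dchain.induct)
  case (3 y z zs)
  then have "rk z < rk y" using rk_less dchain_V by auto
  then show ?case using 3 by auto
qed auto

text \<open>Every step lowers the rank by at least one; if the length accounts for the whole drop,
  each step lowers it by exactly one.\<close>

lemma dchain_maximal_cover:
  assumes "dchain (P @ y # z # R)" "rk (last (P @ y # z # R)) + length (P @ y # z # R) = rk (hd (P @ y # z # R)) + 1"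
  shows "rk y = Suc (rk z)"
proof -
  have d: "dchain (P @ [y])" "dchain (z # R)" "lt z y"
    using assms(1) dchain_append[of "P @ [y]" "z # R"] dchain_append[of P "y # z # R"] by auto
  have V: "y \<in> V" "z \<in> V" using d(2) dchain_V assms(1) by (auto simp: dchain_iff_sorted)
  have "rk y + length (P @ [y]) \<le> rk (hd (P @ [y])) + 1" using dchain_length[OF d(1)] by simp
  moreover have "rk (last (z # R)) + length (z # R) \<le> rk z + 1" using dchain_length[OF d(2)] by simp
  moreover have "hd (P @ [y]) = hd (P @ y # z # R)" by (cases P) auto
  ultimately have "rk y \<le> Suc (rk z)" using assms(2) by simp
  then show ?thesis using rk_less[OF V(2,1) d(3)] by simp
qed

lemma wlab_append: "wlab (P @ y # Q) = wlab (P @ [y]) @ wlab (y # Q)"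
proof (induction P)
  case (Cons p P)
  then show ?case by (cases P) auto
qed simp

text \<open>The words agree down to \<open>y\<close> and first differ in the label of the step below
  \<open>y\<close>. This drives the induction that rewrites chains at an ascent.\<close>

lemma wlab_replace_less:
  assumes "dchain (P @ y # z # Q)" "dchain (P @ y # z' # Q)" "rk y = Suc (rk z)" "rk y = Suc (rk z')"
    and "lab y z < lab y z'"
  shows "(wlab (P @ y # z # Q), wlab (P @ y # z' # Q)) \<in> lexord {(a, b). a < b}"
proof -
  have f: "wlab (y # x # Q) = lab y x # wlab (x # Q)" if "dchain (P @ y # x # Q)" "rk y = Suc (rk x)" for x
  proof -
    have "dchain (y # x # Q)" using dchain_append[OF that(1)] by simp
    then have V: "y \<in> V" "x \<in> V" "lt x y" using dchain_V by auto
    then show ?thesis using fill_rec[OF V(2,1,3)] fst_step_cover[OF V(2,1,3)] that(2) by simp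
  qed
  show ?thesis
    unfolding wlab_append[of P y "z # Q"] wlab_append[of P y "z' # Q"]
      f[OF assms(1,3)] f[OF assms(2,4)] using assms(5) by (simp add: lexord_append_leftI)
qed

end

section \<open>Falling chains and words of trees\<close>

text \<open>A product keeps the points of its left factor, so a tree has its leftmost leaf as only
  point; a bracket keeps the points of both sides, so a word has one point per tree.\<close>

definition wblock :: "mtree list \<Rightarrow> nat set \<times> nat set" where
  "wblock w = (set (lvs w), (\<lambda>t. hd (leaves t)) ` set w)"

definition wmin :: "mtree list \<Rightarrow> nat" where
  "wmin w = Min (set (lvs w))"

definition wpart :: "mtree list set \<Rightarrow> mpart" where
  "wpart S = wblock ` S"

definition wforest :: "nat \<Rightarrow> mtree list set \<Rightarrow> bool" where
  "wforest n S \<longleftrightarrow> (\<forall>w\<in>S. w \<noteq> [] \<and> distinct (lvs w)) \<and> (\<Union>w\<in>S. set (lvs w)) = {1..n}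
     \<and> (\<forall>w\<in>S. \<forall>w'\<in>S. w \<noteq> w' \<longrightarrow> set (lvs w) \<inter> set (lvs w') = {})"

lemma leaves_ne [simp]: "leaves t \<noteq> []"
  by (induction t) auto

lemma lvs_ne: "w \<noteq> [] \<Longrightarrow> set (lvs w) \<noteq> {}"
  by (cases w) auto

lemma wforestD:
  assumes "wforest n S" "w \<in> S"
  shows "w \<noteq> []" "distinct (lvs w)" "set (lvs w) \<noteq> {}" "set (lvs w) \<subseteq> {1..n}" "wmin w \<in> set (lvs w)"
proof -
  show "w \<noteq> []" "distinct (lvs w)" "set (lvs w) \<subseteq> {1..n}" using assms by (auto simp: wforest_def)
  then show "set (lvs w) \<noteq> {}" using lvs_ne by blast
  then show "wmin w \<in> set (lvs w)" unfolding wmin_def by (intro Min_in) auto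
qed

lemma wforest_eq:
  assumes "wforest n S" "w \<in> S" "w' \<in> S" "i \<in> set (lvs w)" "i \<in> set (lvs w')"
  shows "w = w'"
  using assms unfolding wforest_def by blast

lemma wmin_inj:
  assumes "wforest n S" "w \<in> S" "w' \<in> S" "wmin w = wmin w'"
  shows "w = w'"
  using wforest_eq[OF assms(1-3) wforestD(5)[OF assms(1,2)]] wforestD(5)[OF assms(1,3)] assms(4) by simp

lemma wblock_inj:
  assumes "wforest n S" "w \<in> S" "w' \<in> S" "wblock w = wblock w'"
  shows "w = w'"
  using wmin_inj[OF assms(1-3)] assms(4) by (simp add: wblock_def wmin_def)

lemma wpart_MP:
  assumes "wforest n S"
  shows "wpart S \<in> MP n"
  unfolding MP_iff
proof (intro conjI ballI impI)
  fix b assume "b \<in> wpart S"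
  then obtain w where w: "w \<in> S" "b = wblock w" by (auto simp: wpart_def)
  then show "snd b \<noteq> {}" "snd b \<subseteq> fst b"
    using wforestD(1)[OF assms w(1)] by (auto simp: wblock_def)
next
  show "\<Union> (fst ` wpart S) = {1..n}"
    using assms by (simp add: wforest_def wpart_def wblock_def image_image)
next
  fix b c assume "b \<in> wpart S" "c \<in> wpart S" "b \<noteq> c"
  then obtain w w' where "b = wblock w" "c = wblock w'" "w \<in> S" "w' \<in> S" "w \<noteq> w'"
    unfolding wpart_def by blast
  then show "fst b \<inter> fst c = {}"
    using assms unfolding wforest_def by (simp add: wblock_def)
qed

lemma finite_wforest:
  assumes "wforest n S"
  shows "finite S"
proof -
  have "finite (wblock ` S)" using finite_MP_elem[OF wpart_MP[OF assms]] by (simp add: wpart_def)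
  moreover have "inj_on wblock S" using wblock_inj[OF assms] by (auto simp: inj_on_def)
  ultimately show ?thesis using finite_imageD by blast
qed

lemma card_wpart: "wforest n S \<Longrightarrow> card (wpart S) = card S"
  unfolding wpart_def by (intro card_image) (auto simp: inj_on_def intro: wblock_inj)

lemma wforest_merge:
  assumes S: "wforest n S" and w: "w1 \<in> S" "w2 \<in> S" "w1 \<noteq> w2"
    and v: "v \<noteq> []" "distinct (lvs v)" "set (lvs v) = set (lvs w1) \<union> set (lvs w2)"
  shows "wforest n (insert v (S - {w1, w2}))" "v \<notin> S"
proof -
  have dis: "set (lvs v) \<inter> set (lvs u) = {}" if "u \<in> S - {w1, w2}" for u
    using that w v(3) wforest_eq[OF S] by blast
  show "wforest n (insert v (S - {w1, w2}))"
    unfolding wforest_def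
  proof (intro conjI ballI impI)
    fix u assume "u \<in> insert v (S - {w1, w2})"
    then have "u = v \<or> u \<in> S" by blast
    then show "u \<noteq> []" "distinct (lvs u)" using v(1,2) wforestD(1,2)[OF S] by blast+
  next
    have "(\<Union>u\<in>S. set (lvs u)) = (\<Union>u\<in>insert v (S - {w1, w2}). set (lvs u))" using v(3) w by auto
    then show "(\<Union>u\<in>insert v (S - {w1, w2}). set (lvs u)) = {1..n}" using S by (simp add: wforest_def)
  next
    fix u u' assume u: "u \<in> insert v (S - {w1, w2})" "u' \<in> insert v (S - {w1, w2})" "u \<noteq> u'"
    then consider "u = v" "u' \<in> S - {w1, w2}" | "u' = v" "u \<in> S - {w1, w2}" | "u \<in> S" "u' \<in> S" by blast
    then show "set (lvs u) \<inter> set (lvs u') = {}"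
    proof cases
      case 1
      then show ?thesis using dis by simp
    next
      case 2
      then show ?thesis using dis[of u] by (simp add: Int_commute)
    next
      case 3
      then show ?thesis using u(3) wforest_eq[OF S] by blast
    qed
  qed
  show "v \<notin> S"
  proof
    assume "v \<in> S"
    have "wmin w1 \<in> set (lvs v)" "wmin w2 \<in> set (lvs v)"
      using wforestD(5)[OF S w(1)] wforestD(5)[OF S w(2)] v(3) by blast+
    then have "v = w1" "v = w2"
      using wforest_eq[OF S \<open>v \<in> S\<close>] w wforestD(5)[OF S w(1)] wforestD(5)[OF S w(2)] by blast+
    then show False using w(3) by simp
  qed
qed

lemma wpart_merge:
  assumes S: "wforest n S" and w: "w1 \<in> S" "w2 \<in> S" "w1 \<noteq> w2"
    and v: "fst (wblock v) = fst (wblock w1) \<union> fst (wblock w2)"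
  shows "wpart (insert v (S - {w1, w2})) = mrg (wpart S) (wblock w1) (wblock w2) (snd (wblock v))"
proof -
  have "wblock ` (S - {w1, w2}) = wpart S - {wblock w1, wblock w2}"
    using wblock_inj[OF S] w unfolding wpart_def by blast
  moreover have "wblock v = (fst (wblock w1) \<union> fst (wblock w2), snd (wblock v))" using v by (metis prod.collapse)
  ultimately show ?thesis by (simp add: wpart_def mrg_def)
qed

definition wstate :: "mtree list set \<Rightarrow> (nat \<Rightarrow> 'k::comm_ring_1 cell) \<Rightarrow> bool" where
  "wstate S v \<longleftrightarrow> (\<forall>w\<in>S. v (wmin w) = (wblock w, comb w))"

lemma wstate_ex:
  assumes "wforest n S"
  shows "\<exists>v :: nat \<Rightarrow> 'k::comm_ring_1 cell. wstate S v"
proof -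
  have "(THE w'. w' \<in> S \<and> wmin w' = wmin w) = w" if "w \<in> S" for w
    using that wmin_inj[OF assms] by (intro the_equality) auto
  then show ?thesis
    unfolding wstate_def
    by (intro exI[of _ "\<lambda>k. (wblock (THE w. w \<in> S \<and> wmin w = k), comb (THE w. w \<in> S \<and> wmin w = k))"]) simp
qed

lemma wstate_valid:
  assumes "wforest n S" "wstate S v"
  shows "valid_state n (wmin ` S) v" "mpst (wmin ` S) v = wpart S"
proof -
  show m: "mpst (wmin ` S) v = wpart S"
    using assms(2) by (auto simp: mpst_def wpart_def wstate_def image_image intro!: image_cong)
  show "valid_state n (wmin ` S) v"
    unfolding valid_state_def m
    using finite_wforest[OF assms(1)] wpart_MP[OF assms(1)] assms(2) wblock_inj[OF assms(1)]
    by (auto simp: inj_on_def wstate_def)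
qed

text \<open>The new block determines the two merged keys, and the disjoint nonempty pointed sets
  then determine the kind of merge. Thus the defining sum has a single term.\<close>

lemma chain_val_single_move:
  fixes v :: "nat \<Rightarrow> 'k::comm_ring_1 cell"
  assumes v: "valid_state n M v" and mv: "(a, b, t) \<in> mvs M"
  shows "chain_val M v (mpst (M - {b}) (upd v a b t) # D) u = msgn M b t * chain_val (M - {b}) (upd v a b t) D u"
proof -
  have fin: "finite M" and y: "mpst M v \<in> MP n" and inj: "inj_on (\<lambda>k. fst (v k)) M"
    using v by (auto simp: valid_state_def)
  have uniq: "(a', b', t') = (a, b, t)"
    if mv': "(a', b', t') \<in> mvs M" and eq: "mpst (M - {b'}) (upd v a' b' t') = mpst (M - {b}) (upd v a b t)"
    for a' b' t'
  proof -
    have ab: "a \<in> M" "b \<in> M" "a < b" "a' \<in> M" "b' \<in> M" "a' < b'" using mv mv' by (auto simp: mvs_def)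
    have "{fst (opv t' (v a') (v b'))} = {fst (opv t (v a) (v b))}"
      using state_step(7)[OF v ab(4,5), of t'] state_step(7)[OF v ab(1,2), of t] ab eq by simp
    then have e: "fst (fst (v a')) \<union> fst (fst (v b')) = fst (fst (v a)) \<union> fst (fst (v b))"
      "psel t' (snd (fst (v a'))) (snd (fst (v b'))) = psel t (snd (fst (v a))) (snd (fst (v b)))"
      by (simp_all add: opv_def)
    have bl: "fst (v k) \<in> mpst M v" if "k \<in> M" for k using that by (simp add: mpst_def)
    have in2: "k = a \<or> k = b" if k: "k \<in> M" "fst (fst (v k)) \<subseteq> fst (fst (v a)) \<union> fst (fst (v b))" for k
    proof -
      obtain i where "i \<in> fst (fst (v k))" using MP_block(5)[OF y bl[OF k(1)]] by blast
      then have "fst (v k) = fst (v a) \<or> fst (v k) = fst (v b)"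
        using MP_disj[OF y bl[OF k(1)]] bl ab k(2) by blast
      then show ?thesis using inj ab k(1) by (auto dest: inj_onD)
    qed
    have "a' = a \<or> a' = b" "b' = a \<or> b' = b" using in2[of a'] in2[of b'] ab e(1) by blast+
    then have ab': "a' = a" "b' = b" using ab by auto
    note pa = MP_block(1)[OF y bl[OF ab(1)]] and pb = MP_block(1)[OF y bl[OF ab(2)]]
    have "fst (v a) \<noteq> fst (v b)" using inj ab by (auto dest: inj_onD)
    then have "snd (fst (v a)) \<inter> snd (fst (v b)) = {}"
      using MP_disj[OF y bl[OF ab(1)] bl[OF ab(2)]] MP_snd_fst[OF y bl[OF ab(1)]] MP_snd_fst[OF y bl[OF ab(2)]] by blast
    then have "t' = t" using e(2) pa pb unfolding ab' by (cases t; cases t') auto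
    then show ?thesis using ab' by simp
  qed
  have "chain_val M v (mpst (M - {b}) (upd v a b t) # D) u
      = (\<Sum>p\<in>{(a, b, t)}. case p of (a', b', t') \<Rightarrow>
          if mpst (M - {b'}) (upd v a' b' t') = mpst (M - {b}) (upd v a b t)
          then msgn M b' t' * chain_val (M - {b'}) (upd v a' b' t') D u else 0)"
    unfolding chain_val.simps(2)
  proof (intro sum.mono_neutral_right ballI)
    fix p assume p: "p \<in> mvs M - {(a, b, t)}"
    obtain a' b' t' where abt: "p = (a', b', t')" by (cases p)
    then have "mpst (M - {b'}) (upd v a' b' t') \<noteq> mpst (M - {b}) (upd v a b t)" using uniq p by blast
    then show "(case p of (a', b', t') \<Rightarrow>
          if mpst (M - {b'}) (upd v a' b' t') = mpst (M - {b}) (upd v a b t)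
          then msgn M b' t' * chain_val (M - {b'}) (upd v a' b' t') D u else 0) = 0" by (simp add: abt)
  qed (use finite_mvs[OF fin] mv in auto)
  then show ?thesis by simp
qed

lemma msgn_unit: "msgn M b t = (1 :: 'k::comm_ring_1) \<or> msgn M b t = (- 1 :: 'k)"
  unfolding msgn_def by (cases t; cases "even (card {m \<in> M. m < b})") simp_all

text \<open>The merged word has the smaller of the two minima, which is the key that remains. The
  state after the move is therefore again the one prescribed by the forest.\<close>

lemma chain_val_word_merge:
  fixes v v' :: "nat \<Rightarrow> 'k::comm_ring_1 cell"
  assumes S: "wforest n S" and st: "wstate S v" and w: "w1 \<in> S" "w2 \<in> S" "w1 \<noteq> w2"
    and x: "x \<noteq> []" "distinct (lvs x)" "set (lvs x) = set (lvs w1) \<union> set (lvs w2)"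
    and S': "S' = insert x (S - {w1, w2})"
    and op: "opv t (wblock w1, comb w1 :: 'k tens) (wblock w2, comb w2) = (wblock x, comb x)"
    and less: "wmin w1 < wmin w2" and st': "wstate S' v'"
  shows "\<exists>\<epsilon>. (\<epsilon> = 1 \<or> \<epsilon> = - 1) \<and> (\<forall>D u. chain_val (wmin ` S) v (wpart S' # D) u
    = \<epsilon> * chain_val (wmin ` S') v' D u)"
proof -
  let ?a = "wmin w1" and ?b = "wmin w2" and ?M = "wmin ` S"
  have val: "valid_state n ?M v" using wstate_valid(1)[OF S st] .
  have F': "wforest n S'" "x \<notin> S" using wforest_merge[OF S w x] S' by simp_all
  have mv: "(?a, ?b, t) \<in> mvs ?M" using w less by (simp add: mvs_def)
  have xa: "wmin x = ?a"
  proof -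
    have "wmin x = min ?a ?b"
      unfolding wmin_def x(3) using wforestD(3)[OF S] w by (intro Min_Un) auto
    then show ?thesis using less by simp
  qed
  have inj: "wmin u = wmin u' \<longleftrightarrow> u = u'" if "u \<in> S" "u' \<in> S" for u u' using wmin_inj[OF S that] by blast
  have M': "?M - {?b} = wmin ` S'"
  proof -
    have "wmin ` S - {?b} = wmin ` (S - {w2})" using inj w by auto
    also have "S - {w2} = insert w1 (S - {w1, w2})" using w by auto
    finally show ?thesis unfolding S' by (simp add: xa)
  qed
  have "upd v ?a ?b t (wmin u) = (wblock u, comb u)" if "u \<in> S'" for u
  proof (cases "u = x")
    case True
    then show ?thesis using st w op by (simp add: upd_def xa wstate_def)
  next
    case False
    then have "u \<in> S" "u \<noteq> w1" using that S' by auto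
    then have "wmin u \<noteq> ?a" using inj w by blast
    then show ?thesis using st \<open>u \<in> S\<close> by (simp add: upd_def wstate_def)
  qed
  then have cell: "upd v ?a ?b t (wmin u) = v' (wmin u)" if "u \<in> S'" for u
    using st' that by (simp add: wstate_def)
  have st2: "wstate S' (upd v ?a ?b t)" using cell st' by (simp add: wstate_def)
  have mp: "mpst (?M - {?b}) (upd v ?a ?b t) = wpart S'"
    unfolding M' using wstate_valid(2)[OF F'(1) st2] .
  have "chain_val (?M - {?b}) (upd v ?a ?b t) D = chain_val (wmin ` S') v' D" for D
    unfolding M' using cell by (intro chain_val_cong) auto
  then have "chain_val ?M v (wpart S' # D) u = msgn ?M ?b t * chain_val (wmin ` S') v' D u" for D u
    using chain_val_single_move[OF val mv, of D u] mp by simp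
  then show ?thesis using msgn_unit[of ?M ?b t] by blast
qed

text \<open>These are the falling chains, listed from coarse to fine; the words remember how the blocks were
  assembled.  Undoing the last merge is forced: it is the longest word if that is not a single tree,
  and otherwise the composite tree with the smallest minimum.\<close>
inductive wchain :: "nat \<Rightarrow> mtree list set \<Rightarrow> mpart list \<Rightarrow> bool" for n where
  base: "wchain n ((\<lambda>i. [Leaf i]) ` {1..n}) [top_mp n]"
| mag: "wchain n S C \<Longrightarrow> [l] \<in> S \<Longrightarrow> [r] \<in> S \<Longrightarrow> l \<noteq> r \<Longrightarrow> \<forall>w\<in>S. length w = 1
    \<Longrightarrow> \<forall>t s. [Node t s] \<in> S - {[l], [r]} \<longrightarrow> wmin [Node l r] < wmin [Node t s]
    \<Longrightarrow> S' = insert [Node l r] (S - {[l], [r]}) \<Longrightarrow> wchain n S' (wpart S' # C)"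
| lie: "wchain n S C \<Longrightarrow> us \<in> S \<Longrightarrow> [v] \<in> S \<Longrightarrow> us \<noteq> [v] \<Longrightarrow> 1 \<in> set (leaves (hd us))
    \<Longrightarrow> \<forall>w\<in>S - {us}. length w = 1
    \<Longrightarrow> S' = insert (us @ [v]) (S - {us, [v]}) \<Longrightarrow> wchain n S' (wpart S' # C)"

lemma wchain_forest: "wchain n S C \<Longrightarrow> wforest n S"
proof (induction rule: wchain.induct)
  case base
  then show ?case by (auto simp: wforest_def)
next
  case (mag S C l r S')
  have "set (leaves l) \<inter> set (leaves r) = {}"
    using wforest_eq[OF mag.IH mag.hyps(2,3)] mag.hyps(4) by auto
  then show ?case unfolding mag.hyps(7)
    using mag wforestD(2)[OF mag.IH mag.hyps(2)] wforestD(2)[OF mag.IH mag.hyps(3)]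
    by (intro wforest_merge(1)) auto
next
  case (lie S C us v S')
  have "set (lvs us) \<inter> set (lvs [v]) = {}"
    using wforest_eq[OF lie.IH lie.hyps(2,3)] lie.hyps(4) by blast
  then show ?case unfolding lie.hyps(7)
    using lie wforestD(2)[OF lie.IH lie.hyps(2)] wforestD(2)[OF lie.IH lie.hyps(3)]
    by (intro wforest_merge(1)) auto
qed

lemma wchain_long_word:
  "wchain n S C \<Longrightarrow> w \<in> S \<Longrightarrow> length w \<noteq> 1 \<Longrightarrow> 1 \<in> set (leaves (hd w))"
proof (induction arbitrary: w rule: wchain.induct)
  case (lie S C us v S')
  have "us \<noteq> []" using wforestD(1)[OF wchain_forest[OF lie.hyps(1)] lie.hyps(2)] .
  then show ?case using lie by auto
qed auto

lemma wchain_hd: "wchain n S C \<Longrightarrow> \<exists>C'. C = wpart S # C'"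
proof (induction rule: wchain.induct)
  case base
  have "wpart ((\<lambda>i. [Leaf i]) ` {1..n}) = top_mp n"
    by (simp add: wpart_def wblock_def top_mp_def image_image)
  then show ?case by simp
qed auto

lemma wchain_unique:
  "wchain n S C \<Longrightarrow> wchain n S C' \<Longrightarrow> C = C'"
proof (induction arbitrary: C' rule: wchain.induct)
  case base
  from base show ?case
  proof (cases rule: wchain.cases)
    case (mag S C l r)
    then have "[Node l r] \<in> (\<lambda>i. [Leaf i]) ` {1..n}" by blast
    then show ?thesis by auto
  next
    case (lie S C us v)
    then have "us @ [v] \<in> (\<lambda>i. [Leaf i]) ` {1..n}" by blast
    moreover have "us \<noteq> []" using wforestD(1)[OF wchain_forest lie(3)] lie by blast
    ultimately show ?thesis by auto
  qed auto
next
  case (mag S C l r S')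
  note A = mag.hyps and IH = mag.IH
  from mag.prems show ?case
  proof (cases rule: wchain.cases)
    case base
    have "[Node l r] \<in> S'" using A(7) by blast
    then show ?thesis using base by auto
  next
    case (mag T D l' r')
    have fT: "wforest n T" "wforest n S" using wchain_forest mag A by blast+
    have in1: "[Node l r] \<in> insert [Node l' r'] (T - {[l'], [r']})"
      using A(7) mag(8) insertI1[of "[Node l r]" "S - {[l], [r]}"] by metis
    have in2: "[Node l' r'] \<in> insert [Node l r] (S - {[l], [r]})"
      using A(7) mag(8) insertI1[of "[Node l' r']" "T - {[l'], [r']}"] by metis
    \<comment> \<open>If the two trees differed, each would have to have the smaller
      minimum.\<close>
    have eq: "Node l r = Node l' r'"
    proof (rule ccontr)
      assume ne: "Node l r \<noteq> Node l' r'"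
      then have "wmin [Node l' r'] < wmin [Node l r]" using in1 mag by blast
      moreover have "wmin [Node l r] < wmin [Node l' r']" using in2 ne A(6) by blast
      ultimately show False by simp
    qed
    have n1: "[Node l r] \<notin> S"
      using wforest_eq[OF fT(2) _ A(2), of "[Node l r]" "wmin [l]"] wforestD(5)[OF fT(2) A(2)] by auto
    have n2: "[Node l r] \<notin> T"
      using wforest_eq[OF fT(1) _ mag(3), of "[Node l r]" "wmin [l']"] wforestD(5)[OF fT(1) mag(3)] eq by auto
    have "S = insert [l] (insert [r] (S' - {[Node l r]}))" using A(2,3,7) n1 by auto
    moreover have "T = insert [l] (insert [r] (S' - {[Node l r]}))"
      using mag(3,4,8) eq n2 by auto
    ultimately have "T = S" by (rule trans[OF _ sym, rotated])
    then have "C = D" using IH mag(2) by blast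
    then show ?thesis using mag(1) by simp
  next
    case (lie T D us v)
    have "us \<noteq> []" using wforestD(1)[OF wchain_forest lie(3)] lie by blast
    moreover have "us @ [v] \<in> insert [Node l r] (S - {[l], [r]})" using A(7) lie by blast
    then have "length (us @ [v]) = 1" using A(5) by auto
    ultimately show ?thesis by simp
  qed
next
  case (lie S C us v S')
  note A = lie.hyps and IH = lie.IH
  have fS: "wforest n S" using wchain_forest A by blast
  have us: "us \<noteq> []" using wforestD(1)[OF fS A(2)] .
  have inS: "us @ [v] \<in> S'" using A(7) by blast
  from lie.prems show ?case
  proof (cases rule: wchain.cases)
    case base
    then show ?thesis using inS us by auto
  next
    case (mag T D l' r')
    then have "length (us @ [v]) = 1" using inS by auto
    then show ?thesis using us by simp
  next
    case (lie T D us' v')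
    have fT: "wforest n T" using wchain_forest lie by blast
    have "us @ [v] \<in> insert (us' @ [v']) (T - {us', [v']})" using inS lie by blast
    then have eq: "us @ [v] = us' @ [v']"
    proof
      assume "us @ [v] \<in> T - {us', [v']}"
      then have "length (us @ [v]) = 1" using lie by blast
      then show ?thesis using us by simp
    qed
    then have e: "us' = us" "v' = v" by auto
    have n1: "us @ [v] \<notin> S"
      using wforest_eq[OF fS _ A(2), of "us @ [v]" "wmin us"] wforestD(5)[OF fS A(2)] by auto
    have n2: "us @ [v] \<notin> T"
      using wforest_eq[OF fT _ lie(3), of "us @ [v]" "wmin us"] wforestD(5)[OF fT lie(3)] e by auto
    have "S = insert us (insert [v] (S' - {us @ [v]}))" using A(2,3,7) n1 by auto
    moreover have "T = insert us (insert [v] (S' - {us @ [v]}))"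
      using lie(3,4,8) e n2 by auto
    ultimately have "T = S" by (rule trans[OF _ sym, rotated])
    then have "C = D" using IH lie(2) by blast
    then show ?thesis using lie(1) by simp
  qed
qed

text \<open>Split the composite tree of least minimum, which is the one that
  \<open>wchain.mag\<close> may have made last. This increases the number of blocks, which never
  exceeds \<open>n\<close>.\<close>

lemma wchain_forest_ex:
  assumes "wforest n S" "\<forall>w\<in>S. length w = 1"
  shows "\<exists>C. wchain n S C"
  using assms
proof (induction "n - card S" arbitrary: S rule: less_induct)
  case less
  note S = less.prems(1)
  have fin: "finite S" using finite_wforest[OF S] .
  define N where "N = {w \<in> S. \<exists>l r. w = [Node l r]}"
  show ?case
  proof (cases "N = {}")
    case True
    have "S = (\<lambda>i. [Leaf i]) ` {1..n}"
    proof (intro equalityI subsetI)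
      fix w assume w: "w \<in> S"
      then obtain t where t: "w = [t]" using less.prems(2) by (auto simp: length_Suc_conv)
      then obtain i where "t = Leaf i" using True w unfolding N_def by (cases t) auto
      then show "w \<in> (\<lambda>i. [Leaf i]) ` {1..n}" using wforestD(4)[OF S w] t by auto
    next
      fix w assume "w \<in> (\<lambda>i. [Leaf i]) ` {1..n}"
      then obtain i where i: "w = [Leaf i]" "i \<in> {1..n}" by blast
      then obtain w' where w': "w' \<in> S" "i \<in> set (lvs w')" using S unfolding wforest_def by blast
      then obtain t where t: "w' = [t]" using less.prems(2) by (auto simp: length_Suc_conv)
      then obtain j where "t = Leaf j" using True w' unfolding N_def by (cases t) auto
      then show "w \<in> S" using i w' t by auto
    qed
    then show ?thesis using wchain.base by blast
  next
    case False
    have "finite N" using fin by (simp add: N_def)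
    then have "Min (wmin ` N) \<in> wmin ` N" using False by (intro Min_in) auto
    then obtain x where x0: "x \<in> N" "wmin x = Min (wmin ` N)" by (metis imageE)
    then have x: "x \<in> N" "\<And>y. y \<in> N \<Longrightarrow> wmin x \<le> wmin y" using \<open>finite N\<close> by auto
    then obtain l r where lr: "x = [Node l r]" "x \<in> S" by (auto simp: N_def)
    define T where "T = insert [l] (insert [r] (S - {x}))"
    have dlr: "distinct (leaves l)" "distinct (leaves r)" "set (leaves l) \<inter> set (leaves r) = {}"
      using wforestD(2)[OF S lr(2)] lr(1) by auto
    have "hd (leaves l) \<in> set (leaves l)" "hd (leaves r) \<in> set (leaves r)" by simp_all
    then have lner: "l \<noteq> r" using dlr(3) by auto
    have away: "set (lvs w) \<inter> (set (leaves l) \<union> set (leaves r)) = {}" if "w \<in> S - {x}" for w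
      using wforest_eq[OF S _ lr(2), of w] that lr(1) by auto
    have lS: "[l] \<notin> S - {x}" "[r] \<notin> S - {x}" using away[of "[l]"] away[of "[r]"] by auto
    have T: "wforest n T"
      unfolding wforest_def
    proof (intro conjI ballI impI)
      fix w assume "w \<in> T"
      then show "w \<noteq> []" "distinct (lvs w)" using dlr wforestD[OF S] by (auto simp: T_def)
    next
      have "(\<Union>w\<in>S. set (lvs w)) = set (lvs x) \<union> (\<Union>w\<in>S - {x}. set (lvs w))" using lr(2) by blast
      also have "\<dots> = (\<Union>w\<in>T. set (lvs w))" by (simp add: T_def lr(1) Un_assoc)
      finally show "(\<Union>w\<in>T. set (lvs w)) = {1..n}" using S by (simp add: wforest_def)
    next
      fix w w' assume w: "w \<in> T" "w' \<in> T" "w \<noteq> w'"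
      have lr': "i \<notin> set (leaves r)" if "i \<in> set (leaves l)" for i using that dlr(3) by blast
      have away': "i \<notin> set (leaves l) \<and> i \<notin> set (leaves r)" if "u \<in> S - {x}" "i \<in> set (lvs u)" for u i
        using away[OF that(1)] that(2) by blast
      have "False" if i: "i \<in> set (lvs w)" "i \<in> set (lvs w')" for i
      proof -
        consider "w \<in> S - {x}" "w' \<in> S - {x}" | "w \<in> S - {x}" "w' \<in> {[l], [r]}"
          | "w' \<in> S - {x}" "w \<in> {[l], [r]}" | "w \<in> {[l], [r]}" "w' \<in> {[l], [r]}"
          using w unfolding T_def by blast
        then show False
        proof cases
          case 1
          then show False using w(3) wforest_eq[OF S _ _ i] by blast
        next
          case 2
          then show False using away'[OF 2(1) i(1)] i(2) by auto
        next
          case 3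
          then show False using away'[OF 3(1) i(2)] i(1) by auto
        next
          case 4
          then show False using lr'[of i] i w(3) by auto
        qed
      qed
      then show "set (lvs w) \<inter> set (lvs w') = {}" by blast
    qed
    have "card T = Suc (Suc (card (S - {x})))" using lS lner fin by (simp add: T_def)
    then have cT: "card T = Suc (card S)" using card_Suc_Diff1[OF fin lr(2)] by linarith
    have "card T \<le> n" using mp_le_card(1)[OF wpart_MP[OF T] top_mp_MP le_top_mp[OF wpart_MP[OF T]]]
      by (simp add: card_wpart[OF T] card_top_mp)
    then have "n - card T < n - card S" using cT by linarith
    moreover have lT: "\<forall>w\<in>T. length w = 1" using less.prems(2) by (simp add: T_def)
    ultimately obtain C where C: "wchain n T C" using less.hyps[of T] T by blast
    have "insert x (S - {x}) = S" using lr(2) by blast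
    moreover have "T - {[l], [r]} = S - {x}" using lS by (auto simp: T_def)
    ultimately have ST: "S = insert [Node l r] (T - {[l], [r]})" using lr(1) by simp
    have m: "wmin [Node l r] < wmin [Node t s]" if "[Node t s] \<in> T - {[l], [r]}" for t s
    proof -
      have ts: "[Node t s] \<in> S" "[Node t s] \<noteq> x" using that by (auto simp: T_def)
      then have "wmin x \<le> wmin [Node t s]" using x(2)[of "[Node t s]"] by (auto simp: N_def)
      moreover have "wmin x \<noteq> wmin [Node t s]" using wmin_inj[OF S lr(2) ts(1)] ts(2) by blast
      ultimately show ?thesis unfolding lr(1) by simp
    qed
    have "[l] \<in> T" "[r] \<in> T" by (simp_all add: T_def)
    from wchain.mag[OF C this lner lT _ ST] m show ?thesis by blast
  qed
qed

text \<open>The last letter of the word was bracketed last. Removing letters from the right leads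
  back to a forest of single trees.\<close>

lemma wchain_word_ex:
  assumes n: "n \<ge> 1" and w: "w \<in> root_words {1..n} 1"
  shows "\<exists>C. wchain n {w} C"
proof -
  have w': "w \<noteq> []" "distinct (lvs w)" "set (lvs w) = {1..n}" "1 \<in> set (leaves (hd w))"
    using w by (auto simp: root_words_def)
  have "\<exists>C. wchain n (insert us ((\<lambda>v. [v]) ` set vs)) C" if "w = us @ vs" "us \<noteq> []" for us vs
    using that
  proof (induction us arbitrary: vs rule: rev_induct)
    case (snoc v us)
    show ?case
    proof (cases "us = []")
      case True
      have eq: "insert (us @ [v]) ((\<lambda>v. [v]) ` set vs) = (\<lambda>v. [v]) ` set w"
        using snoc True by auto
      have dj: "set (leaves s) \<inter> set (leaves t) = {}" if st: "s \<in> set w" "t \<in> set w" "s \<noteq> t" for s t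
      proof -
        obtain p q where p: "w = p @ s # q" using st(1) by (meson split_list)
        then have "t \<in> set p \<or> t \<in> set q" using st by auto
        then show ?thesis using w'(2) p by auto
      qed
      have "wforest n ((\<lambda>v. [v]) ` set w)"
        unfolding wforest_def
      proof (intro conjI ballI impI)
        fix x assume "x \<in> (\<lambda>v. [v]) ` set w"
        then obtain t where t: "x = [t]" "t \<in> set w" by blast
        then obtain p q where "w = p @ t # q" by (meson split_list)
        then show "x \<noteq> []" "distinct (lvs x)" using t w'(2) by auto
      next
        show "(\<Union>x\<in>(\<lambda>v. [v]) ` set w. set (lvs x)) = {1..n}" using w'(3) by auto
      next
        fix x x' assume "x \<in> (\<lambda>v. [v]) ` set w" "x' \<in> (\<lambda>v. [v]) ` set w" "x \<noteq> x'"
        then obtain t t' where "x = [t]" "x' = [t']" "t \<in> set w" "t' \<in> set w" "t \<noteq> t'" by blast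
        then show "set (lvs x) \<inter> set (lvs x') = {}" using dj[of t t'] by simp
      qed
      then show ?thesis unfolding eq by (intro wchain_forest_ex) auto
    next
      case False
      have ww: "w = us @ v # vs" using snoc by simp
      then obtain C where C: "wchain n (insert us ((\<lambda>v. [v]) ` set (v # vs))) C"
        using snoc.IH[of "v # vs"] False by auto
      let ?S = "insert us ((\<lambda>v. [v]) ` set (v # vs))"
      have dis: "set (lvs us) \<inter> set (leaves v) = {}" "\<And>t. t \<in> set vs \<Longrightarrow> set (leaves t) \<inter> set (leaves v) = {}"
        "\<And>t. t \<in> set vs \<Longrightarrow> set (leaves t) \<inter> set (lvs us) = {}"
        using w'(2) ww by auto
      have hv: "hd (leaves v) \<in> set (leaves v)" "hd (leaves t) \<in> set (leaves t)" for t by simp_all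
      have ne: "us \<noteq> [v]" using dis(1) hv by auto
      have vv: "v \<notin> set vs" using dis(2) hv by blast
      have uu: "us \<notin> (\<lambda>v. [v]) ` set vs" using dis(3) hv by fastforce
      have "1 \<in> set (leaves (hd us))" using w'(4) ww False by simp
      moreover have "insert (us @ [v]) ((\<lambda>v. [v]) ` set vs) = insert (us @ [v]) (?S - {us, [v]})"
        using vv uu by auto
      ultimately have "wchain n (insert (us @ [v]) ((\<lambda>v. [v]) ` set vs))
          (wpart (insert (us @ [v]) ((\<lambda>v. [v]) ` set vs)) # C)"
        using wchain.lie[OF C, of us v] ne by auto
      then show ?thesis by blast
    qed
  qed simp
  from this[of w "[]"] w' show ?thesis by simp
qed

lemma mag_letters: "mag (word [l]) (word [r]) = word [Node l r]"
proof
  fix u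
  show "mag (word [l]) (word [r]) u = word [Node l r] u"
  proof (cases "\<exists>t s. u = [Node t s]")
    case True
    then obtain t s where "u = [Node t s]" by blast
    then show ?thesis by (cases "t = l"; cases "s = r") (simp_all add: mag_def word_def)
  next
    case False
    then have "mag (word [l]) (word [r]) u = 0"
      by (auto simp: mag_def split: list.splits mtree.splits)
    then show ?thesis using False by (simp add: word_def)
  qed
qed

lemma wblock_Node: "wblock [Node l r] = (fst (wblock [l]) \<union> fst (wblock [r]), snd (wblock [l]))"
  by (simp add: wblock_def)

lemma wblock_snoc: "wblock (us @ [v]) = (fst (wblock us) \<union> fst (wblock [v]), snd (wblock us) \<union> snd (wblock [v]))"
  by (auto simp: wblock_def)

lemma key_wblock: "key (wblock w) = wmin w"
  by (simp add: wblock_def wmin_def)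

text \<open>The induction step common to products and brackets: one more merge at the coarse end
  multiplies the sign found so far.\<close>

lemma chain_value_extend:
  assumes S: "wforest n S" and S': "wforest n S'" and C: "C \<noteq> []"
    and IH: "\<exists>\<delta> :: 'k::comm_ring_1. (\<delta> = 1 \<or> \<delta> = - 1) \<and> (\<forall>v D u. wstate S v \<longrightarrow>
      chain_val {1..n} init_cell (tl (rev C) @ D) u = \<delta> * chain_val (wmin ` S) v D u)"
    and merge: "\<And>v v'. wstate S v \<Longrightarrow> wstate S' v' \<Longrightarrow> \<exists>\<epsilon> :: 'k. (\<epsilon> = 1 \<or> \<epsilon> = - 1)
      \<and> (\<forall>D u. chain_val (wmin ` S) v (wpart S' # D) u = \<epsilon> * chain_val (wmin ` S') v' D u)"
  shows "\<exists>\<epsilon> :: 'k. (\<epsilon> = 1 \<or> \<epsilon> = - 1) \<and> (\<forall>v D u. wstate S' v \<longrightarrow>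
    chain_val {1..n} init_cell (tl (rev (wpart S' # C)) @ D) u = \<epsilon> * chain_val (wmin ` S') v D u)"
proof -
  obtain \<delta> :: 'k where \<delta>: "\<delta> = 1 \<or> \<delta> = - 1" "\<And>v D u. wstate S v \<Longrightarrow>
      chain_val {1..n} init_cell (tl (rev C) @ D) u = \<delta> * chain_val (wmin ` S) v D u"
    using IH by blast
  obtain v0 v1 :: "nat \<Rightarrow> 'k cell" where v: "wstate S v0" "wstate S' v1" using wstate_ex S S' by metis
  obtain \<epsilon> :: 'k where \<epsilon>: "\<epsilon> = 1 \<or> \<epsilon> = - 1"
    "\<And>D u. chain_val (wmin ` S) v0 (wpart S' # D) u = \<epsilon> * chain_val (wmin ` S') v1 D u"
    using merge[OF v] by blast
  have "chain_val {1..n} init_cell (tl (rev (wpart S' # C)) @ D) u = \<delta> * \<epsilon> * chain_val (wmin ` S') v' D u"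
    if "wstate S' v'" for v' D u
  proof -
    have "chain_val (wmin ` S') v1 D = chain_val (wmin ` S') v' D"
      using v(2) that by (intro chain_val_cong) (auto simp: wstate_def)
    moreover have "tl (rev (wpart S' # C)) @ D = tl (rev C) @ wpart S' # D" using C by simp
    ultimately show ?thesis using \<delta>(2)[OF v(1), of "wpart S' # D" u] \<epsilon>(2)[of D u] by (simp add: mult.assoc)
  qed
  moreover have "\<delta> * \<epsilon> = 1 \<or> \<delta> * \<epsilon> = - 1" using \<delta>(1) \<epsilon>(1) by auto
  ultimately show ?thesis by blast
qed

text \<open>Chains of words grow at the coarse end, while \<open>chain_val\<close> consumes a chain
  from the fine end. The arbitrary continuation \<open>D\<close> reconciles the two
  directions.\<close>

lemma wchain_value:
  assumes "wchain n S C"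
  shows "\<exists>\<epsilon>. (\<epsilon> = 1 \<or> \<epsilon> = - 1) \<and> (\<forall>v D u. wstate S v \<longrightarrow>
    chain_val {1..n} init_cell (tl (rev C) @ D) u = \<epsilon> * (chain_val (wmin ` S) v D u :: 'k::comm_ring_1))"
  using assms
proof (induction rule: wchain.induct)
  case base
  let ?S = "(\<lambda>i. [Leaf i]) ` {1..n}"
  have m: "wmin ` ?S = {1..n}" by (simp add: wmin_def image_image)
  have "chain_val {1..n} init_cell D = chain_val (wmin ` ?S) v D" if "wstate ?S v" for v :: "nat \<Rightarrow> 'k cell" and D
    unfolding m using that
    by (intro chain_val_cong) (auto simp: wstate_def wmin_def init_cell_def wblock_def)
  then show ?case by (intro exI[of _ 1]) auto
next
  case (mag S C l r S')
  have S: "wforest n S" using wchain_forest[OF mag.hyps(1)] .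
  have S'f: "wforest n S'" using wchain_forest[OF wchain.mag[OF mag.hyps]] .
  have x: "[Node l r] \<noteq> []" "distinct (lvs [Node l r])"
    using wforestD(2)[OF S'f, of "[Node l r]"] mag.hyps(7) by auto
  have "\<exists>\<epsilon> :: 'k. (\<epsilon> = 1 \<or> \<epsilon> = - 1) \<and> (\<forall>D u. chain_val (wmin ` S) v0 (wpart S' # D) u
      = \<epsilon> * chain_val (wmin ` S') v' D u)" if v0: "wstate S v0" and v': "wstate S' v'" for v0 v'
  proof (cases "wmin [l] < wmin [r]")
    case True
    show ?thesis
      by (rule chain_val_word_merge[OF S v0 mag.hyps(2,3) _ x _ mag.hyps(7) _ True v', where t = Lft])
        (use mag.hyps(4) in \<open>simp_all add: opv_def wblock_Node mag_letters\<close>)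
  next
    \<comment> \<open>Moves list their keys in increasing order, so a left factor with the larger
      minimum gives a move of kind \<open>Rgt\<close>.\<close>
    case False
    then have gt: "wmin [r] < wmin [l]" using wmin_inj[OF S mag.hyps(2,3)] mag.hyps(4) by fastforce
    show ?thesis
      by (rule chain_val_word_merge[OF S v0 mag.hyps(3,2) _ x _ _ _ gt v', where t = Rgt])
        (use mag.hyps(4,7) in \<open>simp_all add: opv_def wblock_Node mag_letters Un_commute insert_commute\<close>)
  qed
  then show ?case
    using wchain_hd[OF mag.hyps(1)] by (intro chain_value_extend[OF S S'f _ mag.IH]) auto
next
  case (lie S C us w S')
  have S: "wforest n S" using wchain_forest[OF lie.hyps(1)] .
  have S'f: "wforest n S'" using wchain_forest[OF wchain.lie[OF lie.hyps]] .
  have us: "us \<noteq> []" using wforestD(1)[OF S lie.hyps(2)] .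
  have x: "us @ [w] \<noteq> []" "distinct (lvs (us @ [w]))"
    using wforestD(2)[OF S'f, of "us @ [w]"] lie.hyps(7) by auto
  have one: "1 \<in> set (lvs us)" using lie.hyps(5) us by (cases us) auto
  have "1 \<notin> set (lvs [w])" using wforest_eq[OF S lie.hyps(2,3) one] lie.hyps(4) by blast
  moreover have "wmin [w] \<in> set (lvs [w])" "set (lvs [w]) \<subseteq> {1..n}" "set (lvs us) \<subseteq> {1..n}"
    using wforestD[OF S lie.hyps(3)] wforestD(4)[OF S lie.hyps(2)] by blast+
  moreover have "wmin us \<le> 1" unfolding wmin_def using one by (intro Min_le) auto
  \<comment> \<open>The block of 1 has the smallest key, so it is the left argument of the bracket,
    as in \<open>comb\<close>.\<close>
  ultimately have less: "wmin us < wmin [w]"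
    by (metis One_nat_def Suc_leI atLeastAtMost_iff le_less_trans less_one nat_neq_iff not_le order.order_iff_strict subsetD)
  have "\<exists>\<epsilon> :: 'k. (\<epsilon> = 1 \<or> \<epsilon> = - 1) \<and> (\<forall>D u. chain_val (wmin ` S) v0 (wpart S' # D) u
      = \<epsilon> * chain_val (wmin ` S') v1 D u)" if v0: "wstate S v0" and v1: "wstate S' v1" for v0 v1
    by (rule chain_val_word_merge[OF S v0 lie.hyps(2,3,4) x _ lie.hyps(7) _ less v1, where t = Both])
      (simp_all add: opv_def wblock_snoc comb_snoc[OF us])
  then show ?case
    using wchain_hd[OF lie.hyps(1)] by (intro chain_value_extend[OF S S'f _ lie.IH]) auto
qed

lemma wchain_top_val:
  assumes "wchain n {w} C"
  shows "\<exists>\<epsilon>. (\<epsilon> = 1 \<or> \<epsilon> = - 1) \<and> (\<forall>u. top_val n (tl (rev C)) u = \<epsilon> * (comb w u :: 'k::comm_ring_1))"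
proof -
  obtain \<epsilon> :: 'k where \<epsilon>: "\<epsilon> = 1 \<or> \<epsilon> = - 1" "\<And>v D u. wstate {w} v \<Longrightarrow>
      chain_val {1..n} init_cell (tl (rev C) @ D) u = \<epsilon> * chain_val (wmin ` {w}) v D u"
    using wchain_value[OF assms] by blast
  have "wstate {w} (\<lambda>_. (wblock w, comb w) :: 'k cell)" by (simp add: wstate_def)
  from \<epsilon>(2)[OF this, of "[]"] show ?thesis using \<epsilon>(1) by (auto simp: top_val_def)
qed

text \<open>The list runs from coarse to fine, as the chains of the complex do. Read as a sequence
  of merges, that is from its end, the labels never increase.\<close>

fun fall :: "mpart list \<Rightarrow> bool" where
  "fall (x # y # z # R) = (mlab y x \<le> mlab z y \<and> fall (y # z # R))"
| "fall _ = True"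

fun acov :: "nat \<Rightarrow> mpart list \<Rightarrow> bool" where
  "acov n (x # y # R) = (x \<in> MP n \<and> mp_less x y \<and> Suc (card x) = card y \<and> acov n (y # R))"
| "acov n [x] = (x \<in> MP n)"
| "acov n [] = True"

lemma (in el_labelling) crit_snoc:
  "crit (D @ [y, x]) \<longleftrightarrow> crit (D @ [y]) \<and> rk y = Suc (rk x) \<and> (D = [] \<or> y \<noteq> fst_step x (last D))"
proof (induction D rule: induct_list012)
  case (3 a b D)
  have "crit ((a # b # D) @ [y, x]) \<longleftrightarrow>
      rk a = Suc (rk b) \<and> b \<noteq> fst_step (hd (D @ [y, x])) a \<and> crit ((b # D) @ [y, x])" by simp
  moreover have "crit ((a # b # D) @ [y]) \<longleftrightarrow>
      rk a = Suc (rk b) \<and> b \<noteq> fst_step (hd (D @ [y])) a \<and> crit ((b # D) @ [y])" by simp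
  moreover have "hd (D @ [y, x]) = hd (D @ [y])" by (cases D) auto
  ultimately show ?case using 3(2) by (simp del: crit.simps)
qed auto

lemma acov_hd: "acov n (x # R) \<Longrightarrow> x \<in> MP n"
  by (cases R) auto

text \<open>All steps are covers, so \<open>ascent'\<close> turns the removability of an element
  into a strict increase of the two labels around it.\<close>

lemma crit_iff_fall: "acov n C \<Longrightarrow> MPl.crit n (rev C) \<longleftrightarrow> fall C"
proof (induction C rule: fall.induct)
  case (1 x y z R)
  then have MP: "x \<in> MP n" "y \<in> MP n" "z \<in> MP n" "mp_less x y" "mp_less y z" "Suc (card x) = card y" "Suc (card y) = card z"
    using acov_hd by auto
  have "MPo.fst_step n x y = x" using MPl.fst_step_cover[OF MP(1,2,4,6)] .
  then have "y = MPo.fst_step n x z \<longleftrightarrow> mlab z y < mlab y x"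
    using MPl.ascent'[OF MP(1,3,2,5,7,4)] by simp
  moreover have "MPl.crit n (rev (x # y # z # R)) \<longleftrightarrow>
      MPl.crit n (rev (y # z # R)) \<and> card y = Suc (card x) \<and> y \<noteq> MPo.fst_step n x z"
    using MPl.crit_snoc[of n "rev R @ [z]" y x] by simp
  ultimately show ?case using 1 MP by auto
qed auto

lemma acovI:
  "set C \<subseteq> MP n \<Longrightarrow> (\<And>P x y R. C = P @ x # y # R \<Longrightarrow> mp_less x y \<and> Suc (card x) = card y) \<Longrightarrow> acov n C"
proof (induction C rule: acov.induct)
  case (1 n x y R)
  have "acov n (y # R)"
  proof (rule 1(1))
    fix P x' y' R' assume "y # R = P @ x' # y' # R'"
    then show "mp_less x' y' \<and> Suc (card x') = card y'" using 1(3)[of "x # P" x' y' R'] by simp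
  qed (use 1 in auto)
  then show ?case using 1(2) 1(3)[of "[]" x y R] by simp
qed auto

lemma acov_sorted: "acov n C \<Longrightarrow> set C \<subseteq> MP n \<and> sorted_wrt mp_less C"
proof (induction C rule: acov.induct)
  case (1 n x y R)
  then have IH: "set (y # R) \<subseteq> MP n" "sorted_wrt mp_less (y # R)" "x \<in> MP n" "mp_less x y" by auto
  have "mp_less x z" if "z \<in> set R" for z
    using mp_less_trans[of x n y z] IH that by auto
  then show ?case using IH by auto
qed auto

lemma acov_length: "acov n C \<Longrightarrow> C \<noteq> [] \<Longrightarrow> card (last C) + 1 = card (hd C) + length C"
  by (induction n C rule: acov.induct) auto

lemma top_chains_iff:
  assumes n: "n \<ge> 1"
  shows "C \<in> chains n (n - 1) \<longleftrightarrow> C \<noteq> [] \<and> acov n C \<and> card (hd C) = 1 \<and> last C = top_mp n"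
proof
  assume "C \<in> chains n (n - 1)"
  then have C: "length C = n" "MPl.dchain n (rev C)" "card (hd C) = 1" "last C = top_mp n"
    using chains_iff[OF n] n by auto
  then have ne: "C \<noteq> []" using n by auto
  have "acov n C"
  proof (rule acovI)
    show "set C \<subseteq> MP n" using C(2) by (simp add: MPl.dchain_iff_sorted)
    fix P x y R assume eq: "C = P @ x # y # R"
    then have r: "rev C = rev R @ y # x # rev P" by simp
    have "card y = Suc (card x)"
    proof (rule MPl.dchain_maximal_cover[of n "rev R" y x "rev P"])
      show "MPl.dchain n (rev R @ y # x # rev P)" using C(2) r by simp
      have "card (last (rev C)) + length (rev C) = card (hd (rev C)) + 1"
        using C ne by (simp add: hd_rev last_rev card_top_mp)
      then show "card (last (rev R @ y # x # rev P)) + length (rev R @ y # x # rev P)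
          = card (hd (rev R @ y # x # rev P)) + 1" unfolding r .
    qed
    moreover have "sorted_wrt mp_less C" using C(2) by (simp add: MPl.dchain_iff_sorted sorted_wrt_rev)
    then have "mp_less x y" unfolding eq by (simp add: sorted_wrt_append)
    ultimately show "mp_less x y \<and> Suc (card x) = card y" by simp
  qed
  then show "C \<noteq> [] \<and> acov n C \<and> card (hd C) = 1 \<and> last C = top_mp n" using ne C by simp
next
  assume C: "C \<noteq> [] \<and> acov n C \<and> card (hd C) = 1 \<and> last C = top_mp n"
  then have "length C = Suc (n - 1)" using acov_length[of n C] n by (simp add: card_top_mp)
  moreover have "MPl.dchain n (rev C)"
    using acov_sorted[of n C] C by (simp add: MPl.dchain_iff_sorted sorted_wrt_rev)
  ultimately show "C \<in> chains n (n - 1)" using C chains_iff[OF n] by simp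
qed

lemma falling_iff: "n \<ge> 1 \<Longrightarrow> C \<in> falling n \<longleftrightarrow> C \<in> chains n (n - 1) \<and> fall C"
  unfolding falling_def using top_chains_iff crit_iff_fall by blast

lemma wpart_mag:
  assumes S: "wforest n S" and lr: "[l] \<in> S" "[r] \<in> S" "l \<noteq> r"
  shows "wpart (insert [Node l r] (S - {[l], [r]})) = mrg (wpart S) (wblock [l]) (wblock [r]) (snd (wblock [l]))"
    "mlab (wpart S) (wpart (insert [Node l r] (S - {[l], [r]}))) = int (wmin [Node l r])"
    "wmin [Node l r] = min (wmin [l]) (wmin [r])"
proof -
  have ne: "[l] \<noteq> [r]" "wblock [l] \<noteq> wblock [r]" using lr wblock_inj[OF S lr(1,2)] by auto
  have y: "wpart S \<in> MP n" using wpart_MP[OF S] .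
  have bl: "wblock [l] \<in> wpart S" "wblock [r] \<in> wpart S" using lr by (auto simp: wpart_def)
  show eq: "wpart (insert [Node l r] (S - {[l], [r]})) = mrg (wpart S) (wblock [l]) (wblock [r]) (snd (wblock [l]))"
    using wpart_merge[OF S lr(1,2) ne(1), of "[Node l r]"] by (simp add: wblock_Node)
  show m: "wmin [Node l r] = min (wmin [l]) (wmin [r])"
    using wforestD(3)[OF S lr(1)] wforestD(3)[OF S lr(2)] unfolding wmin_def by (simp add: Min_Un)
  show "mlab (wpart S) (wpart (insert [Node l r] (S - {[l], [r]}))) = int (wmin [Node l r])"
    unfolding eq m using mrg_props(5)[OF y bl ne(2), of "snd (wblock [l])"] left_ne_both[OF y bl ne(2)]
    by (simp add: key_wblock)
qed

lemma wpart_lie: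
  assumes S: "wforest n S" and w: "us \<in> S" "[v] \<in> S" "us \<noteq> [v]"
  shows "wpart (insert (us @ [v]) (S - {us, [v]}))
      = mrg (wpart S) (wblock us) (wblock [v]) (snd (wblock us) \<union> snd (wblock [v]))"
    "mlab (wpart S) (wpart (insert (us @ [v]) (S - {us, [v]}))) = - int (min (wmin us) (wmin [v]))"
proof -
  have ne: "wblock us \<noteq> wblock [v]" using w wblock_inj[OF S w(1,2)] by auto
  have y: "wpart S \<in> MP n" using wpart_MP[OF S] .
  have bl: "wblock us \<in> wpart S" "wblock [v] \<in> wpart S" using w by (auto simp: wpart_def)
  show eq: "wpart (insert (us @ [v]) (S - {us, [v]}))
      = mrg (wpart S) (wblock us) (wblock [v]) (snd (wblock us) \<union> snd (wblock [v]))"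
    using wpart_merge[OF S w, of "us @ [v]"] by (simp add: wblock_snoc)
  show "mlab (wpart S) (wpart (insert (us @ [v]) (S - {us, [v]}))) = - int (min (wmin us) (wmin [v]))"
    unfolding eq using mrg_props(5)[OF y bl ne, of "snd (wblock us) \<union> snd (wblock [v])"]
    by (simp add: key_wblock)
qed

lemma wmin_one: "wforest n S \<Longrightarrow> w \<in> S \<Longrightarrow> 1 \<in> set (lvs w) \<longleftrightarrow> wmin w = 1"
proof
  assume S: "wforest n S" "w \<in> S" and "1 \<in> set (lvs w)"
  then have "wmin w \<le> 1" unfolding wmin_def by (intro Min_le) auto
  moreover have "wmin w \<in> {1..n}" using wforestD(4,5)[OF S] by blast
  ultimately show "wmin w = 1" by simp
next
  assume "wforest n S" "w \<in> S" "wmin w = 1"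
  then show "1 \<in> set (lvs w)" using wforestD(5) by metis
qed

lemma wforest_wmin_pos: "wforest n S \<Longrightarrow> w \<in> S \<Longrightarrow> 1 \<le> wmin w"
  using wforestD(4,5)[of n S w] by auto

text \<open>The last label reveals the last merge: a product has the least minimum of a composite
  tree, while a bracket has label -1 because it involves the block of 1.\<close>

lemma wchain_label:
  assumes "wchain n S (x # y # R)"
  shows "(\<exists>t s. [Node t s] \<in> S \<and> mlab y x = int (wmin [Node t s])
      \<and> (\<forall>t' s'. [Node t' s'] \<in> S \<longrightarrow> wmin [Node t s] \<le> wmin [Node t' s']) \<and> (\<forall>w\<in>S. length w = 1))
    \<or> (mlab y x = - 1 \<and> (\<exists>w\<in>S. length w \<noteq> 1))"
  using assms
proof (cases rule: wchain.cases)
  case (mag T l r)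
  have T: "wforest n T" using wchain_forest[OF mag(2)] .
  have y: "y = wpart T" using wchain_hd[OF mag(2)] by auto
  have "mlab y x = int (wmin [Node l r])"
    using wpart_mag(2)[OF T mag(3,4,5)] mag(1,8) y by simp
  moreover have "wmin [Node l r] \<le> wmin [Node t' s']" if "[Node t' s'] \<in> S" for t' s'
    using that mag(7,8) by (metis Diff_iff insert_iff less_imp_le order_refl)
  moreover have "\<forall>w\<in>S. length w = 1" using mag(6,8) by auto
  moreover have "[Node l r] \<in> S" using mag(8) by simp
  ultimately show ?thesis by blast
next
  case (lie T us v)
  have T: "wforest n T" using wchain_forest[OF lie(2)] .
  have y: "y = wpart T" using wchain_hd[OF lie(2)] by auto
  have us: "us \<noteq> []" using wforestD(1)[OF T lie(3)] .
  have "1 \<in> set (lvs us)" using lie(6) us by (cases us) auto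
  then have "wmin us = 1" using wmin_one[OF T lie(3)] by blast
  then have "min (wmin us) (wmin [v]) = 1" using wforest_wmin_pos[OF T lie(4)] by simp
  then have "mlab y x = - 1" using wpart_lie(2)[OF T lie(3,4,5)] lie(1,8) y by simp
  moreover have "us @ [v] \<in> S" "length (us @ [v]) \<noteq> 1" using lie(8) us by auto
  ultimately show ?thesis by blast
qed

lemma wchain_acov: "wchain n S C \<Longrightarrow> acov n C \<and> last C = top_mp n \<and> fall C"
proof (induction rule: wchain.induct)
  case base
  then show ?case using top_mp_MP by simp
next
  case (mag S C l r S')
  have S: "wforest n S" using wchain_forest[OF mag.hyps(1)] .
  obtain C1 where C: "C = wpart S # C1" using wchain_hd[OF mag.hyps(1)] by blast
  have ne: "[l] \<noteq> [r]" "wblock [l] \<noteq> wblock [r]" using mag.hyps(4) wblock_inj[OF S mag.hyps(2,3)] by auto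
  have bl: "wblock [l] \<in> wpart S" "wblock [r] \<in> wpart S" using mag.hyps by (auto simp: wpart_def)
  note wm = wpart_mag[OF S mag.hyps(2,3,4), folded mag.hyps(7)]
  note mp = mrg_props[OF wpart_MP[OF S] bl ne(2), of "snd (wblock [l])", folded wm(1)]
  have "fall (wpart S' # C)"
  proof (cases C1)
    case Nil
    then show ?thesis by (simp add: C)
  next
    case (Cons y R)
    obtain t s where ts: "[Node t s] \<in> S" "mlab y (wpart S) = int (wmin [Node t s])"
      using wchain_label[of n S "wpart S" y R] mag.hyps(1,5) C Cons by auto
    have "wmin [Node l r] \<le> wmin [Node t s]"
    proof (cases "[Node t s] \<in> S - {[l], [r]}")
      case True
      then show ?thesis using mag.hyps(6) by (simp add: less_imp_le)
    next
      case False
      then have "[Node t s] = [l] \<or> [Node t s] = [r]" using ts by blast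
      then show ?thesis using wm(3) by (metis min.cobounded1 min.cobounded2)
    qed
    then show ?thesis using mag.IH wm(2) ts(2) by (simp add: C Cons)
  qed
  then show ?case using mag.IH mp by (simp add: C)
next
  case (lie S C us v S')
  have S: "wforest n S" using wchain_forest[OF lie.hyps(1)] .
  obtain C1 where C: "C = wpart S # C1" using wchain_hd[OF lie.hyps(1)] by blast
  have ne: "wblock us \<noteq> wblock [v]" using lie.hyps(4) wblock_inj[OF S lie.hyps(2,3)] by auto
  have bl: "wblock us \<in> wpart S" "wblock [v] \<in> wpart S" using lie.hyps by (auto simp: wpart_def)
  note wm = wpart_lie[OF S lie.hyps(2,3,4), folded lie.hyps(7)]
  note mp = mrg_props[OF wpart_MP[OF S] bl ne, of "snd (wblock us) \<union> snd (wblock [v])", folded wm(1)]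
  have "wchain n S' (wpart S' # wpart S # C1)" using wchain.lie[OF lie.hyps] C by simp
  moreover have "us \<noteq> []" using wforestD(1)[OF S lie.hyps(2)] .
  then have "us @ [v] \<in> S'" "length (us @ [v]) \<noteq> 1" using lie.hyps(7) by auto
  ultimately have l: "mlab (wpart S) (wpart S') = - 1" using wchain_label by blast
  have "fall (wpart S' # C)"
  proof (cases C1)
    case Nil
    then show ?thesis by (simp add: C)
  next
    case (Cons y R)
    have "- 1 \<le> mlab y (wpart S)"
      using wchain_label[of n S "wpart S" y R] lie.hyps(1) C Cons by auto
    then show ?thesis using lie.IH l by (simp add: C Cons)
  qed
  then show ?case using lie.IH mp by (simp add: C)
qed

text \<open>With this bound the only negative label is -1, so every bracket involves the block of
  1.\<close>

fun labge :: "mpart list \<Rightarrow> bool" where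
  "labge (x # y # R) = (- 1 \<le> mlab y x \<and> labge (y # R))"
| "labge _ = True"

text \<open>On a falling chain the label at the coarse end is the smallest, so bounding it
  suffices.\<close>

lemma fall_labge: "fall C \<Longrightarrow> (\<And>x y R. C = x # y # R \<Longrightarrow> - 1 \<le> mlab y x) \<Longrightarrow> labge C"
  by (induction C rule: fall.induct) force+

lemma wchain_singleton:
  assumes "wchain n S [x]"
  shows "S = (\<lambda>i. [Leaf i]) ` {1..n}"
  using assms
proof (cases rule: wchain.cases)
  case (mag T l r)
  then show ?thesis using wchain_hd by blast
next
  case (lie T us v)
  then show ?thesis using wchain_hd by blast
qed

text \<open>The next merge is read as a step of \<open>wchain\<close>. A bracket has label -1, so
  one factor contains 1; any longer word contains 1 as well, so the other factor is a single tree.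
  Before a product all labels are positive, so all words are single trees; falling makes its minimum
  at most that of the other composite trees, and distinct words have distinct minima.\<close>

lemma wchain_extend:
  assumes n: "wchain n S (y # R)" and cov: "acov n (x # y # R)" and fall: "fall (x # y # R)" and lab: "- 1 \<le> mlab y x"
  shows "\<exists>S'. wchain n S' (x # y # R)"
proof -
  have S: "wforest n S" using wchain_forest[OF n] .
  have y: "y = wpart S" using wchain_hd[OF n] by simp
  have MP: "x \<in> MP n" "y \<in> MP n" "mp_le x y" "Suc (card x) = card y"
    using cov acov_hd[of n y R] by (auto simp: mp_less_def)
  obtain b c P where m: "b \<in> y" "c \<in> y" "b \<noteq> c" "P = snd b \<union> snd c \<or> P = snd b" "x = mrg y b c P"
    using cover_cases[OF MP] by blast
  note mp = mrg_props[OF MP(2) m(1-4), folded m(5)]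
  show ?thesis
  proof (cases "P = snd b \<union> snd c")
    case True
    have x': "x = mrg y c b P" using m(5) by (simp add: mrg_def Un_commute insert_commute)
    have "min (key b) (key c) \<le> 1" using mp(5) True lab by simp
    then have "key b \<le> 1 \<or> key c \<le> 1" by (simp add: min_le_iff_disj)
    then obtain b' c' where bc: "b' \<in> y" "c' \<in> y" "b' \<noteq> c'" "x = mrg y b' c' P" "P = snd b' \<union> snd c'" "key b' \<le> 1"
      using m x' True by (metis Un_commute)
    obtain us w where w: "us \<in> S" "b' = wblock us" "w \<in> S" "c' = wblock w"
      using bc(1,2) y by (auto simp: wpart_def)
    have "wmin us = 1" using bc(6) wforest_wmin_pos[OF S w(1)] by (simp add: w(2) key_wblock)
    then have one: "1 \<in> set (lvs us)" using wmin_one[OF S w(1)] by blast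
    have len: "length u = 1" if u: "u \<in> S" "u \<noteq> us" for u
    proof (rule ccontr)
      assume "length u \<noteq> 1"
      then have "1 \<in> set (leaves (hd u))" using wchain_long_word[OF n u(1)] by simp
      moreover have "u \<noteq> []" using wforestD(1)[OF S u(1)] .
      ultimately have "1 \<in> set (lvs u)" by (cases u) auto
      then show False using wforest_eq[OF S u(1) w(1) _ one] u(2) by blast
    qed
    have hd1: "1 \<in> set (leaves (hd us))"
    proof (cases "length us = 1")
      case True
      then show ?thesis using one by (cases us) auto
    next
      case False
      then show ?thesis using wchain_long_word[OF n w(1)] by simp
    qed
    have "w \<noteq> us" using bc(3) w by auto
    then obtain v where v: "w = [v]" using len[OF w(3)] by (auto simp: length_Suc_conv)
    have ne: "us \<noteq> [v]" using \<open>w \<noteq> us\<close> v by simp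
    have vS: "[v] \<in> S" using w(3) v by simp
    have "wpart (insert (us @ [v]) (S - {us, [v]})) = x"
      using wpart_lie(1)[OF S w(1) vS ne] bc(4,5) w v y by simp
    moreover have "\<forall>u\<in>S - {us}. length u = 1" using len by blast
    ultimately show ?thesis using wchain.lie[OF n w(1) vS ne hd1 _ refl] by metis
  next
    case False
    then have Pb: "P = snd b" using m(4) by blast
    have "0 < min (key b) (key c)" using key_pos[OF MP(2)] m(1,2) by simp
    then have pos: "0 < mlab y x" using mp(5) False by simp
    have single: "\<forall>w\<in>S. length w = 1"
    proof (cases R)
      case Nil
      then show ?thesis using wchain_singleton[of n S y] n by simp
    next
      case (Cons z R')
      then show ?thesis using wchain_label[of n S y z R'] n fall pos by auto
    qed
    obtain w1 w2 where w: "w1 \<in> S" "b = wblock w1" "w2 \<in> S" "c = wblock w2"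
      using m(1,2) y by (auto simp: wpart_def)
    obtain l r where lr: "w1 = [l]" "w2 = [r]"
      using single w(1,3) by (metis One_nat_def length_0_conv length_Suc_conv)
    have ner: "l \<noteq> r" using m(3) w lr by auto
    have lrS: "[l] \<in> S" "[r] \<in> S" using w lr by auto
    note wm = wpart_mag[OF S lrS ner]
    have x': "wpart (insert [Node l r] (S - {[l], [r]})) = x" using wm(1) m(5) Pb w lr y by simp
    have lx: "mlab y x = int (wmin [Node l r])" using wm(2) x' y by simp
    have "wmin [Node l r] < wmin [Node t s]" if ts: "[Node t s] \<in> S - {[l], [r]}" for t s
    proof -
      have "wmin [Node l r] \<le> wmin [Node t s]"
      proof (cases R)
        case Nil
        then show ?thesis using wchain_singleton[of n S y] n ts by auto
      next
        case (Cons z R')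
        then obtain t0 s0 where "mlab z y = int (wmin [Node t0 s0])" "wmin [Node t0 s0] \<le> wmin [Node t s]"
          using wchain_label[of n S y z R'] n single ts by auto
        moreover have "mlab y x \<le> mlab z y" using fall Cons by simp
        ultimately show ?thesis using lx by simp
      qed
      moreover have "wmin [Node l r] \<noteq> wmin [Node t s]"
        using wm(3) wmin_inj[OF S lrS(1), of "[Node t s]"] wmin_inj[OF S lrS(2), of "[Node t s]"] ts
        by (auto simp: min_def split: if_splits)
      ultimately show ?thesis by simp
    qed
    then show ?thesis using wchain.mag[OF n lrS ner single _ refl] x' by metis
  qed
qed

lemma wchain_of_fall:
  "C \<noteq> [] \<Longrightarrow> acov n C \<Longrightarrow> fall C \<Longrightarrow> labge C \<Longrightarrow> last C = top_mp n \<Longrightarrow> \<exists>S. wchain n S C"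
proof (induction C rule: labge.induct)
  case (1 x y R)
  have "fall (y # R)" using 1(4) by (cases R) auto
  then obtain S where "wchain n S (y # R)" using 1 by auto
  then show ?case using wchain_extend 1 by auto
next
  case ("2_2" x)
  then show ?case using wchain.base by auto
qed auto

text \<open>The coarsest partition has only one block, so the last merge involves 1 and its label is
  at least -1. This starts \<open>fall_labge\<close>, and the chain is then rebuilt from its fine
  end.\<close>

lemma falling_wchain:
  assumes n: "n \<ge> 1" and C: "C \<in> falling n"
  shows "\<exists>w\<in>root_words {1..n} 1. wchain n {w} C"
proof -
  have c: "C \<noteq> []" "acov n C" "card (hd C) = 1" "last C = top_mp n" "fall C"
    using C falling_iff[OF n] top_chains_iff[OF n] by auto
  have "- 1 \<le> mlab y x" if eq: "C = x # y # R" for x y R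
  proof -
    have MP: "x \<in> MP n" "y \<in> MP n" "mp_le x y" "Suc (card x) = card y"
      using c(2) acov_hd[of n y R] eq by (auto simp: mp_less_def)
    obtain b cc P where m: "b \<in> y" "cc \<in> y" "b \<noteq> cc" "P = snd b \<union> snd cc \<or> P = snd b" "x = mrg y b cc P"
      using cover_cases[OF MP] by blast
    have "(fst b \<union> fst cc, P) \<in> x" using m(5) by (simp add: mrg_def)
    moreover have "card x = 1" using c(3) eq by simp
    ultimately have x: "x = {(fst b \<union> fst cc, P)}" by (metis card_1_singletonE singletonD)
    obtain d where "d \<in> x" "1 \<in> fst d" using MP_cover[OF MP(1), of 1] n by auto
    then have "1 \<in> fst b \<or> 1 \<in> fst cc" using x by auto
    then have "key b \<le> 1 \<or> key cc \<le> 1" 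
      using Min_le[OF MP_block(4)[OF MP(2) m(1)]] Min_le[OF MP_block(4)[OF MP(2) m(2)]] by blast
    then have "min (key b) (key cc) \<le> 1" by linarith
    then show ?thesis using mrg_props(5)[OF MP(2) m(1-4)] m(5) by (simp split: if_splits)
  qed
  then have "labge C" using fall_labge[OF c(5)] by blast
  then obtain S where S: "wchain n S C" using wchain_of_fall c by blast
  have F: "wforest n S" using wchain_forest[OF S] .
  have "hd C = wpart S" using wchain_hd[OF S] by auto
  then have "card S = 1" using c(3) card_wpart[OF F] by simp
  then obtain w where w: "S = {w}" by (auto simp: card_1_singleton_iff)
  have w': "w \<noteq> []" "distinct (lvs w)" using wforestD(1,2)[OF F, of w] w by auto
  have set: "set (lvs w) = {1..n}" using F w by (simp add: wforest_def)
  have "1 \<in> set (leaves (hd w))"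
  proof (cases "length w = 1")
    case True
    then obtain t where "w = [t]" by (auto simp: length_Suc_conv)
    then show ?thesis using set n by auto
  next
    case False
    then show ?thesis using wchain_long_word[OF S] w by blast
  qed
  then have "w \<in> root_words {1..n} 1" using w' set by (simp add: root_words_def)
  then show ?thesis using S w by blast
qed

lemma wchain_falling:
  assumes n: "n \<ge> 1" and C: "wchain n {w} C"
  shows "C \<in> falling n"
proof -
  have "hd C = wpart {w}" "C \<noteq> []" using wchain_hd[OF C] by auto
  then have "card (hd C) = 1" by (simp add: wpart_def)
  then show ?thesis
    using wchain_acov[OF C] \<open>C \<noteq> []\<close> falling_iff[OF n] top_chains_iff[OF n] by simp
qed

lemma good_snoc: "good (D @ [z, y, x]) \<longleftrightarrow> good (D @ [z, y]) \<and> (pts y = pts z \<longrightarrow> pts x = pts y)"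
proof (induction D rule: induct_list012)
  case (2 a)
  then show ?case by auto
next
  case (3 a b D)
  have step: "good (a # b # Q) \<longleftrightarrow> (pts b = pts a \<longrightarrow> pts (hd Q) = pts b) \<and> good (b # Q)" if "Q \<noteq> []" for Q
    using that by (cases Q) auto
  have "hd (D @ [z, y, x]) = hd (D @ [z, y])" by (cases D) auto
  then show ?case using 3(2) step[of "D @ [z, y, x]"] step[of "D @ [z, y]"] by (simp del: good.simps)
qed auto

text \<open>The negative labels are those of the merges that keep all points, and after a negative
  label all further labels are negative.\<close>

lemma fall_good: "acov n C \<Longrightarrow> fall C \<Longrightarrow> good (rev C)"
proof (induction C rule: fall.induct)
  case (1 x y z R)
  then have MP: "x \<in> MP n" "y \<in> MP n" "z \<in> MP n" "mp_less x y" "mp_less y z" "Suc (card x) = card y" "Suc (card y) = card z"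
    using acov_hd by auto
  have "good (rev (y # z # R))" using 1 by simp
  moreover have "pts y = pts z \<longrightarrow> pts x = pts y"
    using mlab_sign[OF MP(3,2,5,7)] mlab_sign[OF MP(2,1,4,6)] 1(3) by auto
  ultimately show ?case using good_snoc[of "rev R" z y x] by simp
qed auto

lemma pts_relabel: "pts (mp_relabel s x) = s ` pts x"
  by (simp add: pts_def mp_relabel_def image_UN image_image case_prod_unfold)

lemma good_relabel:
  assumes "inj s"
  shows "good (map (mp_relabel s) D) = good D"
  by (induction D rule: good.induct) (auto simp: pts_relabel inj_image_eq_iff[OF assms])

section \<open>The isomorphism in the top degree\<close>

definition word_chain :: "nat \<Rightarrow> mtree list \<Rightarrow> mpart list" where
  "word_chain n w = (THE C. wchain n {w} C)"

definition word_sign :: "nat \<Rightarrow> mtree list \<Rightarrow> 'k::comm_ring_1" where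
  "word_sign n w = (SOME \<epsilon>. (\<epsilon> = 1 \<or> \<epsilon> = - 1)
     \<and> (\<forall>u. top_val n (tl (rev (word_chain n w))) u = \<epsilon> * comb w u))"

lemma word_chain_wchain:
  assumes "n \<ge> 1" "w \<in> root_words {1..n} 1"
  shows "wchain n {w} (word_chain n w)"
proof -
  obtain C where C: "wchain n {w} C" using wchain_word_ex[OF assms] by blast
  then have "word_chain n w = C" unfolding word_chain_def using wchain_unique by blast
  then show ?thesis using C by simp
qed

lemma word_chain_falling: "n \<ge> 1 \<Longrightarrow> w \<in> root_words {1..n} 1 \<Longrightarrow> word_chain n w \<in> falling n"
  using wchain_falling word_chain_wchain by blast

lemma falling_word_chain:
  assumes "n \<ge> 1" "C \<in> falling n"
  obtains w where "w \<in> root_words {1..n} 1" "C = word_chain n w"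
proof -
  obtain w where w: "w \<in> root_words {1..n} 1" "wchain n {w} C" using falling_wchain[OF assms] by blast
  then have "C = word_chain n w" using wchain_unique word_chain_wchain[OF assms(1)] by blast
  then show thesis using that w by blast
qed

lemma word_sign:
  assumes "n \<ge> 1" "w \<in> root_words {1..n} 1"
  shows "word_sign n w = (1 :: 'k::comm_ring_1) \<or> word_sign n w = (- 1 :: 'k)"
    "top_val n (tl (rev (word_chain n w))) = (\<lambda>u. word_sign n w * comb w u :: 'k)"
proof -
  have "(word_sign n w = (1 :: 'k) \<or> word_sign n w = (- 1 :: 'k))
      \<and> (\<forall>u. top_val n (tl (rev (word_chain n w))) u = (word_sign n w :: 'k) * comb w u)"
    unfolding word_sign_def by (rule someI_ex) (rule wchain_top_val[OF word_chain_wchain[OF assms]])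
  then show "word_sign n w = (1 :: 'k) \<or> word_sign n w = (- 1 :: 'k)"
    "top_val n (tl (rev (word_chain n w))) = (\<lambda>u. word_sign n w * comb w u :: 'k)" by auto
qed

lemma word_sign_square:
  "n \<ge> 1 \<Longrightarrow> w \<in> root_words {1..n} 1 \<Longrightarrow> word_sign n w * word_sign n w = (1 :: 'k::comm_ring_1)"
  using word_sign(1)[of n w, where 'k = 'k] by auto

text \<open>The chain determines its value, which is plus or minus \<open>comb w\<close>. Over the
  integers its coefficient at \<open>w\<close> is nonzero, and \<open>comb_dual_root_words\<close>
  then identifies the words.\<close>

lemma word_chain_inj: "n \<ge> 1 \<Longrightarrow> inj_on (word_chain n) (root_words {1..n} 1)"
proof (rule inj_onI)
  fix w w' assume n: "n \<ge> 1" and w: "w \<in> root_words {1..n} 1" "w' \<in> root_words {1..n} 1"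
    and eq: "word_chain n w = word_chain n w'"
  have "(word_sign n w :: int) * comb w w = word_sign n w' * comb w' w"
    using word_sign(2)[OF n w(1), where 'k = int] word_sign(2)[OF n w(2), where 'k = int] eq by metis
  moreover have "(comb w w :: int) = 1" using comb_dual_root_words[OF w(1,1)] by simp
  moreover have "(word_sign n w :: int) \<noteq> 0" using word_sign(1)[OF n w(1), where 'k = int] by auto
  ultimately have "(comb w' w :: int) \<noteq> 0" by auto
  then show "w = w'" unfolding comb_dual_root_words[OF w(2,1)] by (simp split: if_splits)
qed

lemma finite_root_words:
  assumes "n \<ge> 1"
  shows "finite (root_words {1..n} 1)"
proof (rule finite_imageD[OF finite_subset[OF _ finite_chains] word_chain_inj[OF assms]])
  show "word_chain n ` root_words {1..n} 1 \<subseteq> chains n (n - 1)"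
    using word_chain_falling[OF assms] by (auto simp: falling_def)
qed

text \<open>A linear functional on \<open>LieMag n\<close> with prescribed values at the basis \<open>comb w\<close>, written down by
  means of the dual basis: the coefficients at the words whose first tree contains 1.\<close>
definition pairing :: "nat \<Rightarrow> (mpart list \<Rightarrow> 'k::comm_ring_1) \<Rightarrow> 'k tens \<Rightarrow> 'k" where
  "pairing n f x = (\<Sum>w\<in>root_words {1..n} 1. x w * (word_sign n w * f (word_chain n w)))"

lemma pairing_sum: "pairing n f (\<lambda>u. \<Sum>i\<in>I. c i * x i u) = (\<Sum>i\<in>I. c i * pairing n f (x i))"
  unfolding pairing_def sum_distrib_left sum_distrib_right
  by (subst sum.swap) (simp add: mult.assoc)

lemma pairing_scale: "pairing n f (\<lambda>u. r * x u) = r * pairing n f x"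
  by (simp add: pairing_def sum_distrib_left mult.assoc)

lemma pairing_add: "pairing n f (\<lambda>u. x u + y u) = pairing n f x + pairing n f y"
  by (simp add: pairing_def sum.distrib distrib_right)

lemma pairing_comb:
  fixes f :: "mpart list \<Rightarrow> 'k::comm_ring_1"
  assumes n: "n \<ge> 1" and w: "w \<in> root_words {1..n} 1"
  shows "pairing n f (comb w) = word_sign n w * f (word_chain n w)"
proof -
  have "pairing n f (comb w) = (\<Sum>w'\<in>root_words {1..n} 1. if w = w' then word_sign n w' * f (word_chain n w') else 0)"
    unfolding pairing_def
  proof (intro sum.cong refl)
    fix w' assume w': "w' \<in> root_words {1..n} 1"
    show "comb w w' * (word_sign n w' * f (word_chain n w'))
        = (if w = w' then word_sign n w' * f (word_chain n w') else 0)"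
      unfolding comb_dual_root_words[OF w w'] by simp
  qed
  then show ?thesis using finite_root_words[OF n] w by simp
qed

lemma (in el_labelling) dchain_replace:
  "dchain (P @ y # z # w # R) \<Longrightarrow> z' \<in> V \<Longrightarrow> lt z' y \<Longrightarrow> lt w z' \<Longrightarrow> dchain (P @ y # z' # w # R)"
proof (induction P)
  case (Cons p P)
  have "hd (P @ y # z # w # R) = hd (P @ y # z' # w # R)" by (cases P) auto
  then show ?case using Cons by (simp add: dchain_Cons_iff)
qed simp

lemma acov_adjacent: "acov n (A @ x # y # B) \<Longrightarrow> mp_less x y \<and> Suc (card x) = card y"
proof (induction A)
  case (Cons a A)
  then show ?case by (cases A) auto
qed simp

text \<open>The boundary of \<open>f\<close> is evaluated at the chain without \<open>z\<close>. The
  maximal chains having it as a facet arise by inserting an element between \<open>w\<close> and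
  \<open>y\<close>, and they all carry the same sign.\<close>

lemma cycle_interval_sum:
  fixes f :: "mpart list \<Rightarrow> 'k::comm_ring_1"
  assumes n: "n \<ge> 1" and f: "f \<in> cycles n (n - 1)" and C: "rev (P @ y # z # w # R) \<in> chains n (n - 1)"
  shows "(\<Sum>z'\<in>btw n y w. f (rev (P @ y # z' # w # R))) = 0"
    and "\<And>z'. z' \<in> btw n y w \<Longrightarrow> rev (P @ y # z' # w # R) \<in> chains n (n - 1)"
proof -
  let ?A = "rev R @ [w]" and ?B = "y # rev P"
  let ?c = "\<lambda>z'. ?A @ z' # ?B"
  have rev: "rev (P @ y # x # w # R) = ?c x" for x by simp
  have ac: "acov n (?c z)" using C top_chains_iff[OF n] rev by metis
  have wzy: "mp_less w z" "Suc (card w) = card z" "mp_less z y" "Suc (card z) = card y"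
    using acov_adjacent[of n "rev R" w z ?B] acov_adjacent[of n ?A z y "rev P"] ac by auto
  show ch: "rev (P @ y # z' # w # R) \<in> chains n (n - 1)" if "z' \<in> btw n y w" for z'
  proof -
    have "MPl.dchain n (P @ y # z' # w # R)"
      using C that MPl.dchain_replace[of n P y z w R z'] chains_iff[OF n] by (auto simp: btw_def)
    moreover have "hd (?c z') = hd (?c z)" "last (?c z') = last (?c z)" by (cases "rev R"; simp)+
    moreover have "length (?c z') = length (?c z)" by simp
    ultimately show ?thesis using C unfolding chains_iff[OF n] rev rev_rev_ident by (metis rev rev_rev_ident)
  qed
  have zero: "inc (n - 1) c (?A @ ?B) = (0 :: 'k)" if c: "c \<in> chains n (n - 1) - ?c ` btw n y w" for c
  proof (rule ccontr)
    assume nz: "inc (n - 1) c (?A @ ?B) \<noteq> (0 :: 'k)"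
    have acc: "acov n c" and len: "length c = Suc (n - 1)"
      using c top_chains_iff[OF n] chains_iff[OF n] by blast+
    obtain p x q where pq: "c = p @ x # q" "?A @ ?B = p @ q" using inc_nonzero[OF nz len] by metis
    \<comment> \<open>The ranks of \<open>w\<close> and \<open>y\<close> differ by two, so they
      cannot be neighbours in a maximal chain; the additional element must separate them.\<close>
    have nadj: False if "c = A @ w # y # B" for A B
      using acov_adjacent[of n A w y B] acc that wzy by simp
    have btwn: False if e: "p = ?A" "q = ?B"
    proof -
      have cx: "c = ?c x" using pq e by simp
      have "mp_less w x" "Suc (card w) = card x" "mp_less x y" "Suc (card x) = card y"
        using acov_adjacent[of n "rev R" w x ?B] acov_adjacent[of n ?A x y "rev P"] acc cx by auto
      moreover have "x \<in> MP n" using acov_sorted[OF acc] cx by auto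
      ultimately have "x \<in> btw n y w" by (simp add: btw_def)
      then show False using c cx by blast
    qed
    have "\<exists>us. ?A = p @ us \<and> us @ ?B = q \<or> ?A @ us = p \<and> ?B = us @ q"
      using pq(2) unfolding append_eq_append_conv2[of ?A ?B p q] .
    then consider us where "?A = p @ us" "us @ ?B = q" | us where "?A @ us = p" "?B = us @ q"
      by blast
    then show False
    proof cases
      case (1 us)
      show False
      proof (cases us rule: rev_cases)
        case Nil
        then show False using btwn 1 by simp
      next
        case (snoc us' a)
        then have "a = w" using 1(1) by (metis append_assoc last_snoc)
        then have "c = (p @ x # us') @ w # y # rev P" using pq 1 snoc by simp
        then show False by (rule nadj)
      qed
    next
      case (2 us)
      show False
      proof (cases us)
        case Nil
        then show False using btwn 2 by simp
      next
        case (Cons a us')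
        then have "a = y" using 2(2) by simp
        then have "c = rev R @ w # y # (us' @ x # q)" using pq 2(1) Cons by auto
        then show False by (rule nadj)
      qed
    qed
  qed
  have sg: "inc (n - 1) (?c z') (?A @ ?B) = (- 1 :: 'k) ^ length ?A" if "z' \<in> btw n y w" for z'
  proof (rule inc_facet)
    have c: "?c z' \<in> chains n (n - 1)" using ch[OF that] rev by metis
    show "distinct (?A @ z' # ?B)" by (rule distinct_chain[OF c])
    show "length (?A @ z' # ?B) = Suc (n - 1)" using c chains_iff[OF n] by blast
  qed auto
  have "0 = bd n (n - 1) f (?A @ ?B)" using f by (simp add: cycles_def)
  also have "\<dots> = (\<Sum>c\<in>?c ` btw n y w. inc (n - 1) c (?A @ ?B) * f c)"
    unfolding bd_inc
  proof (intro sum.mono_neutral_right finite_chains ballI)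
    show "?c ` btw n y w \<subseteq> chains n (n - 1)" using ch unfolding rev by blast
    fix c assume "c \<in> chains n (n - 1) - ?c ` btw n y w"
    then show "inc (n - 1) c (?A @ ?B) * f c = 0" using zero by simp
  qed
  also have "\<dots> = (\<Sum>z'\<in>btw n y w. inc (n - 1) (?c z') (?A @ ?B) * f (?c z'))"
    by (subst sum.reindex) (auto simp: inj_on_def)
  also have "\<dots> = (- 1) ^ length ?A * (\<Sum>z'\<in>btw n y w. f (?c z'))"
    unfolding sum_distrib_left by (intro sum.cong refl) (simp only: sg)
  finally have "(- 1 :: 'k) ^ length ?A * (\<Sum>z'\<in>btw n y w. f (?c z')) = 0" by simp
  then have "(- 1 :: 'k) ^ length ?A * ((- 1) ^ length ?A * (\<Sum>z'\<in>btw n y w. f (?c z'))) = 0" by simp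
  then have "(\<Sum>z'\<in>btw n y w. f (?c z')) = 0"
    by (simp only: mult.assoc[symmetric] power_mult_distrib[symmetric]) simp
  then show "(\<Sum>z'\<in>btw n y w. f (rev (P @ y # z' # w # R))) = 0" unfolding rev .
qed

lemma wrank_le: "wrank n l c \<le> card (chains n l)"
  unfolding wrank_def by (intro card_mono finite_chains) auto

text \<open>On good chains a cycle is determined by its values on the falling chains through the very
  relations that the Lie bracket satisfies, so it is computed by pairing with the value of the chain.\<close>
lemma cycle_eq_pairing:
  fixes f :: "mpart list \<Rightarrow> 'k::comm_ring_1"
  assumes n: "n \<ge> 1" and f: "f \<in> cycles n (n - 1)" and C: "C \<in> chains n (n - 1)" "good (rev C)"
  shows "f C = pairing n f (top_val n (tl (rev C)))"
  using C
proof (induction "card (chains n (n - 1)) - wrank n (n - 1) C" arbitrary: C rule: less_induct)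
  case less
  show ?case
  proof (cases "C \<in> falling n")
    case True
    then obtain w where w: "w \<in> root_words {1..n} 1" "C = word_chain n w" using falling_word_chain[OF n] by blast
    have "pairing n f (top_val n (tl (rev C))) = word_sign n w * (word_sign n w * f C)"
      unfolding w(2) word_sign(2)[OF n w(1)] pairing_scale pairing_comb[OF n w(1)] ..
    also have "\<dots> = f C" using word_sign_square[OF n w(1), where 'k = 'k] by (simp add: mult.assoc[symmetric])
    finally show ?thesis by simp
  next
    case False
    have Cc: "C \<noteq> []" "acov n C" "last C = top_mp n" "length C = n" "MPl.dchain n (rev C)"
      using less.prems(1) top_chains_iff[OF n] chains_iff[OF n] n by auto
    have "\<not> MPl.crit n (rev C)" using False less.prems(1) by (simp add: falling_def)
    then obtain P y z R where D: "rev C = P @ y # z # R"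
      "card y \<noteq> Suc (card z) \<or> (\<exists>w R'. R = w # R' \<and> z = MPo.fst_step n w y)"
      using MPl.not_crit_split by blast
    have Ceq: "C = rev R @ z # y # rev P"
      using arg_cong[OF D(1), of rev] by simp
    have zy: "mp_less z y" "Suc (card z) = card y" using acov_adjacent[of n "rev R" z y "rev P"] Cc(2) Ceq by auto
    \<comment> \<open>A maximal chain has no gaps, so the irregularity is an element that equals its
      first step, that is, an ascent.\<close>
    then obtain w R' where R: "R = w # R'" "z = MPo.fst_step n w y" using D(2) by auto
    have wz: "mp_less w z" "Suc (card w) = card z"
      using acov_adjacent[of n "rev R'" w z "y # rev P"] Cc(2) Ceq R(1) by auto
    have MP: "y \<in> MP n" "z \<in> MP n" "w \<in> MP n" using acov_sorted[OF Cc(2)] Ceq R(1) by auto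
    let ?c = "\<lambda>x. rev (P @ y # x # w # R')"
    have Cz: "C = ?c z" using Ceq R(1) by simp
    have revc: "rev (?c x) = P @ y # x # w # R'" for x by simp
    have zb: "z \<in> btw n y w" using MP zy wz by (simp add: btw_def)
    note cyc = cycle_interval_sum[OF n f less.prems(1)[unfolded Cz]]
    have wy: "mp_less w y" using mp_less_trans[OF MP(3,2,1) wz(1) zy(1)] .
    have lab: "mlab y z < mlab z w"
      using MPl.ascent'[OF MP(3,1,2) zy wz(1)] R(2) MPl.fst_step_cover[OF MP(3,2) wz] by simp
    have gd: "good (P @ y # z # w # R')" using less.prems(2) Cz revc by metis
    have g3: "pts z = pts y \<longrightarrow> pts w = pts z"
    proof -
      have "good (P @ y # z # w # R') \<Longrightarrow> good (y # z # w # R')" for P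
      proof (induction P rule: induct_list012)
        case (2 a) then show ?case by simp
      next
        case (3 a b P) then show ?case by (cases P) auto
      qed auto
      from this[OF gd] show ?thesis by simp
    qed
    \<comment> \<open>The first step \<open>z\<close> has the least label below \<open>y\<close>, so
      any other chain of the interval has a larger label word and hence a larger
      \<open>wrank\<close>; it is still good.\<close>
    have IH: "f (?c x) = pairing n f (top_val n (tl (rev (?c x))))" if x: "x \<in> btw n y w" "x \<noteq> z" for x
    proof (rule less.hyps)
      show cx: "?c x \<in> chains n (n - 1)" using cyc(2)[OF x(1)] .
      show "good (rev (?c x))" unfolding revc
        using good_replace[OF gd] ascent_interval_types(2,3)[OF MP(1,3) zb x(1) lab g3] by blast
      have xs: "x \<in> MP n" "mp_less x y" "card y = Suc (card x)" "mp_less w x" using x(1) by (auto simp: btw_def)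
      have "x \<in> MPo.cc n w y" using xs by (simp add: MPo.cc_def)
      then have "mlab y z < mlab y x" using MPl.fst_step_lab_less[OF MP(3,1) wy] R(2) x(2) by simp
      moreover have "MPl.dchain n (P @ y # z # w # R')" "MPl.dchain n (P @ y # x # w # R')"
        using Cc(5) cx chains_iff[OF n] Cz revc by metis+
      ultimately have "(MPl.wlab n (P @ y # z # w # R'), MPl.wlab n (P @ y # x # w # R')) \<in> lexord {(a, b). a < b}"
        using MPl.wlab_replace_less[of n P y z "w # R'" x] zy(2) xs(3) by simp
      then have "wrank n (n - 1) C < wrank n (n - 1) (?c x)"
        using wrank_less[OF less.prems(1), of "?c x"] Cz revc by simp
      moreover have "wrank n (n - 1) (?c x) \<le> card (chains n (n - 1))" by (rule wrank_le)
      ultimately show "card (chains n (n - 1)) - wrank n (n - 1) (?c x) < card (chains n (n - 1)) - wrank n (n - 1) C"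
        by linarith
    qed
    have "(\<Sum>x\<in>btw n y w. pairing n f (top_val n (tl (rev (?c x))))) = 0"
    proof -
      \<comment> \<open>Evaluation starts after the finest partition, which \<open>tl\<close>
        removes. If \<open>P\<close> is empty, the removed element is \<open>y\<close>
        itself.\<close>
      obtain Q where Q: "\<And>x. tl (P @ y # x # w # R') = Q @ x # w # R'" "y = last (top_mp n # Q)" "length Q = length P"
      proof (cases P)
        case Nil
        have "y = top_mp n" using Cc(3) Cz Nil by simp
        then show thesis using that[of "[]"] Nil by simp
      next
        case (Cons p P')
        then show thesis using that[of "P' @ [y]"] by simp
      qed
      have "n = length Q + length R' + 3" using Cc(4) Cz Q(3) by simp
      then have s: "(\<Sum>x\<in>btw n y w. top_val n (Q @ x # w # R') u) = (0 :: 'k)" for u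
        using ascent_interval_types(1)[OF MP(1,3) zb zb lab g3] Q(2) by (intro top_val_interval_sum)
      have "(\<Sum>x\<in>btw n y w. 1 * pairing n f (top_val n (Q @ x # w # R')))
          = pairing n f (\<lambda>u. \<Sum>x\<in>btw n y w. 1 * top_val n (Q @ x # w # R') u)"
        by (rule pairing_sum[symmetric])
      also have "\<dots> = 0" by (simp add: s pairing_def)
      finally show ?thesis unfolding revc Q(1) by simp
    qed
    \<comment> \<open>The cycle and the pairing satisfy the same relation on this interval and agree
      at every other element, hence also at \<open>z\<close>.\<close>
    then have "(\<Sum>x\<in>btw n y w. f (?c x) - pairing n f (top_val n (tl (rev (?c x))))) = 0"
      using cyc(1) by (simp only: sum_subtractf) simp
    moreover have "(\<Sum>x\<in>btw n y w. f (?c x) - pairing n f (top_val n (tl (rev (?c x)))))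
        = (\<Sum>x\<in>{z}. f (?c x) - pairing n f (top_val n (tl (rev (?c x)))))"
      using zb IH finite_btw by (intro sum.mono_neutral_right) auto
    ultimately have "f (?c z) - pairing n f (top_val n (tl (rev (?c z)))) = 0" by simp
    then show ?thesis unfolding Cz by simp
  qed
qed

section \<open>Action of permutations on chains, and equivariance\<close>

lemma mp_relabel_image: "mp_relabel s x = (\<lambda>b. (s ` fst b, s ` snd b)) ` x"
  by (simp add: mp_relabel_def case_prod_unfold)

lemma mp_relabel_MP:
  assumes s: "s permutes {1..n}" and x: "x \<in> MP n"
  shows "mp_relabel s x \<in> MP n"
  unfolding MP_iff
proof (intro conjI ballI impI)
  have inj: "inj s" using s by (rule permutes_inj)
  fix b assume "b \<in> mp_relabel s x"
  then obtain b' where b': "b' \<in> x" "b = (s ` fst b', s ` snd b')" by (auto simp: mp_relabel_image)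
  then show "snd b \<noteq> {}" "snd b \<subseteq> fst b" using MP_block(1,2)[OF x b'(1)] by auto
  fix c assume "c \<in> mp_relabel s x" and ne: "b \<noteq> c"
  then obtain c' where c': "c' \<in> x" "c = (s ` fst c', s ` snd c')" by (auto simp: mp_relabel_image)
  then have "b' \<noteq> c'" using ne b' by auto
  then have "fst b' \<inter> fst c' = {}" using MP_disj[OF x b'(1) c'(1)] by blast
  then show "fst b \<inter> fst c = {}" using b' c' image_Int[OF inj] by (metis fst_conv image_empty)
next
  have "\<Union> (fst ` mp_relabel s x) = s ` \<Union> (fst ` x)" by (simp add: mp_relabel_image image_image image_UN)
  also have "\<dots> = {1..n}" using x permutes_image[OF s] by (simp add: MP_iff)
  finally show "\<Union> (fst ` mp_relabel s x) = {1..n}" .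
qed

lemma mp_relabel_less:
  assumes s: "s permutes {1..n}" and x: "x \<in> MP n" and y: "y \<in> MP n" and xy: "mp_less x y"
  shows "mp_less (mp_relabel s x) (mp_relabel s y)"
proof -
  have inj: "inj s" using s by (rule permutes_inj)
  have le: "\<forall>b\<in>y. \<exists>c\<in>x. fst b \<subseteq> fst c \<and> (snd b \<subseteq> snd c \<or> snd b \<inter> snd c = {})" "pts x \<subseteq> pts y"
    using xy mp_le_iff[OF x y] by (simp_all add: mp_less_def)
  have "mp_le (mp_relabel s x) (mp_relabel s y)"
    unfolding mp_le_iff[OF mp_relabel_MP[OF s x] mp_relabel_MP[OF s y]]
  proof (intro conjI ballI)
    fix b assume "b \<in> mp_relabel s y"
    then obtain b' where b': "b' \<in> y" "b = (s ` fst b', s ` snd b')" by (auto simp: mp_relabel_image)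
    then obtain c where c: "c \<in> x" "fst b' \<subseteq> fst c" "snd b' \<subseteq> snd c \<or> snd b' \<inter> snd c = {}" using le(1) by blast
    have "s ` snd b' \<subseteq> s ` snd c \<or> s ` snd b' \<inter> s ` snd c = {}"
      using c(3) image_Int[OF inj, of "snd b'" "snd c"] by auto
    moreover have "(s ` fst c, s ` snd c) \<in> mp_relabel s x" using c(1) by (auto simp: mp_relabel_image)
    ultimately show "\<exists>c\<in>mp_relabel s x. fst b \<subseteq> fst c \<and> (snd b \<subseteq> snd c \<or> snd b \<inter> snd c = {})"
      using b' c(2) by (intro bexI[of _ "(s ` fst c, s ` snd c)"]) auto
  next
    show "pts (mp_relabel s x) \<subseteq> pts (mp_relabel s y)" using le(2) by (auto simp: pts_relabel)
  qed
  then show ?thesis using xy inj_mp_relabel[OF inj] by (simp add: mp_less_def)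
qed

lemma card_mp_relabel:
  assumes "inj s"
  shows "card (mp_relabel s x) = card x"
  unfolding mp_relabel_image
  by (intro card_image inj_onI prod_eqI) (use assms in \<open>auto simp: inj_image_eq_iff\<close>)

lemma mp_relabel_top:
  assumes s: "s permutes {1..n}"
  shows "mp_relabel s (top_mp n) = top_mp n"
proof -
  have "mp_relabel s (top_mp n) = (\<lambda>i. ({i}, {i})) ` (s ` {1..n})"
    by (simp add: mp_relabel_image top_mp_def image_image)
  then show ?thesis unfolding permutes_image[OF s] top_mp_def .
qed

lemma chains_relabel:
  assumes n: "n \<ge> 1" and s: "s permutes {1..n}" and C: "C \<in> chains n l"
  shows "map (mp_relabel s) C \<in> chains n l"
proof -
  have C': "length C = Suc l" "set C \<subseteq> MP n" "sorted_wrt mp_less C" "card (hd C) = 1" "last C = top_mp n"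
    using C chains_iff[OF n] by (auto simp: MPl.dchain_iff_sorted sorted_wrt_rev)
  then have ne: "C \<noteq> []" by auto
  have "sorted_wrt mp_less (map (mp_relabel s) C)"
    using C'(2,3) mp_relabel_less[OF s] unfolding sorted_wrt_map by (induction C) auto
  moreover have "set (map (mp_relabel s) C) \<subseteq> MP n" using C'(2) mp_relabel_MP[OF s] by auto
  moreover have "card (hd (map (mp_relabel s) C)) = 1"
    using C'(4) ne card_mp_relabel[OF permutes_inj[OF s]] by (simp add: hd_map)
  moreover have "last (map (mp_relabel s) C) = top_mp n"
    using C'(5) ne mp_relabel_top[OF s] by (simp add: last_map)
  ultimately show ?thesis using C'(1) chains_iff[OF n] by (simp add: MPl.dchain_iff_sorted sorted_wrt_rev)
qed

text \<open>It suffices to look at the basis \<open>comb w\<close>. A relabelled falling chain need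
  not be falling, but it is good, so \<open>cycle_eq_pairing\<close> still computes the cycle there;
  \<open>top_val_relabel\<close> supplies the sign.\<close>

lemma pairing_equivariant:
  fixes f :: "mpart list \<Rightarrow> 'k::comm_ring_1"
  assumes n: "n \<ge> 1" and f: "f \<in> cycles n (n - 1)" and s: "s permutes {1..n}" and x: "x \<in> LieMag n"
  shows "pairing n (chain_act s f) x = of_int (sign s) * pairing n f (tens_act (inv s) x)"
proof -
  let ?W = "root_words {1..n} 1"
  have s': "inv s permutes {1..n}" using permutes_inv[OF s] .
  have sg: "sign (inv s) = sign s" using sign_inverse s permutes_imp_permutation by blast
  have term_eq: "word_sign n w * chain_act s f (word_chain n w)
      = of_int (sign s) * pairing n f (tens_act (inv s) (comb w))" if w: "w \<in> ?W" for w
  proof -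
    let ?C = "word_chain n w"
    have fC: "?C \<in> chains n (n - 1)" "fall ?C" using word_chain_falling[OF n w] falling_iff[OF n] by auto
    then have ac: "acov n ?C" using top_chains_iff[OF n] by blast
    have len: "length ?C = n" using fC(1) chains_iff[OF n] n by simp
    have "good (rev (map (mp_relabel (inv s)) ?C))"
      unfolding rev_map using good_relabel[OF permutes_inj[OF s']] fall_good[OF ac fC(2)] by simp
    then have "chain_act s f ?C = pairing n f (top_val n (tl (rev (map (mp_relabel (inv s)) ?C))))"
      unfolding chain_act_def using chains_relabel[OF n s' fC(1)] by (intro cycle_eq_pairing[OF n f])
    also have "tl (rev (map (mp_relabel (inv s)) ?C)) = map (mp_relabel (inv s)) (tl (rev ?C))"
      by (simp add: rev_map map_tl)
    also have "top_val n \<dots> = (\<lambda>u. of_int (sign s) * tens_act (inv s) (top_val n (tl (rev ?C)) :: 'k tens) u)"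
      using top_val_relabel[OF s', of "tl (rev ?C)"] len n sg by simp
    also have "tens_act (inv s) (top_val n (tl (rev ?C)) :: 'k tens) = (\<lambda>u. word_sign n w * tens_act (inv s) (comb w) u)"
      unfolding word_sign(2)[OF n w] by (simp add: tens_act_def)
    finally have "chain_act s f ?C = of_int (sign s) * (word_sign n w * pairing n f (tens_act (inv s) (comb w)))"
      unfolding pairing_scale .
    then have "word_sign n w * chain_act s f ?C
        = (word_sign n w * word_sign n w) * (of_int (sign s) * pairing n f (tens_act (inv s) (comb w)))"
      by (simp only: mult_ac)
    then show ?thesis by (simp only: word_sign_square[OF n w] mult_1)
  qed
  have xe: "x = (\<lambda>u. \<Sum>w\<in>?W. x w * comb w u)" by (rule LieMag_expansion[OF n finite_root_words[OF n] x])
  have "tens_act (inv s) x = (\<lambda>u. \<Sum>w\<in>?W. x w * tens_act (inv s) (comb w) u)"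
    unfolding tens_act_def using xe by (metis (no_types))
  then have "pairing n f (tens_act (inv s) x) = (\<Sum>w\<in>?W. x w * pairing n f (tens_act (inv s) (comb w)))"
    by (simp only: pairing_sum)
  then have "of_int (sign s) * pairing n f (tens_act (inv s) x)
      = (\<Sum>w\<in>?W. x w * (of_int (sign s) * pairing n f (tens_act (inv s) (comb w))))"
    by (simp only: sum_distrib_left mult.left_commute)
  also have "\<dots> = (\<Sum>w\<in>?W. x w * (word_sign n w * chain_act s f (word_chain n w)))"
    using term_eq by (intro sum.cong refl) simp
  finally show ?thesis by (simp add: pairing_def)
qed

lemma comb_LieMag:
  "n \<ge> 1 \<Longrightarrow> w \<in> root_words {1..n} 1 \<Longrightarrow> comb w \<in> (LieMag n :: 'k::comm_ring_1 tens set)"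
  using LieMag_eq_comb_span[of n] kspan_base by blast

text \<open>Members of \<open>LieMag_dual\<close> are linear on \<open>LieMag n\<close> only, so the
  induction also keeps the partial sums inside \<open>LieMag n\<close>.\<close>

lemma dual_expansion:
  fixes g :: "'k::comm_ring_1 tens \<Rightarrow> 'k"
  assumes n: "n \<ge> 1" and g: "g \<in> LieMag_dual n" and x: "x \<in> LieMag n"
  shows "g x = (\<Sum>w\<in>root_words {1..n} 1. x w * g (comb w))"
proof -
  have lin: "g (\<lambda>w. x w + y w) = g x + g y" "g (\<lambda>w. r * x w) = r * g x"
    if "x \<in> LieMag n" "y \<in> LieMag n" for x y r
    using g that unfolding LieMag_dual_def by blast+
  have mem: "(\<lambda>u. r * b u + y u) \<in> LieMag n" "(\<lambda>u. r * b u) \<in> LieMag n"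
    if "b \<in> LieMag n" "y \<in> LieMag n" for b y :: "'k tens" and r
    using that kspan_lin kspan_scale unfolding LieMag_def by blast+
  have "finite F \<Longrightarrow> F \<subseteq> root_words {1..n} 1 \<Longrightarrow> (\<lambda>u. \<Sum>w\<in>F. x w * comb w u) \<in> LieMag n
      \<and> g (\<lambda>u. \<Sum>w\<in>F. x w * comb w u) = (\<Sum>w\<in>F. x w * g (comb w))" for F
  proof (induction F rule: finite_induct)
    case empty
    have z: "(\<lambda>_. 0) \<in> (LieMag n :: 'k tens set)" unfolding LieMag_def by (rule kspan_zero)
    then show ?case using lin(2)[OF z z, of 0] by simp
  next
    case (insert w F)
    have c: "comb w \<in> (LieMag n :: 'k tens set)" using comb_LieMag[OF n] insert.prems by blast
    have IH: "(\<lambda>u. \<Sum>w\<in>F. x w * comb w u) \<in> LieMag n"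
      "g (\<lambda>u. \<Sum>w\<in>F. x w * comb w u) = (\<Sum>w\<in>F. x w * g (comb w))" using insert by auto
    show ?case
      using mem(1)[OF c IH(1), of "x w"] lin(1)[OF mem(2)[OF c c, of "x w"] IH(1)] lin(2)[OF c c, of "x w"] IH(2) insert(1,2)
      by simp
  qed
  from this[OF finite_root_words[OF n] subset_refl]
  show ?thesis using LieMag_expansion[OF n finite_root_words[OF n] x] by metis
qed

lemma top_homology_iso:
  assumes n: "n \<ge> 1"
  shows "homology_iso n (cycles n (n - 1) :: (mpart list \<Rightarrow> 'k::comm_ring_1) set) (boundaries n (n - 1)) chain_act
    (LieMag_dual n :: ('k tens \<Rightarrow> 'k) set) (dual_sgn_act n)"
proof -
  let ?Z = "cycles n (n - 1) :: (mpart list \<Rightarrow> 'k) set" and ?L = "LieMag n :: 'k tens set"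
  let ?W = "root_words {1..n} 1"
  \<comment> \<open>The cut-off matches the convention that dual elements vanish outside
    \<open>LieMag n\<close>. At \<open>comb w\<close> the value is
    \<open>word_sign n w * f (word_chain n w)\<close>.\<close>
  define \<phi> where "\<phi> = (\<lambda>(f :: mpart list \<Rightarrow> 'k) (x :: 'k tens). if x \<in> ?L then pairing n f x else 0)"
  have add: "\<phi> (\<lambda>x. f x + g x) = (\<lambda>y. \<phi> f y + \<phi> g y)" for f g
    by (simp add: \<phi>_def fun_eq_iff pairing_def distrib_left sum.distrib)
  have scale: "\<phi> (\<lambda>x. r * f x) = (\<lambda>y. r * \<phi> f y)" for r f
    by (simp add: \<phi>_def fun_eq_iff pairing_def sum_distrib_left mult.left_commute)
  have into: "\<phi> f \<in> LieMag_dual n" for f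
  proof -
    have "(\<lambda>w. x w + y w) \<in> ?L" if "x \<in> ?L" "y \<in> ?L" for x y
      using that kspan_add unfolding LieMag_def by blast
    moreover have "(\<lambda>w. r * x w) \<in> ?L" if "x \<in> ?L" for x r
      using that kspan_scale unfolding LieMag_def by blast
    ultimately show ?thesis by (simp add: LieMag_dual_def \<phi>_def pairing_add pairing_scale)
  qed
  have onto: "\<exists>f\<in>?Z. \<phi> f = g" if g: "g \<in> LieMag_dual n" for g :: "'k tens \<Rightarrow> 'k"
  proof -
    \<comment> \<open>The values on falling chains for which the pairing reproduces \<open>g\<close>
      on the basis; \<open>word_sign\<close> is its own inverse.\<close>
    define u where "u = (\<lambda>C. let w = the_inv_into ?W (word_chain n) C in word_sign n w * g (comb w))"
    obtain f where f: "f \<in> ?Z" "\<forall>c\<in>falling n. f c = u c" using top_cycle_exists[OF n, of u] by blast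
    have "word_sign n w * f (word_chain n w) = g (comb w)" if w: "w \<in> ?W" for w
    proof -
      have "f (word_chain n w) = word_sign n w * g (comb w)"
        using f(2) word_chain_falling[OF n w] the_inv_into_f_f[OF word_chain_inj[OF n] w] by (simp add: u_def)
      then show ?thesis using word_sign_square[OF n w, where 'k = 'k] by (simp add: mult.assoc[symmetric])
    qed
    then have "pairing n f x = g x" if "x \<in> ?L" for x
      using dual_expansion[OF n g that] by (simp add: pairing_def)
    moreover have "g x = 0" if "x \<notin> ?L" for x using g that by (simp add: LieMag_dual_def)
    ultimately have "\<phi> f = g" by (auto simp: \<phi>_def)
    then show ?thesis using f(1) by blast
  qed
  have ker: "\<phi> f = (\<lambda>_. 0) \<longleftrightarrow> f \<in> boundaries n (n - 1)" if f: "f \<in> ?Z" for f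
  proof
    assume z: "\<phi> f = (\<lambda>_. 0)"
    have "f = (\<lambda>_. 0)"
    proof (rule top_cycle_unique[OF n f])
      fix c assume "c \<in> falling n"
      then obtain w where w: "w \<in> ?W" "c = word_chain n w" using falling_word_chain[OF n] by blast
      have "\<phi> f (comb w) = word_sign n w * f c"
        using comb_LieMag[OF n w(1), where 'k = 'k] pairing_comb[OF n w(1), of f] w(2) by (simp add: \<phi>_def)
      then have "word_sign n w * f c = 0" using z by simp
      then have "(word_sign n w * word_sign n w) * f c = 0" by (simp only: mult.assoc mult_zero_right)
      then show "f c = 0" using word_sign_square[OF n w(1), where 'k = 'k] by simp
    qed
    then show "f \<in> boundaries n (n - 1)" unfolding top_boundaries[OF n] by simp
  next
    assume "f \<in> boundaries n (n - 1)"
    then have "f = (\<lambda>_. 0)" unfolding top_boundaries[OF n] by simp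
    then show "\<phi> f = (\<lambda>_. 0)" by (simp add: \<phi>_def pairing_def fun_eq_iff)
  qed
  have equi: "\<phi> (chain_act s f) = dual_sgn_act n s (\<phi> f)" if "s permutes {1..n}" "f \<in> ?Z" for s f
    using pairing_equivariant[OF n that(2,1)] LieMag_tens_act[OF permutes_inv[OF that(1)]]
    by (auto simp: \<phi>_def dual_sgn_act_def fun_eq_iff)
  show ?thesis
    unfolding homology_iso_def
  proof (intro exI[of _ \<phi>] conjI)
    show "\<phi> ` ?Z = LieMag_dual n" using into onto by (auto simp: image_iff)
  qed (use add scale ker equi in blast)+
qed

theorem mainTheorem8:
  fixes n l :: nat
  assumes "admissible_coeffs TYPE('k::comm_ring_1)"
    and "n \<ge> 1"
  shows "(l = n - 1 \<longrightarrow>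
            homology_iso n (cycles n l :: (mpart list \<Rightarrow> 'k) set) (boundaries n l) chain_act
              (LieMag_dual n :: ('k tens \<Rightarrow> 'k) set) (dual_sgn_act n))
       \<and> (l \<noteq> n - 1 \<longrightarrow> (cycles n l :: (mpart list \<Rightarrow> 'k) set) = boundaries n l)"
  using top_homology_iso[OF assms(2)] acyclic_below_top[OF assms(2)] by blast



end
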